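(* Let $n$ and $m$ be positive integers. There is a bijection between the set of isomorphism classes (as toric varieties) of Bott manifolds of Bott--Samelson type determined by sequences in $[n]^m$ and the set of equivalence classes of $\mathrm{AOP}(n,m)$ under the relation $\approx$: \[ \{\mathcal{B}_{\mathbf i}:\mathbf i\in[n]^m\}/(\text{isomorphism})\stackrel{1:1}{\longleftrightarrow}\mathrm{AOP}(n,m)/\approx . \]
   Context: Notation: $[n]=\{1,\dots,n\}$. Bott manifolds. A Bott matrix of size $m$ is an $m\times m$ lower triangular integer matrix with all diagonal entries equal to $-1$. The Bott manifold determined by a Bott matrix $B$ is the smooth projective toric variety whose fan in $\mathbb{R}^m$ (lattice $\mathbb{Z}^m$) has primitive ray generators $\mathbf e_1,\dots,\mathbf e_m$ (standard basis) and $\mathbf v_1,\dots,\mathbf v_m$ (the columns of $B$), and whose maximal cones are spanned by the $m$-element sets $S$ of ray generators with $\{\mathbf e_i,\mathbf v_i\}\not\subseteq S$ for all $i\in[m]$. For $\mathbf i=(i_1,\dots,i_m)\in[n]^m$, the Bott matrix $B_{\mathbf i}=[b_{j,k}]$ is defined by: for $1\le k<j\le m$, $b_{j,k}=-2$ if $i_j=i_k$, $b_{j,k}=1$ if $|i_j-i_k|=1$, and $b_{j,k}=0$ otherwise; $b_{k,j}=0$; and $b_{j,j}=-1$. The Bott manifold determined by $B_{\mathbf i}$ is denoted $\mathcal{B}_{\mathbf i}$; such Bott manifolds are said to be of Bott--Samelson type. Assemblies. An ordered partition is a sequence $\tau=(\tau^1,\dots,\tau^r)$ of mutually disjoint nonempty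 sets; $U(\tau)=\tau^1\cup\cdots\cup\tau^r$ and $\min(\tau)=\min(U(\tau))$. An assembly of ordered partitions of $[m]$ is a sequence $\sigma=(\sigma_1,\dots,\sigma_\ell)$ of ordered partitions such that $\{U(\sigma_1),\dots,U(\sigma_\ell)\}$ is a partition of $[m]$ and $\min(\sigma_1)<\cdots<\min(\sigma_\ell)$; because of the latter condition it is identified with the set $\{\sigma_1,\dots,\sigma_\ell\}$. Writing $\sigma_a=(\sigma_a^1,\dots,\sigma_a^{r_a})$, the assembly has bound $n$ if $r_1+\cdots+r_\ell+(\ell-1)\le n$. $\mathrm{AOP}(n,m)$ is the set of assemblies of ordered partitions of $[m]$ with bound $n$. Relations. For an ordered partition $\eta=(\eta^1,\dots,\eta^r)$ put $\overline{\eta}=(\eta^r,\dots,\eta^1)$. For $\sigma=(\sigma_1,\dots,\sigma_\ell),\tau=(\tau_1,\dots,\tau_{\ell'})\in\mathrm{AOP}(n,m)$, $\sigma\sim\tau$ means $\ell=\ell'$ and, for each $a\in[\ell]$, $\tau_a=\sigma_a$ or $\tau_a=\overline{\sigma_a}$. Distinct integers $j,k\in[m]$ are neighbors in $\sigma$ if $k\in\sigma_a^b$ and $j\in\sigma_a^{b-1}\cup\sigma_a^b\cup\sigma_a^{b+1}$ for some $a,b$ (blocks with index outside $[r_a]$ are empty). For $j\in[m-1]$, $s_j\cdot\sigma$ is the assembly obtained from $\sigma$ by swapping the integers $j$ and $j+1$ (the ordered partitions being re-listed in increasing order of minima if needed); the simple transposition $s_j=(j,j+1)$ is an admissible transposition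 of $\sigma$ if $j$ and $j+1$ are not neighbors in $\sigma$. Finally, $\sigma\approx\tau$ means that there exist $\rho^{(0)},\dots,\rho^{(k)}\in\mathrm{AOP}(n,m)$ such that $\rho^{(0)}\sim\sigma$, $\rho^{(k)}\sim\tau$, and for each $i\in[k]$ there is an admissible transposition $s_{j_i}$ of $\rho^{(i-1)}$ with $s_{j_i}\cdot\rho^{(i-1)}=\rho^{(i)}$. *)

theory Defs
  imports
    "Jordan_Normal_Form.Matrix"
    "HOL-Library.Disjoint_Sets"
    "HOL-Library.FuncSet"
    "HOL-Algebra.Group"
    "HOL-Combinatorics.Transposition"
    Complex_Main
begin

section \<open>Toric varieties over the complex numbers\<close>

text \<open>
  The cocharacter and character lattices of the \<open>m\<close>-dimensional torus are both
  \<open>carrier_vec m :: int vec set\<close>, paired by the scalar product; a cone is a set of real vectors.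
\<close>

definition cone_span :: "nat \<Rightarrow> int vec set \<Rightarrow> real vec set" where
  "cone_span m S =
     {vec m (\<lambda>j. \<Sum>u\<in>S. c u * of_int (u $ j)) | c. \<forall>u\<in>S. 0 \<le> c u}"

text \<open>The monoid of lattice points of the dual cone.\<close>

definition dual_monoid :: "nat \<Rightarrow> real vec set \<Rightarrow> int vec set" where
  "dual_monoid m \<sigma> = {w \<in> carrier_vec m. \<forall>v\<in>\<sigma>. 0 \<le> map_vec of_int w \<bullet> v}"

text \<open>
  The closed points of the affine toric variety \<open>Spec \<complex>[dual_monoid m \<sigma>]\<close> are the monoid
  homomorphisms from \<open>dual_monoid m \<sigma>\<close> to the multiplicative monoid \<open>\<complex>\<close>. For
  \<open>\<sigma> = {0}\<close> these are the homomorphisms from the whole character lattice to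
  \<open>\<complex>\<close>; they never vanish, so they form the torus.
\<close>

definition affine_points :: "nat \<Rightarrow> real vec set \<Rightarrow> (int vec \<Rightarrow> complex) set" where
  "affine_points m \<sigma> =
     {\<gamma> \<in> extensional (dual_monoid m \<sigma>).
        \<gamma> (0\<^sub>v m) = 1 \<and>
        (\<forall>w\<in>dual_monoid m \<sigma>. \<forall>w'\<in>dual_monoid m \<sigma>. \<gamma> (w + w') = \<gamma> w * \<gamma> w')}"

text \<open>Elements of \<open>\<complex>[dual_monoid m \<sigma>]\<close>, as functions on the affine points.\<close>

definition coordinate_ring ::
    "nat \<Rightarrow> real vec set \<Rightarrow> ((int vec \<Rightarrow> complex) \<Rightarrow> complex) set" where
  "coordinate_ring m \<sigma> =
     {(\<lambda>\<gamma>. \<Sum>w\<in>W. a w * \<gamma> w) | W a. finite W \<and> W \<subseteq> dual_monoid m \<sigma>}"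

text \<open>
  The toric variety of a fan is glued from the affine pieces of its cones: the pieces of
  \<open>\<sigma>\<close> and \<open>\<sigma>'\<close> are identified along the piece of the common face
  \<open>\<sigma> \<inter> \<sigma>'\<close>, whose points restrict to points of both.
\<close>

type_synonym chart_point = "real vec set \<times> (int vec \<Rightarrow> complex)"

definition chart_points :: "nat \<Rightarrow> real vec set set \<Rightarrow> chart_point set" where
  "chart_points m \<Sigma> = (SIGMA \<sigma>:\<Sigma>. affine_points m \<sigma>)"

definition glue :: "nat \<Rightarrow> real vec set set \<Rightarrow> chart_point rel" where
  "glue m \<Sigma> =
     {((\<sigma>, \<gamma>), (\<sigma>', \<gamma>')).
        (\<sigma>, \<gamma>) \<in> chart_points m \<Sigma> \<and> (\<sigma>', \<gamma>') \<in> chart_points m \<Sigma> \<and>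
        (\<exists>\<delta>\<in>affine_points m (\<sigma> \<inter> \<sigma>').
           \<gamma> = restrict \<delta> (dual_monoid m \<sigma>) \<and> \<gamma>' = restrict \<delta> (dual_monoid m \<sigma>'))}"

definition toric_points :: "nat \<Rightarrow> real vec set set \<Rightarrow> chart_point set set" where
  "toric_points m \<Sigma> = chart_points m \<Sigma> // glue m \<Sigma>"

definition chart ::
    "nat \<Rightarrow> real vec set set \<Rightarrow> real vec set \<Rightarrow> (int vec \<Rightarrow> complex) \<Rightarrow> chart_point set" where
  "chart m \<Sigma> \<sigma> \<gamma> = glue m \<Sigma> `` {(\<sigma>, \<gamma>)}"

definition principal_open ::
    "nat \<Rightarrow> real vec set set \<Rightarrow> real vec set \<Rightarrow> ((int vec \<Rightarrow> complex) \<Rightarrow> complex)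
      \<Rightarrow> chart_point set set" where
  "principal_open m \<Sigma> \<sigma> h = chart m \<Sigma> \<sigma> ` {\<gamma> \<in> affine_points m \<sigma>. h \<gamma> \<noteq> 0}"

definition zariski_open :: "nat \<Rightarrow> real vec set set \<Rightarrow> chart_point set set \<Rightarrow> bool" where
  "zariski_open m \<Sigma> V \<longleftrightarrow>
     V \<subseteq> toric_points m \<Sigma> \<and>
     (\<forall>p\<in>V. \<exists>\<sigma>\<in>\<Sigma>. \<exists>h\<in>coordinate_ring m \<sigma>.
        p \<in> principal_open m \<Sigma> \<sigma> h \<and> principal_open m \<Sigma> \<sigma> h \<subseteq> V)"

text \<open>A function on an open set is regular if it is locally a fraction of coordinate functions.
  Its values outside the open set are irrelevant.\<close>

definition regular_on ::
    "nat \<Rightarrow> real vec set set \<Rightarrow> chart_point set set \<Rightarrow> (chart_point set \<Rightarrow> complex) \<Rightarrow> bool" where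
  "regular_on m \<Sigma> V f \<longleftrightarrow>
     zariski_open m \<Sigma> V \<and>
     (\<forall>p\<in>V. \<exists>\<sigma>\<in>\<Sigma>. \<exists>g\<in>coordinate_ring m \<sigma>. \<exists>h\<in>coordinate_ring m \<sigma>.
        p \<in> principal_open m \<Sigma> \<sigma> h \<and> principal_open m \<Sigma> \<sigma> h \<subseteq> V \<and>
        (\<forall>\<gamma>\<in>affine_points m \<sigma>. h \<gamma> \<noteq> 0 \<longrightarrow> f (chart m \<Sigma> \<sigma> \<gamma>) = g \<gamma> / h \<gamma>))"

definition torus_group :: "nat \<Rightarrow> (int vec \<Rightarrow> complex) monoid" where
  "torus_group m =
     \<lparr>carrier = affine_points m {0\<^sub>v m},
      mult = (\<lambda>s t. \<lambda>w\<in>carrier_vec m. s w * t w),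
      one = (\<lambda>w\<in>carrier_vec m. 1)\<rparr>"

text \<open>
  A variety (a space with a sheaf of complex-valued functions) together with its embedded torus.
  The torus action is not recorded: the torus is dense, so the action is determined by the embedding.
\<close>

record ('p, 't) torus_embedding =
  points :: "'p set"
  is_open :: "'p set \<Rightarrow> bool"
  is_regular :: "'p set \<Rightarrow> ('p \<Rightarrow> complex) \<Rightarrow> bool"
  torus :: "'t monoid"
  embed :: "'t \<Rightarrow> 'p"

definition toric_variety ::
    "nat \<Rightarrow> real vec set set \<Rightarrow> (chart_point set, int vec \<Rightarrow> complex) torus_embedding" where
  "toric_variety m \<Sigma> =
     \<lparr>points = toric_points m \<Sigma>,
      is_open = zariski_open m \<Sigma>,
      is_regular = regular_on m \<Sigma>,
      torus = torus_group m,
      embed = chart m \<Sigma> {0\<^sub>v m}\<rparr>"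

definition variety_morphism ::
    "('p, 's) torus_embedding \<Rightarrow> ('q, 't) torus_embedding \<Rightarrow> ('p \<Rightarrow> 'q) \<Rightarrow> bool" where
  "variety_morphism X Y \<phi> \<longleftrightarrow>
     \<phi> \<in> points X \<rightarrow> points Y \<and>
     (\<forall>V. is_open Y V \<longrightarrow> is_open X {p \<in> points X. \<phi> p \<in> V}) \<and>
     (\<forall>V f. is_open Y V \<and> is_regular Y V f \<longrightarrow> is_regular X {p \<in> points X. \<phi> p \<in> V} (f \<circ> \<phi>))"

text \<open>A toric morphism maps torus to torus and restricts to a group homomorphism there.\<close>

definition toric_morphism ::
    "('p, 's) torus_embedding \<Rightarrow> ('q, 't) torus_embedding \<Rightarrow> ('p \<Rightarrow> 'q) \<Rightarrow> bool" where
  "toric_morphism X Y \<phi> \<longleftrightarrow>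
     variety_morphism X Y \<phi> \<and>
     (\<exists>\<psi>\<in>hom (torus X) (torus Y). \<forall>t\<in>carrier (torus X). \<phi> (embed X t) = embed Y (\<psi> t))"

definition toric_isomorphic ::
    "('p, 's) torus_embedding \<Rightarrow> ('q, 't) torus_embedding \<Rightarrow> bool" where
  "toric_isomorphic X Y \<longleftrightarrow>
     (\<exists>\<phi> \<psi>. toric_morphism X Y \<phi> \<and> toric_morphism Y X \<psi> \<and>
        (\<forall>p\<in>points X. \<psi> (\<phi> p) = p) \<and> (\<forall>q\<in>points Y. \<phi> (\<psi> q) = q))"

section \<open>Bott manifolds\<close>

text \<open>Rows and columns of matrices are indexed from \<open>0\<close>.\<close>

definition bott_rays :: "int mat \<Rightarrow> int vec set" where
  "bott_rays B =
     {unit_vec (dim_row B) i | i. i < dim_row B} \<union> {col B i | i. i < dim_row B}"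

definition bott_max_gens :: "int mat \<Rightarrow> int vec set set" where
  "bott_max_gens B =
     {S. S \<subseteq> bott_rays B \<and> card S = dim_row B \<and>
         (\<forall>i<dim_row B. \<not> {unit_vec (dim_row B) i, col B i} \<subseteq> S)}"

text \<open>The maximal cones are simplicial, so their faces are spanned by the subsets of their
  generators.\<close>

definition bott_fan :: "int mat \<Rightarrow> real vec set set" where
  "bott_fan B = {cone_span (dim_row B) F | F S. S \<in> bott_max_gens B \<and> F \<subseteq> S}"

definition bott_manifold ::
    "int mat \<Rightarrow> (chart_point set, int vec \<Rightarrow> complex) torus_embedding" where
  "bott_manifold B = toric_variety (dim_row B) (bott_fan B)"

definition bs_matrix :: "nat list \<Rightarrow> int mat" where
  "bs_matrix is = mat (length is) (length is) (\<lambda>(j, k).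
     if j < k then 0
     else if j = k then -1
     else if is ! j = is ! k then -2
     else if \<bar>int (is ! j) - int (is ! k)\<bar> = 1 then 1
     else 0)"

definition bs_manifolds ::
    "nat \<Rightarrow> nat \<Rightarrow> (chart_point set, int vec \<Rightarrow> complex) torus_embedding set" where
  "bs_manifolds n m =
     {bott_manifold (bs_matrix is) | is. length is = m \<and> set is \<subseteq> {1..n}}"

definition bs_iso_rel ::
    "nat \<Rightarrow> nat \<Rightarrow> (chart_point set, int vec \<Rightarrow> complex) torus_embedding rel" where
  "bs_iso_rel n m =
     {(X, Y). X \<in> bs_manifolds n m \<and> Y \<in> bs_manifolds n m \<and> toric_isomorphic X Y}"

section \<open>Assemblies of ordered partitions\<close>

definition ordered_partition :: "nat set list \<Rightarrow> bool" where
  "ordered_partition \<eta> \<longleftrightarrow> {} \<notin> set \<eta> \<and> sorted_wrt disjnt \<eta>"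

definition support :: "nat set list \<Rightarrow> nat set" where
  "support \<eta> = \<Union> (set \<eta>)"

text \<open>Strictly increasing minima force the supports of different entries to be different, so
  \<open>partition_on\<close> for the set of supports really is disjointness of the entries.\<close>

definition assembly :: "nat \<Rightarrow> nat set list list \<Rightarrow> bool" where
  "assembly m \<sigma> \<longleftrightarrow>
     (\<forall>\<eta>\<in>set \<sigma>. ordered_partition \<eta>) \<and>
     partition_on {1..m} (support ` set \<sigma>) \<and>
     sorted_wrt (<) (map (\<lambda>\<eta>. Min (support \<eta>)) \<sigma>)"

definition AOP :: "nat \<Rightarrow> nat \<Rightarrow> nat set list list set" where
  "AOP n m = {\<sigma>. assembly m \<sigma> \<and> (\<Sum>\<eta>\<leftarrow>\<sigma>. length \<eta>) + (length \<sigma> - 1) \<le> n}"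

definition reversal_equiv :: "nat set list list \<Rightarrow> nat set list list \<Rightarrow> bool" where
  "reversal_equiv \<sigma> \<tau> \<longleftrightarrow> list_all2 (\<lambda>\<eta> \<theta>. \<theta> = \<eta> \<or> \<theta> = rev \<eta>) \<sigma> \<tau>"

definition neighbors :: "nat set list list \<Rightarrow> nat \<Rightarrow> nat \<Rightarrow> bool" where
  "neighbors \<sigma> j k \<longleftrightarrow>
     j \<noteq> k \<and>
     (\<exists>\<eta>\<in>set \<sigma>. \<exists>b<length \<eta>. \<exists>c<length \<eta>.
        (c + 1 = b \<or> c = b \<or> c = b + 1) \<and> k \<in> \<eta> ! b \<and> j \<in> \<eta> ! c)"

definition swap_adjacent :: "nat \<Rightarrow> nat set list list \<Rightarrow> nat set list list" where
  "swap_adjacent j \<sigma> =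
     sort_key (\<lambda>\<eta>. Min (support \<eta>)) (map (map (image (Transposition.transpose j (j + 1)))) \<sigma>)"

definition admissible :: "nat \<Rightarrow> nat \<Rightarrow> nat set list list \<Rightarrow> bool" where
  "admissible m j \<sigma> \<longleftrightarrow> 1 \<le> j \<and> j + 1 \<le> m \<and> \<not> neighbors \<sigma> j (j + 1)"

definition approx_rel :: "nat \<Rightarrow> nat \<Rightarrow> nat set list list rel" where
  "approx_rel n m =
     {(\<sigma>, \<tau>). \<sigma> \<in> AOP n m \<and> \<tau> \<in> AOP n m \<and>
        (\<exists>k (\<rho> :: nat \<Rightarrow> nat set list list).
           (\<forall>i\<le>k. \<rho> i \<in> AOP n m) \<and>
           reversal_equiv (\<rho> 0) \<sigma> \<and> reversal_equiv (\<rho> k) \<tau> \<and>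
           (\<forall>i\<in>{1..k}. \<exists>j. admissible m j (\<rho> (i - 1)) \<and> swap_adjacent j (\<rho> (i - 1)) = \<rho> i))}"

end

theory Submission
  imports Defs
begin

text \<open>
  A toric isomorphism induces an isomorphism of the cocharacter lattices: a character composed with
  the given torus homomorphism and restricted to a one-parameter subgroup \<open>z \<mapsto> exp (z * \<lambda>)\<close> is
  additive, differentiable at \<open>0\<close> because it is locally a quotient of coordinate functions, and
  periodic, hence of the form \<open>exp (n * z)\<close>. Letting \<open>z\<close> tend to \<open>-\<infinity>\<close> towards the fixed point of a
  maximal cone shows that this lattice map sends maximal cones to maximal cones, so it sends rays to
  rays and pairs \<open>{e\<^sub>i, v\<^sub>i}\<close> to such pairs.

  It may exchange the two rays of a pair. In the primitive relations \<open>e\<^sub>k + v\<^sub>k = (\<Sum>j>k. b\<^sub>j\<^sub>k * e\<^sub>j)\<close> an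
  exchange changes the sign of a coefficient, but the coefficients \<open>-2\<close>, \<open>0\<close>, \<open>1\<close> of a Bott--Samelson
  matrix only admit this for \<open>0\<close>. Hence two Bott manifolds of Bott--Samelson type are isomorphic iff
  their matrices are conjugate by a permutation.

  The matrix of a word records which positions carry equal or adjacent letters, which is the same
  as an assembly up to reversal of its ordered partitions. A permutation that conjugates one lower
  triangular matrix into another one is sorted by adjacent transpositions, each of which exchanges
  positions with entry \<open>0\<close> and is therefore admissible.
\<close>

section \<open>One-parameter subgroups and exponential sums\<close>

text \<open>The torus homomorphism in the definition of a toric morphism is a homomorphism of
  abstract groups, and complex tori have many of these that come from no lattice map, complex
  conjugation being one. Algebraicity has to be extracted from the regularity of the morphism near a
  single point. In the coordinate z = log t this becomes a question about one additive function, and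
  its period supplies the integer.

  A lattice isomorphism need not permute the coordinates: if all entries off the diagonal are 0,
  every pair of rays can be exchanged independently. This is why matrices are compared and not
  lattice maps.

  Isomorphism of manifolds and \<approx> on assemblies are both translated into one relation,
  conjugacy of matrices by a permutation. Several words can have the same manifold and several
  assemblies the same matrix, so the bijection is induced by the relation of having the same matrix
  and not by a map.\<close>

lemma exp_of_additive:
  fixes F :: "complex \<Rightarrow> complex"
  assumes add: "\<And>z w. F (z + w) = F z * F w" and zero: "F 0 = 1"
    and deriv: "(F has_field_derivative D) (at 0)"
    and period: "F (2 * pi * \<i>) = 1"
  shows "\<exists>n::int. \<forall>z. F z = exp (z * of_int n)"
proof -
  have dF: "(F has_field_derivative F z * D) (at z)" for z
  proof -
    have "((\<lambda>w. F z * F (w + - z)) has_field_derivative F z * D) (at z)"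
      by (rule DERIV_cmult) (subst DERIV_shift[symmetric], use deriv in simp)
    moreover have "F z * F (w + - z) = F w" for w using add[of z "w + - z"] by simp
    ultimately show ?thesis by simp
  qed
  have mult0: "(*) (0 :: 'a :: real_normed_field) = (\<lambda>h. 0)" by auto
  \<comment> \<open>The exponential factor cancels the growth of \<open>F\<close>, so
    \<open>K\<close> is constant. This is checked on the segment from 0 to \<open>z\<close>,
    separately for real and imaginary part, where the criterion for real functions applies.\<close>
  define K where "K z = F z * exp (- (D * z))" for z
  have dK: "(K has_derivative (\<lambda>h. 0)) (at z)" for z
  proof -
    have "(K has_field_derivative 0) (at z)"
      unfolding K_def by (rule derivative_eq_intros dF refl | simp)+
    then show ?thesis by (simp add: has_field_derivative_def mult0)
  qed
  have K1: "K z = 1" for z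
  proof -
    have path: "((\<lambda>t. K (of_real t * z)) has_derivative (\<lambda>h. 0)) (at t)" for t :: real
    proof -
      have "((\<lambda>t. of_real t * z) has_derivative (\<lambda>h. of_real h * z)) (at t)"
        by (auto intro!: derivative_eq_intros)
      from has_derivative_compose[OF this dK] show ?thesis by simp
    qed
    have re: "((\<lambda>t. Re (K (of_real t * z))) has_real_derivative 0) (at t)" for t
      using bounded_linear.has_derivative[OF bounded_linear_Re path, of t]
      by (simp add: has_field_derivative_def mult0)
    have im: "((\<lambda>t. Im (K (of_real t * z))) has_real_derivative 0) (at t)" for t
      using bounded_linear.has_derivative[OF bounded_linear_Im path, of t]
      by (simp add: has_field_derivative_def mult0)
    have "Re (K (of_real 1 * z)) = Re (K (of_real 0 * z))"
      using re by (intro DERIV_isconst_all) auto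
    moreover have "Im (K (of_real 1 * z)) = Im (K (of_real 0 * z))"
      using im by (intro DERIV_isconst_all[of "\<lambda>t. Im (K (of_real t * z))"]) auto
    moreover have "K 0 = 1" by (simp add: K_def zero)
    ultimately show ?thesis by (simp add: complex_eq_iff)
  qed
  have F_exp: "F z = exp (D * z)" for z
    using K1[of z] by (simp add: K_def exp_minus field_simps)
  have one: "exp (D * (2 * pi * \<i>)) = 1" using F_exp period by metis
  \<comment> \<open>The modulus of exp (2 pi i D) forces \<open>D\<close> to be real; its real part
    is then a cosine and forces \<open>D\<close> to be an integer.\<close>
  have "norm (exp (D * (2 * pi * \<i>))) = 1" by (simp only: one norm_one)
  then have "Im D = 0" by (simp add: norm_exp_eq_Re)
  then have D: "D = of_real (Re D)" by (simp add: complex_eq_iff)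
  have "Re (exp (D * (2 * pi * \<i>))) = 1" by (simp only: one one_complex.sel)
  then have "cos (Re D * (2 * pi)) = 1" using \<open>Im D = 0\<close> by (simp add: Re_exp)
  then obtain n :: int where "Re D * (2 * pi) = of_int n * 2 * pi"
    using cos_one_2pi_int by blast
  then have "D = of_int n" using D by (simp add: complex_eq_iff)
  then show ?thesis using F_exp by (intro exI[of _ n]) (simp add: mult.commute)
qed

lemma exp_sum_has_derivative:
  fixes e :: "'a \<Rightarrow> int"
  shows "\<exists>D. ((\<lambda>z::complex. \<Sum>w\<in>W. a w * exp (z * of_int (e w))) has_field_derivative D) (at z)"
proof -
  have "((\<lambda>z::complex. a w * exp (z * of_int (e w))) has_field_derivative
      a w * (exp (z * of_int (e w)) * of_int (e w))) (at z)" for w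
    by (rule derivative_eq_intros refl | simp)+
  from DERIV_sum[OF this] show ?thesis by (rule exI)
qed

text \<open>Such sums are coordinate functions along a one-parameter subgroup. As z = -k tends to
  minus infinity, only the terms with exponent 0 survive.\<close>

lemma exp_sum_tendsto:
  fixes e :: "'a \<Rightarrow> int"
  assumes "\<And>w. w \<in> W \<Longrightarrow> 0 \<le> e w"
  shows "(\<lambda>k. \<Sum>w\<in>W. a w * exp (- of_nat k * of_int (e w)))
    \<longlonglongrightarrow> (\<Sum>w\<in>W. a w * (if e w = 0 then 1 else 0 :: complex))"
proof (intro tendsto_sum tendsto_mult tendsto_const)
  fix w assume "w \<in> W"
  then have "0 \<le> e w" by (rule assms)
  have *: "exp (- of_nat k * of_int (e w)) = exp (- of_int (e w) :: complex) ^ k" for k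
    by (simp flip: exp_of_nat_mult)
  show "(\<lambda>k. exp (- of_nat k * of_int (e w)) :: complex) \<longlonglongrightarrow> (if e w = 0 then 1 else 0)"
  proof (cases "e w = 0")
    case False
    then have "norm (exp (- of_int (e w)) :: complex) < 1"
      using \<open>0 \<le> e w\<close> by (simp add: norm_exp_eq_Re)
    then show ?thesis unfolding * using False by (simp add: LIMSEQ_power_zero)
  qed simp
qed

text \<open>For n < 0 the exponential would be unbounded along z = -k, while the quotient has a
  finite limit because its denominator tends to a nonzero number.\<close>

lemma exp_quotient_nonneg:
  fixes e :: "'a \<Rightarrow> int" and b :: "'a \<Rightarrow> complex"
  assumes e: "\<And>w. w \<in> W \<union> W' \<Longrightarrow> 0 \<le> e w"
    and nz: "(\<Sum>w\<in>W'. b w * (if e w = 0 then 1 else 0)) \<noteq> 0"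
    and eq: "\<And>z::complex. (\<Sum>w\<in>W'. b w * exp (z * of_int (e w))) \<noteq> 0 \<Longrightarrow>
      exp (z * of_int n) = (\<Sum>w\<in>W. a w * exp (z * of_int (e w))) / (\<Sum>w\<in>W'. b w * exp (z * of_int (e w)))"
  shows "0 \<le> n"
proof (rule ccontr)
  assume "\<not> 0 \<le> n"
  define g where "g k = (\<Sum>w\<in>W. a w * exp (- of_nat k * of_int (e w)))" for k
  define h where "h k = (\<Sum>w\<in>W'. b w * exp (- of_nat k * of_int (e w)))" for k
  have g: "g \<longlonglongrightarrow> (\<Sum>w\<in>W. a w * (if e w = 0 then 1 else 0))"
    unfolding g_def by (rule exp_sum_tendsto) (use e in auto)
  have h: "h \<longlonglongrightarrow> (\<Sum>w\<in>W'. b w * (if e w = 0 then 1 else 0))"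
    unfolding h_def by (rule exp_sum_tendsto) (use e in auto)
  have "(\<lambda>k. exp (of_int n :: complex) ^ k) \<longlonglongrightarrow> 0"
    by (rule LIMSEQ_power_zero) (use \<open>\<not> 0 \<le> n\<close> in \<open>simp add: norm_exp_eq_Re\<close>)
  from tendsto_mult[OF this tendsto_divide[OF g h nz]]
  have "(\<lambda>k. exp (of_int n) ^ k * (g k / h k)) \<longlonglongrightarrow> 0" by simp
  moreover have "eventually (\<lambda>k. exp (of_int n) ^ k * (g k / h k) = 1) sequentially"
    using tendsto_imp_eventually_ne[OF h nz]
  proof eventually_elim
    case (elim k)
    then have "exp (- of_nat k * of_int n) = g k / h k"
      unfolding g_def h_def by (intro eq) simp
    then have "exp (of_int n) ^ k * (g k / h k) = exp (of_nat k * of_int n) * exp (- of_nat k * of_int n)"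
      by (simp only: exp_of_nat_mult)
    also have "\<dots> = 1" by (simp flip: exp_add)
    finally show ?case .
  qed
  ultimately have "(\<lambda>k. 1 :: complex) \<longlonglongrightarrow> 0" using tendsto_cong by fast
  then show False by (simp add: LIMSEQ_const_iff)
qed

section \<open>Dual monoids, points of affine charts and their gluing\<close>

lemma dual_monoid_carrier: "dual_monoid m \<sigma> \<subseteq> carrier_vec m"
  by (auto simp: dual_monoid_def)

lemma dual_monoid_antimono: "\<sigma> \<subseteq> \<tau> \<Longrightarrow> dual_monoid m \<tau> \<subseteq> dual_monoid m \<sigma>"
  by (auto simp: dual_monoid_def)

lemma dual_monoid_zero: "dual_monoid m {0\<^sub>v m} = carrier_vec m"
  by (auto simp: dual_monoid_def)

lemma dual_monoid_0_mem:
  assumes "\<sigma> \<subseteq> carrier_vec m" shows "0\<^sub>v m \<in> dual_monoid m \<sigma>"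
proof -
  have eq: "map_vec of_int (0\<^sub>v m) = (0\<^sub>v m :: real vec)" by auto
  have "map_vec of_int (0\<^sub>v m) \<bullet> v = 0" if "v \<in> \<sigma>" for v :: "real vec"
    unfolding eq using assms that by (intro scalar_prod_left_zero) auto
  then show ?thesis by (simp add: dual_monoid_def)
qed

lemma dual_monoid_add:
  assumes "\<sigma> \<subseteq> carrier_vec m" "u \<in> dual_monoid m \<sigma>" "w \<in> dual_monoid m \<sigma>"
  shows "u + w \<in> dual_monoid m \<sigma>"
proof -
  have c: "u \<in> carrier_vec m" "w \<in> carrier_vec m" using assms dual_monoid_carrier by auto
  have "map_vec of_int (u + w) = map_vec of_int u + (map_vec of_int w :: real vec)"
    using c by auto
  then have "map_vec of_int (u + w) \<bullet> v = map_vec of_int u \<bullet> v + map_vec of_int w \<bullet> (v :: real vec)"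
    if "v \<in> \<sigma>" for v
    using that assms(1) c by (simp add: add_scalar_prod_distrib[of _ m] subsetD)
  then show ?thesis using assms c by (auto simp: dual_monoid_def)
qed

lemma affine_points_zero:
  "\<gamma> \<in> affine_points m \<sigma> \<Longrightarrow> \<gamma> (0\<^sub>v m) = 1"
  by (simp add: affine_points_def)

lemma affine_points_add:
  "\<gamma> \<in> affine_points m \<sigma> \<Longrightarrow> u \<in> dual_monoid m \<sigma> \<Longrightarrow> w \<in> dual_monoid m \<sigma> \<Longrightarrow> \<gamma> (u + w) = \<gamma> u * \<gamma> w"
  by (simp add: affine_points_def)

lemma affine_points_restrict: "\<gamma> \<in> affine_points m \<sigma> \<Longrightarrow> restrict \<gamma> (dual_monoid m \<sigma>) = \<gamma>"
  by (simp add: affine_points_def extensional_restrict)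

lemma restrict_affine_points:
  assumes "\<sigma> \<subseteq> \<tau>" "\<tau> \<subseteq> carrier_vec m" "\<gamma> \<in> affine_points m \<sigma>"
  shows "restrict \<gamma> (dual_monoid m \<tau>) \<in> affine_points m \<tau>"
  using assms dual_monoid_antimono[OF assms(1), of m] dual_monoid_0_mem[OF assms(2)]
    dual_monoid_add[OF assms(2)]
  by (auto simp: affine_points_def subset_iff)

lemma torus_point_nonzero:
  assumes t: "t \<in> affine_points m {0\<^sub>v m}" and w: "w \<in> carrier_vec m"
  shows "t w \<noteq> 0"
proof -
  have "- w \<in> carrier_vec m" using w by simp
  then have "t (w + - w) = t w * t (- w)"
    using affine_points_add[OF t, unfolded dual_monoid_zero] w by blast
  moreover have "w + - w = 0\<^sub>v m" using w by auto
  ultimately have "t w * t (- w) = 1" using affine_points_zero[OF t] by simp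
  then show ?thesis by auto
qed

lemma self_mem_chart:
  assumes "\<sigma> \<in> \<Sigma>" "\<gamma> \<in> affine_points m \<sigma>"
  shows "(\<sigma>, \<gamma>) \<in> chart m \<Sigma> \<sigma> \<gamma>"
  using assms affine_points_restrict[OF assms(2)]
  by (auto simp: chart_def glue_def chart_points_def intro!: bexI[of _ \<gamma>])

lemma mem_chart_iff:
  "(\<tau>, \<eta>) \<in> chart m \<Sigma> \<sigma> \<gamma> \<longleftrightarrow>
    \<sigma> \<in> \<Sigma> \<and> \<gamma> \<in> affine_points m \<sigma> \<and> \<tau> \<in> \<Sigma> \<and> \<eta> \<in> affine_points m \<tau> \<and>
    (\<exists>\<delta>\<in>affine_points m (\<sigma> \<inter> \<tau>).
       \<gamma> = restrict \<delta> (dual_monoid m \<sigma>) \<and> \<eta> = restrict \<delta> (dual_monoid m \<tau>))"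
  by (auto simp: chart_def glue_def chart_points_def)

lemma chart_inj:
  assumes "\<sigma> \<in> \<Sigma>" "\<gamma> \<in> affine_points m \<sigma>" "\<gamma>' \<in> affine_points m \<sigma>"
    and "chart m \<Sigma> \<sigma> \<gamma> = chart m \<Sigma> \<sigma> \<gamma>'"
  shows "\<gamma> = \<gamma>'"
proof -
  have "(\<sigma>, \<gamma>') \<in> chart m \<Sigma> \<sigma> \<gamma>" using self_mem_chart[OF assms(1,3)] assms(4) by simp
  then show ?thesis by (auto simp: mem_chart_iff)
qed

lemma toric_points_eq: "toric_points m \<Sigma> = {chart m \<Sigma> \<sigma> \<gamma> | \<sigma> \<gamma>. \<sigma> \<in> \<Sigma> \<and> \<gamma> \<in> affine_points m \<sigma>}"
  by (auto simp: toric_points_def quotient_def chart_def chart_points_def)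

lemma monomial_in_coordinate_ring:
  assumes "u \<in> dual_monoid m \<sigma>" shows "(\<lambda>\<gamma>. \<gamma> u) \<in> coordinate_ring m \<sigma>"
  unfolding coordinate_ring_def
  using assms by (intro CollectI exI[of _ "{u}"] exI[of _ "\<lambda>_. 1"]) auto

text \<open>The one-parameter subgroup of a cocharacter in the coordinate \<open>z = log t\<close>, in which Laurent
  polynomials become entire functions.\<close>

definition one_param :: "nat \<Rightarrow> int vec \<Rightarrow> complex \<Rightarrow> int vec \<Rightarrow> complex" where
  "one_param m l z = (\<lambda>w\<in>carrier_vec m. exp (z * of_int (l \<bullet> w)))"

lemma one_param_torus:
  assumes "l \<in> carrier_vec m"
  shows "one_param m l z \<in> affine_points m {0\<^sub>v m}"
  using assms
  by (auto simp: affine_points_def dual_monoid_zero one_param_def scalar_prod_add_distrib[of _ m]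
      distrib_left exp_add)

lemma one_param_inj:
  assumes "l \<in> carrier_vec m" "l' \<in> carrier_vec m" "\<And>z. one_param m l z = one_param m l' z"
  shows "l = l'"
proof (rule eq_vecI)
  fix i assume "i < dim_vec l'"
  then have i: "i < m" using assms(2) by simp
  have "one_param m l 1 (unit_vec m i) = one_param m l' 1 (unit_vec m i)" using assms(3) by simp
  then have "exp (of_int (l $ i)) = (exp (of_int (l' $ i)) :: complex)"
    using i assms(1,2) by (simp add: one_param_def scalar_prod_right_unit)
  \<comment> \<open>Norms replace the complex exponential by the real one, which is
    injective.\<close>
  then have "norm (exp (of_int (l $ i) :: complex)) = norm (exp (of_int (l' $ i)) :: complex)" by simp
  then show "l $ i = l' $ i" by (simp add: norm_exp_eq_Re)
qed (use assms in simp)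

lemma additive_functional:
  fixes f :: "int vec \<Rightarrow> int"
  assumes add: "\<And>u w. u \<in> carrier_vec m \<Longrightarrow> w \<in> carrier_vec m \<Longrightarrow> f (u + w) = f u + f w"
  shows "\<exists>v\<in>carrier_vec m. \<forall>u\<in>carrier_vec m. f u = v \<bullet> u"
proof -
  define v where "v = vec m (\<lambda>i. f (unit_vec m i))"
  have f0: "f (0\<^sub>v m) = 0" using add[of "0\<^sub>v m" "0\<^sub>v m"] by simp
  have smult: "f (k \<cdot>\<^sub>v w) = k * f w" if w: "w \<in> carrier_vec m" for k w
  proof (induction k rule: int_induct[of _ 0])
    case base
    have "0 \<cdot>\<^sub>v w = 0\<^sub>v m" using w by auto
    then show ?case using f0 by simp
  next
    case (step1 i)
    have "(i + 1) \<cdot>\<^sub>v w = i \<cdot>\<^sub>v w + w" using w by (intro eq_vecI) (auto simp: algebra_simps)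
    then show ?case using step1 add[of "i \<cdot>\<^sub>v w" w] w by (simp add: algebra_simps)
  next
    case (step2 i)
    have "i \<cdot>\<^sub>v w = (i - 1) \<cdot>\<^sub>v w + w" using w by (intro eq_vecI) (auto simp: algebra_simps)
    then show ?case using step2 add[of "(i - 1) \<cdot>\<^sub>v w" w] w by (simp add: algebra_simps)
  qed
  have "f u = v \<bullet> u" if u: "u \<in> carrier_vec m" for u
  proof -
    \<comment> \<open>\<open>t p\<close> keeps the first \<open>p\<close> coordinates of
      \<open>u\<close>, so passing to \<open>Suc p\<close> adds one multiple of a unit
      vector.\<close>
    define t where "t p = vec m (\<lambda>i. if i < p then u $ i else 0)" for p
    have "f (t p) = (\<Sum>i<p. u $ i * f (unit_vec m i))" if "p \<le> m" for p
      using that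
    proof (induction p)
      case 0
      have "t 0 = 0\<^sub>v m" by (auto simp: t_def)
      then show ?case using f0 by simp
    next
      case (Suc p)
      have "t (Suc p) = t p + u $ p \<cdot>\<^sub>v unit_vec m p"
        using Suc.prems by (intro eq_vecI) (auto simp: t_def less_Suc_eq)
      then have "f (t (Suc p)) = f (t p) + f (u $ p \<cdot>\<^sub>v unit_vec m p)"
        using add[of "t p" "u $ p \<cdot>\<^sub>v unit_vec m p"] by (simp add: t_def)
      then show ?case using Suc smult[of "unit_vec m p"] by simp
    qed
    from this[of m] have "f (t m) = (\<Sum>i<m. u $ i * f (unit_vec m i))" by simp
    moreover have "t m = u" using u by (intro eq_vecI) (auto simp: t_def)
    ultimately show ?thesis
      using u by (simp add: scalar_prod_def v_def atLeast0LessThan mult.commute)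
  qed
  moreover have "v \<in> carrier_vec m" by (simp add: v_def)
  ultimately show ?thesis by blast
qed

text \<open>Each coordinate of \<open>L\<close> is additive, hence the scalar product with a fixed
  vector, and that commutes with finite sums.\<close>

lemma additive_sum:
  fixes L :: "int vec \<Rightarrow> int vec"
  assumes L: "\<And>u. u \<in> carrier_vec m \<Longrightarrow> L u \<in> carrier_vec m'"
    and add: "\<And>u w. u \<in> carrier_vec m \<Longrightarrow> w \<in> carrier_vec m \<Longrightarrow> L (u + w) = L u + L w"
    and x: "\<And>k. k < q \<Longrightarrow> x k \<in> carrier_vec m"
  shows "L (vec m (\<lambda>j. \<Sum>k<q. c k * x k $ j)) = vec m' (\<lambda>j. \<Sum>k<q. c k * L (x k) $ j)"
proof (intro eq_vecI)
  fix j assume "j < dim_vec (vec m' (\<lambda>j. \<Sum>k<q. c k * L (x k) $ j))"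
  then have j: "j < m'" by simp
  have "L (u + w) $ j = L u $ j + L w $ j" if "u \<in> carrier_vec m" "w \<in> carrier_vec m" for u w
    using add[OF that] L[OF that(2)] j by simp
  then obtain v where v: "v \<in> carrier_vec m" "\<And>u. u \<in> carrier_vec m \<Longrightarrow> L u $ j = v \<bullet> u"
    using additive_functional[of m "\<lambda>u. L u $ j"] by blast
  have "L (vec m (\<lambda>j. \<Sum>k<q. c k * x k $ j)) $ j = (\<Sum>i<m. \<Sum>k<q. c k * (v $ i * x k $ i))"
    by (subst v(2)) (auto simp: scalar_prod_def atLeast0LessThan sum_distrib_left mult_ac intro!: sum.cong)
  also have "\<dots> = (\<Sum>k<q. c k * (v \<bullet> x k))"
    by (subst sum.swap) (auto simp: scalar_prod_def atLeast0LessThan sum_distrib_left carrier_vecD[OF x])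
  also have "\<dots> = (\<Sum>k<q. c k * L (x k) $ j)" using v(2) x by simp
  finally show "L (vec m (\<lambda>j. \<Sum>k<q. c k * x k $ j)) $ j = vec m' (\<lambda>j. \<Sum>k<q. c k * L (x k) $ j) $ j"
    using j by simp
qed (use L[of "vec m (\<lambda>j. \<Sum>k<q. c k * x k $ j)"] in simp)

section \<open>The fan of a Bott matrix\<close>

locale bott =
  fixes m :: nat and B :: "int mat"
  assumes carrier: "B \<in> carrier_mat m m"
    and diag: "i < m \<Longrightarrow> B $$ (i, i) = -1"
    and upper: "i < j \<Longrightarrow> j < m \<Longrightarrow> B $$ (i, j) = 0"
begin

text \<open>The flag selects one ray of the pair \<open>{unit_vec m i, col B i}\<close>, so a
  function \<open>s\<close> from indices to flags names a maximal cone.\<close>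

definition ray :: "nat \<Rightarrow> bool \<Rightarrow> int vec" where
  "ray i b = (if b then col B i else unit_vec m i)"

text \<open>The coefficient type is left open: integers give lattice points, reals give points of
  cones.\<close>

definition comb :: "(nat \<Rightarrow> bool) \<Rightarrow> (nat \<Rightarrow> 'a) \<Rightarrow> 'a::linordered_idom vec" where
  "comb s a = vec m (\<lambda>j. \<Sum>k<m. a k * of_int (ray k (s k) $ j))"

definition cone :: "(nat \<Rightarrow> bool) \<Rightarrow> nat set \<Rightarrow> real vec set" where
  "cone s I = {comb s a | a. (\<forall>k<m. 0 \<le> a k) \<and> (\<forall>k<m. k \<notin> I \<longrightarrow> a k = 0)}"

definition lattice_cone :: "(nat \<Rightarrow> bool) \<Rightarrow> int vec set" where
  "lattice_cone s = {comb s a | a. \<forall>k<m. 0 \<le> a k}"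

lemma dim_row_B [simp]: "dim_row B = m" and dim_col_B [simp]: "dim_col B = m"
  using carrier by auto

lemma dim_ray [simp]: "dim_vec (ray k b) = m"
  by (cases b) (simp_all only: ray_def if_True if_False dim_col dim_row_B index_unit_vec)

lemma ray_carrier [simp]: "ray k b \<in> carrier_vec m"
  by (rule carrier_vecI) (rule dim_ray)

lemma ray_before: "j < k \<Longrightarrow> k < m \<Longrightarrow> ray k b $ j = 0"
  unfolding ray_def using upper by auto

lemma ray_diag: "k < m \<Longrightarrow> ray k b $ k = (if b then -1 else 1)"
  unfolding ray_def using diag by auto

lemma ray_inj:
  assumes "k < m" "l < m" "ray k b = ray l c"
  shows "k = l \<and> b = c"
proof -
  have "k = l"
  proof (rule ccontr)
    assume "k \<noteq> l"
    then consider "k < l" | "l < k" by linarith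
    then show False
    proof cases
      case 1
      then have "ray k b $ k = 0" using assms(2) unfolding assms(3) by (rule ray_before)
      then show False using ray_diag[OF assms(1), of b] by (simp split: if_splits)
    next
      case 2
      then have "ray l c $ l = 0" using assms(1) unfolding assms(3)[symmetric] by (rule ray_before)
      then show False using ray_diag[OF assms(2), of c] by (simp split: if_splits)
    qed
  qed
  moreover have "(if b then -1 else 1 :: int) = (if c then -1 else 1)"
    using ray_diag[OF assms(1), of b] ray_diag[OF assms(2), of c] assms(3) \<open>k = l\<close> by metis
  ultimately show ?thesis by (simp split: if_splits)
qed

lemma comb_carrier [simp]: "comb s a \<in> carrier_vec m"
  by (simp add: comb_def)

lemma dim_comb [simp]: "dim_vec (comb s a) = m"
  by (simp add: comb_def)

text \<open>Ray \<open>k\<close> vanishes in all coordinates before \<open>k\<close>, so the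
  coefficients solve a triangular system with diagonal entries 1 or -1.\<close>

lemma comb_index:
  assumes "j < m"
  shows "comb s a $ j = (\<Sum>k<j. a k * of_int (ray k (s k) $ j)) + a j * (if s j then -1 else 1)"
proof -
  have "(\<Sum>k<m. a k * of_int (ray k (s k) $ j)) = (\<Sum>k<Suc j. a k * of_int (ray k (s k) $ j))"
    by (rule sum.mono_neutral_right) (use assms ray_before in auto)
  then show ?thesis using assms by (simp add: comb_def ray_diag)
qed

text \<open>Forward substitution. Where the two choices of rays differ, the diagonal entries have
  opposite signs and non-negative coefficients must both be 0. This is the fan property: two cones
  meet along the cone on their common rays.\<close>

lemma comb_unique:
  assumes eq: "comb s a = comb t b" and i: "i < m"
    and sgn: "\<And>k. k < m \<Longrightarrow> s k = t k \<or> 0 \<le> a k \<and> 0 \<le> b k"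
  shows "a i = b i \<and> (a i \<noteq> 0 \<longrightarrow> s i = t i)"
  using i
proof (induction i rule: less_induct)
  case (less i)
  have IH: "a k * of_int (ray k (s k) $ i) = b k * of_int (ray k (t k) $ i)" if "k < i" for k
    using less.IH[of k] that less.prems by (cases "a k = 0") auto
  have "(\<Sum>k<i. a k * of_int (ray k (s k) $ i)) = (\<Sum>k<i. b k * of_int (ray k (t k) $ i))"
    by (rule sum.cong) (use IH in auto)
  moreover have "comb s a $ i = comb t b $ i" using eq by simp
  ultimately have "a i * (if s i then -1 else 1) = b i * (if t i then -1 else 1)"
    using comb_index[OF less.prems, of s a] comb_index[OF less.prems, of t b] by simp
  then show ?case using sgn[OF less.prems] by (auto split: if_splits)
qed

lemma comb_cong:
  assumes "\<And>k. k < m \<Longrightarrow> a k = b k" "\<And>k. k < m \<Longrightarrow> a k \<noteq> 0 \<Longrightarrow> s k = t k"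
  shows "comb s a = comb t b"
proof -
  have "a k * of_int (ray k (s k) $ j) = b k * of_int (ray k (t k) $ j)" if "k < m" for j k
    using assms[OF that] by (cases "a k = 0") auto
  then show ?thesis unfolding comb_def by (intro eq_vecI) (auto intro!: sum.cong)
qed

lemma comb_zero [simp]: "comb s (\<lambda>_. 0) = 0\<^sub>v m"
  unfolding comb_def by auto

lemma comb_add: "comb s a + comb s b = comb s (\<lambda>k. a k + b k)"
  unfolding comb_def by (intro eq_vecI) (auto simp: sum.distrib algebra_simps)

lemma comb_single:
  assumes "k < m" shows "comb s (\<lambda>l. if l = k then 1 else 0) = ray k (s k)"
proof (intro eq_vecI)
  fix j assume "j < dim_vec (ray k (s k))"
  then have "j < m" by simp
  have "(\<Sum>l<m. (if l = k then 1 else 0) * of_int (ray l (s l) $ j)) =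
      (\<Sum>l<m. if l = k then ray k (s k) $ j else 0)"
    by (intro sum.cong) auto
  then show "comb s (\<lambda>l. if l = k then 1 else 0) $ j = ray k (s k) $ j"
    using assms \<open>j < m\<close> by (simp add: comb_def)
qed simp

text \<open>Forward substitution stays in the integers because each diagonal entry is its own
  inverse. Every choice of rays is therefore a lattice basis.\<close>

lemma comb_exists:
  assumes x: "x \<in> carrier_vec m"
  shows "\<exists>a. x = comb s (a :: nat \<Rightarrow> int)"
proof -
  have "\<exists>a :: nat \<Rightarrow> int. \<forall>j<p. comb s a $ j = x $ j" if "p \<le> m" for p
    using that
  proof (induction p)
    case (Suc p)
    then obtain a :: "nat \<Rightarrow> int" where a: "\<forall>j<p. comb s a $ j = x $ j" by auto
    define e where "e = (if s p then -1 else (1 :: int))"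
    define a' where "a' = a(p := e * (x $ p - (\<Sum>k<p. a k * of_int (ray k (s k) $ p))))"
    have "comb s a' $ j = x $ j" if "j < Suc p" for j
    proof (cases "j = p")
      case True
      have "(\<Sum>k<p. a' k * of_int (ray k (s k) $ p)) = (\<Sum>k<p. a k * of_int (ray k (s k) $ p))"
        by (intro sum.cong) (auto simp: a'_def)
      then show ?thesis using True Suc.prems by (simp add: comb_index) (simp add: a'_def e_def)
    next
      case False
      then have "j < p" using that by simp
      moreover have "comb s a' $ j = comb s a $ j"
        using Suc.prems \<open>j < p\<close> by (simp add: comb_index) (simp add: a'_def)
      ultimately show ?thesis using a by simp
    qed
    then show ?case by blast
  qed auto
  then obtain a :: "nat \<Rightarrow> int" where "\<forall>j<m. comb s a $ j = x $ j" by blast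
  then have "x = comb s a" using x by (intro eq_vecI) auto
  then show ?thesis by blast
qed

text \<open>Back substitution: adding a multiple of the unit vector \<open>q\<close> does not change
  the pairings with later rays, since these vanish at \<open>q\<close>. With \<open>c\<close> an
  indicator function this yields the dual basis.\<close>

lemma dual_exists:
  fixes c :: "nat \<Rightarrow> int"
  shows "\<exists>u\<in>carrier_vec m. \<forall>k<m. u \<bullet> ray k (s k) = c k"
proof -
  have "\<exists>u\<in>carrier_vec m. \<forall>k<m. m - p \<le> k \<longrightarrow> u \<bullet> ray k (s k) = c k" if "p \<le> m" for p
    using that
  proof (induction p)
    case 0
    show ?case by (intro bexI[of _ "0\<^sub>v m"]) auto
  next
    case (Suc p)
    then obtain u where u: "u \<in> carrier_vec m" "\<forall>k<m. m - p \<le> k \<longrightarrow> u \<bullet> ray k (s k) = c k" by auto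
    define q where "q = m - Suc p"
    have q: "q < m" "m - p = Suc q" using Suc.prems by (auto simp: q_def)
    define e where "e = (if s q then -1 else (1 :: int))"
    define u' where "u' = u + (e * (c q - u \<bullet> ray q (s q))) \<cdot>\<^sub>v unit_vec m q"
    have *: "u' \<bullet> ray k (s k) = u \<bullet> ray k (s k) + e * (c q - u \<bullet> ray q (s q)) * ray k (s k) $ q" for k
      unfolding u'_def using u(1) q(1)
      by (subst add_scalar_prod_distrib[of _ m]) (auto simp: scalar_prod_left_unit[of _ m])
    have "u' \<bullet> ray k (s k) = c k" if "k < m" "q \<le> k" for k
    proof (cases "k = q")
      case True
      then show ?thesis unfolding * using q(1) by (simp add: ray_diag e_def)
    next
      case False
      then show ?thesis unfolding * using that u(2) q by (simp add: ray_before)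
    qed
    moreover have "u' \<in> carrier_vec m" using u(1) by (simp add: u'_def)
    ultimately show ?case unfolding q_def by blast
  qed
  from this[of m] show ?thesis by auto
qed

lemma scalar_prod_comb:
  assumes "w \<in> carrier_vec m"
  shows "map_vec of_int w \<bullet> comb s a = (\<Sum>k<m. a k * of_int (w \<bullet> ray k (s k)))"
proof -
  have "map_vec of_int w \<bullet> comb s a
      = (\<Sum>j<m. \<Sum>k<m. a k * of_int (w $ j * ray k (s k) $ j))"
    using assms
    by (auto simp: scalar_prod_def comb_def sum_distrib_left atLeast0LessThan mult_ac intro!: sum.cong)
  also have "\<dots> = (\<Sum>k<m. a k * of_int (w \<bullet> ray k (s k)))"
    by (subst sum.swap) (auto simp: scalar_prod_def atLeast0LessThan sum_distrib_left)
  finally show ?thesis .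
qed

lemma scalar_prod_comb_int:
  fixes a :: "nat \<Rightarrow> int"
  assumes "w \<in> carrier_vec m"
  shows "w \<bullet> comb s a = (\<Sum>k<m. a k * (w \<bullet> ray k (s k)))"
proof -
  have "map_vec of_int w = w" by auto
  then show ?thesis using scalar_prod_comb[OF assms, of s a] by simp
qed

lemma dual_monoid_cone:
  assumes "I \<subseteq> {..<m}"
  shows "dual_monoid m (cone s I) = {w \<in> carrier_vec m. \<forall>k\<in>I. 0 \<le> w \<bullet> ray k (s k)}"
proof (intro equalityI subsetI)
  fix w assume w: "w \<in> dual_monoid m (cone s I)"
  then have wc: "w \<in> carrier_vec m" by (simp add: dual_monoid_def)
  have "0 \<le> w \<bullet> ray k (s k)" if k: "k \<in> I" for k
  proof -
    have "comb s (\<lambda>l. if l = k then 1 else 0) \<in> cone s I"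
      unfolding cone_def using k by (intro CollectI exI conjI) auto
    then have "0 \<le> (\<Sum>l<m. (if l = k then 1 else 0) * real_of_int (w \<bullet> ray l (s l)))"
      using w unfolding dual_monoid_def scalar_prod_comb[OF wc, symmetric] by blast
    moreover have "(\<Sum>l<m. (if l = k then 1 else 0) * real_of_int (w \<bullet> ray l (s l))) =
        (\<Sum>l<m. if l = k then real_of_int (w \<bullet> ray k (s k)) else 0)"
      by (intro sum.cong) auto
    ultimately show ?thesis using k assms by auto
  qed
  then show "w \<in> {w \<in> carrier_vec m. \<forall>k\<in>I. 0 \<le> w \<bullet> ray k (s k)}" using wc by auto
next
  fix w assume "w \<in> {w \<in> carrier_vec m. \<forall>k\<in>I. 0 \<le> w \<bullet> ray k (s k)}"
  then have wc: "w \<in> carrier_vec m" and w: "\<forall>k\<in>I. 0 \<le> w \<bullet> ray k (s k)" by auto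
  have "0 \<le> map_vec of_int w \<bullet> v" if v: "v \<in> cone s I" for v
  proof -
    obtain a where a: "v = comb s a" "\<forall>k<m. 0 \<le> a k" "\<forall>k<m. k \<notin> I \<longrightarrow> a k = 0"
      using v unfolding cone_def by blast
    show ?thesis unfolding a(1) scalar_prod_comb[OF wc]
    proof (intro sum_nonneg)
      fix k assume "k \<in> {..<m}"
      then show "0 \<le> a k * real_of_int (w \<bullet> ray k (s k))"
        using a w by (cases "k \<in> I") auto
    qed
  qed
  then show "w \<in> dual_monoid m (cone s I)" using wc by (auto simp: dual_monoid_def)
qed

text \<open>By counting, \<open>m\<close> rays without a complete pair consist of exactly one ray
  from each of the \<open>m\<close> pairs.\<close>

lemma bott_max_gens_eq: "bott_max_gens B = {(\<lambda>k. ray k (s k)) ` {..<m} | s. True}"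
proof -
  have rays: "bott_rays B = {ray k b | k b. k < m}"
  proof (intro equalityI subsetI)
    fix x assume "x \<in> bott_rays B"
    then obtain i where i: "i < m" "x = unit_vec m i \<or> x = col B i"
      unfolding bott_rays_def by auto
    then have "x = ray i False \<or> x = ray i True" by (simp add: ray_def)
    then show "x \<in> {ray k b | k b. k < m}" using i(1) by blast
  next
    fix x assume "x \<in> {ray k b | k b. k < m}"
    then obtain k b where "x = ray k b" "k < m" by blast
    then show "x \<in> bott_rays B" unfolding bott_rays_def by (cases b) (auto simp: ray_def)
  qed
  show ?thesis
  proof (intro equalityI subsetI)
    fix S assume "S \<in> bott_max_gens B"
    then have S: "S \<subseteq> bott_rays B" "card S = m"
      "\<And>k. k < m \<Longrightarrow> \<not> {ray k False, ray k True} \<subseteq> S"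
      unfolding bott_max_gens_def by (simp_all add: ray_def)
    define K where "K = {k. k < m \<and> (\<exists>b. ray k b \<in> S)}"
    define s where "s k = (ray k True \<in> S)" for k
    have sub: "S \<subseteq> (\<lambda>k. ray k (s k)) ` K"
    proof
      fix x assume x: "x \<in> S"
      then obtain k b where kb: "x = ray k b" "k < m" using S(1) rays by blast
      then have "b = s k" using S(3)[of k] x by (cases b) (auto simp: s_def)
      then show "x \<in> (\<lambda>k. ray k (s k)) ` K" using kb x by (auto simp: K_def)
    qed
    have "finite K" "K \<subseteq> {..<m}" by (auto simp: K_def)
    have "m \<le> card K"
      using card_mono[OF _ sub] card_image_le[OF \<open>finite K\<close>, of "\<lambda>k. ray k (s k)"] S(2) \<open>finite K\<close>
      by simp
    then have "K = {..<m}" using \<open>K \<subseteq> {..<m}\<close> by (metis card_lessThan card_seteq finite_lessThan)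
    moreover have "ray k (s k) \<in> S" if "k < m" for k
    proof -
      obtain b where "ray k b \<in> S" using \<open>K = {..<m}\<close> \<open>k < m\<close> by (auto simp: K_def)
      then show ?thesis by (cases "ray k True \<in> S"; cases b) (simp_all add: s_def)
    qed
    ultimately have "S = (\<lambda>k. ray k (s k)) ` {..<m}" using sub by auto
    then show "S \<in> {(\<lambda>k. ray k (s k)) ` {..<m} | s. True}" by blast
  next
    fix S assume "S \<in> {(\<lambda>k. ray k (s k)) ` {..<m} | s. True}"
    then obtain s where S: "S = (\<lambda>k. ray k (s k)) ` {..<m}" by blast
    have "inj_on (\<lambda>k. ray k (s k)) {..<m}" by (rule inj_onI) (use ray_inj in auto)
    then have "card S = m" by (simp add: S card_image)
    moreover have "\<not> {ray k False, ray k True} \<subseteq> S" if "k < m" for k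
    proof
      assume "{ray k False, ray k True} \<subseteq> S"
      then obtain l l' where "l < m" "l' < m" "ray k False = ray l (s l)" "ray k True = ray l' (s l')"
        by (auto simp: S)
      then have "s k = False" "s k = True" using ray_inj that by blast+
      then show False by simp
    qed
    moreover have "S \<subseteq> bott_rays B" by (auto simp: rays S)
    ultimately show "S \<in> bott_max_gens B"
      unfolding bott_max_gens_def by (simp add: ray_def)
  qed
qed

text \<open>\<open>cone_span\<close> attaches coefficients to vectors and \<open>cone\<close> to
  positions; the two agree because different positions carry different rays.\<close>

lemma cone_span_eq:
  assumes "I \<subseteq> {..<m}"
  shows "cone_span m ((\<lambda>k. ray k (s k)) ` I) = cone s I"
proof -
  have inj: "inj_on (\<lambda>k. ray k (s k)) I"
    by (rule inj_onI) (meson ray_inj assms lessThan_iff subsetD)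
  have *: "(\<Sum>u\<in>(\<lambda>k. ray k (s k)) ` I. c u * real_of_int (u $ j)) =
      (\<Sum>k<m. (if k \<in> I then c (ray k (s k)) else 0) * real_of_int (ray k (s k) $ j))" for c j
  proof -
    have "(\<Sum>u\<in>(\<lambda>k. ray k (s k)) ` I. c u * real_of_int (u $ j)) =
      (\<Sum>k\<in>I. (if k \<in> I then c (ray k (s k)) else 0) * real_of_int (ray k (s k) $ j))"
      by (subst sum.reindex[OF inj]) (auto intro!: sum.cong)
    also have "\<dots> = (\<Sum>k<m. (if k \<in> I then c (ray k (s k)) else 0) * real_of_int (ray k (s k) $ j))"
      by (rule sum.mono_neutral_left) (use assms in auto)
    finally show ?thesis .
  qed
  show ?thesis
  proof (intro equalityI subsetI)
    fix v assume "v \<in> cone_span m ((\<lambda>k. ray k (s k)) ` I)"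
    then obtain c where c: "v = comb s (\<lambda>k. if k \<in> I then c (ray k (s k)) else 0)"
      "\<forall>k\<in>I. 0 \<le> c (ray k (s k))"
      unfolding cone_span_def comb_def * by auto
    show "v \<in> cone s I" unfolding cone_def using c by (intro CollectI exI conjI) auto
  next
    fix v assume "v \<in> cone s I"
    then obtain a where a: "v = comb s a" "\<forall>k<m. 0 \<le> a k" "\<forall>k<m. k \<notin> I \<longrightarrow> a k = 0"
      unfolding cone_def by blast
    define c where "c u = a (the_inv_into I (\<lambda>k. ray k (s k)) u)" for u
    have c: "c (ray k (s k)) = a k" if "k \<in> I" for k
      unfolding c_def using the_inv_into_f_f[OF inj that] by simp
    have "v = comb s (\<lambda>k. if k \<in> I then c (ray k (s k)) else 0)"
      unfolding a(1) by (rule comb_cong) (use a(3) c in auto)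
    moreover have "\<forall>u\<in>(\<lambda>k. ray k (s k)) ` I. 0 \<le> c u" using c a(2) assms by auto
    ultimately show "v \<in> cone_span m ((\<lambda>k. ray k (s k)) ` I)"
      unfolding cone_span_def comb_def *[symmetric] by blast
  qed
qed

lemma bott_fan_eq: "bott_fan B = {cone s I | s I. I \<subseteq> {..<m}}"
proof -
  have "bott_fan B = {cone_span m F | F s. F \<subseteq> (\<lambda>k. ray k (s k)) ` {..<m}}"
    unfolding bott_fan_def bott_max_gens_eq by auto
  also have "\<dots> = {cone_span m ((\<lambda>k. ray k (s k)) ` I) | s I. I \<subseteq> {..<m}}"
    by (auto simp: subset_image_iff)
  also have "\<dots> = {cone s I | s I. I \<subseteq> {..<m}}"
  proof (intro equalityI subsetI; clarify)
    fix s I assume "I \<subseteq> {..<m}"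
    then show "\<exists>t J. cone_span m ((\<lambda>k. ray k (s k)) ` I) = cone t J \<and> J \<subseteq> {..<m}"
      by (intro exI[of _ s] exI[of _ I]) (simp add: cone_span_eq)
  next
    fix s I assume "I \<subseteq> {..<m}"
    then show "\<exists>t J. cone s I = cone_span m ((\<lambda>k. ray k (t k)) ` J) \<and> J \<subseteq> {..<m}"
      by (intro exI[of _ s] exI[of _ I]) (simp add: cone_span_eq)
  qed
  finally show ?thesis .
qed

lemma lattice_cone_carrier: "lattice_cone s \<subseteq> carrier_vec m"
  by (auto simp: lattice_cone_def)

lemma ray_in_lattice_cone:
  assumes "k < m" shows "ray k (s k) \<in> lattice_cone s"
proof -
  have "comb s (\<lambda>l. if l = k then 1 else 0) \<in> lattice_cone s"
    unfolding lattice_cone_def by fastforce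
  then show ?thesis using comb_single[OF assms, of s] by metis
qed

lemma ray_nonzero:
  assumes "k < m" shows "ray k b \<noteq> 0\<^sub>v m"
proof
  assume eq: "ray k b = 0\<^sub>v m"
  have "ray k b $ k = 0" unfolding eq using assms by simp
  then show False using ray_diag[OF assms, of b] by (simp split: if_splits)
qed

text \<open>Pairing with a vector of the dual basis reads off one coefficient, and these vectors lie
  in the dual monoid.\<close>

lemma in_lattice_coneI:
  assumes x: "x \<in> carrier_vec m"
    and nonneg: "\<And>u. u \<in> dual_monoid m (cone s {..<m}) \<Longrightarrow> 0 \<le> u \<bullet> x"
  shows "x \<in> lattice_cone s"
proof -
  obtain a :: "nat \<Rightarrow> int" where a: "x = comb s a" using comb_exists[OF x] by blast
  have "0 \<le> a k" if "k < m" for k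
  proof -
    obtain u where u: "u \<in> carrier_vec m" "\<forall>l<m. u \<bullet> ray l (s l) = (if l = k then 1 else 0)"
      using dual_exists[of s "\<lambda>l. if l = k then 1 else 0"] by blast
    have "(\<Sum>l<m. a l * (u \<bullet> ray l (s l))) = (\<Sum>l<m. if l = k then a k else 0)"
      by (intro sum.cong) (auto simp: u(2))
    then have "u \<bullet> x = a k"
      unfolding a scalar_prod_comb_int[OF u(1)] using that by simp
    moreover have "u \<in> dual_monoid m (cone s {..<m})" by (subst dual_monoid_cone) (use u in auto)
    ultimately show ?thesis using nonneg by metis
  qed
  then show ?thesis using a by (auto simp: lattice_cone_def)
qed

text \<open>The lattice points of a maximal cone form a free commutative monoid, whose generators
  are its indecomposable elements. This characterizes the rays by addition alone, so additive
  bijections between such cones preserve them.\<close>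

lemma irreducible_iff:
  assumes x: "x \<in> lattice_cone s"
  shows "x \<in> (\<lambda>k. ray k (s k)) ` {..<m} \<longleftrightarrow>
    x \<noteq> 0\<^sub>v m \<and> (\<forall>y\<in>lattice_cone s. \<forall>z\<in>lattice_cone s. x = y + z \<longrightarrow> y = 0\<^sub>v m \<or> z = 0\<^sub>v m)"
    (is "_ \<longleftrightarrow> ?irr")
proof
  assume "x \<in> (\<lambda>k. ray k (s k)) ` {..<m}"
  then obtain k where k: "k < m" "x = ray k (s k)" by blast
  have "x \<noteq> 0\<^sub>v m" unfolding k(2) by (rule ray_nonzero[OF k(1)])
  moreover have "y = 0\<^sub>v m \<or> z = 0\<^sub>v m"
    if yz: "y \<in> lattice_cone s" "z \<in> lattice_cone s" "x = y + z" for y z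
  proof -
    obtain a :: "nat \<Rightarrow> int" where a: "y = comb s a" "\<forall>l<m. 0 \<le> a l"
      using yz(1) unfolding lattice_cone_def by auto
    obtain b :: "nat \<Rightarrow> int" where b: "z = comb s b" "\<forall>l<m. 0 \<le> b l"
      using yz(2) unfolding lattice_cone_def by auto
    have "comb s (\<lambda>l. if l = k then 1 else 0) = comb s (\<lambda>l. a l + b l)"
      unfolding comb_single[OF k(1)] comb_add[symmetric] k(2)[symmetric] yz(3) a(1) b(1) ..
    then have e: "(if l = k then 1 else 0) = a l + b l" if "l < m" for l
      using comb_unique that by blast
    have "a k = 0 \<or> b k = 0" proof -
      have "1 = a k + b k" "0 \<le> a k" "0 \<le> b k" using e[OF k(1)] a(2) b(2) k(1) by auto
      then show ?thesis by linarith
    qed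
    moreover have "a l = 0 \<and> b l = 0" if "l < m" "l \<noteq> k" for l
      using e[OF that(1)] a(2) b(2) that by (simp add: add_nonneg_eq_0_iff)
    ultimately have "(\<forall>l<m. a l = 0) \<or> (\<forall>l<m. b l = 0)" by blast
    then have "comb s a = comb s (\<lambda>_. 0) \<or> comb s b = comb s (\<lambda>_. 0)"
      using comb_cong[of a "\<lambda>_. 0" s s] comb_cong[of b "\<lambda>_. 0" s s] by blast
    then show ?thesis unfolding a(1) b(1) by simp
  qed
  ultimately show ?irr by blast
next
  assume irr: ?irr
  obtain a :: "nat \<Rightarrow> int" where a: "x = comb s a" "\<forall>l<m. 0 \<le> a l"
    using x unfolding lattice_cone_def by blast
  obtain k where k: "k < m" "a k \<noteq> 0"
    proof (rule ccontr)
    assume "\<not> thesis"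
    then have "comb s a = comb s (\<lambda>_. 0)" using that by (intro comb_cong) auto
    then show False using irr a(1) by simp
  qed
  define b where "b l = a l - (if l = k then 1 else 0)" for l
  have "comb s b \<in> lattice_cone s"
    proof -
    have "0 \<le> b l" if "l < m" for l using a(2) k that by (cases "l = k") (auto simp: b_def order_less_le)
    then show ?thesis unfolding lattice_cone_def by blast
  qed
  moreover have x_eq: "x = ray k (s k) + comb s b"
    unfolding a(1) comb_single[OF k(1), of s, symmetric] comb_add by (simp add: b_def)
  moreover have "ray k (s k) \<noteq> 0\<^sub>v m" by (rule ray_nonzero[OF k(1)])
  ultimately have "comb s b = 0\<^sub>v m" using irr ray_in_lattice_cone[OF k(1)] by blast
  then have "x = ray k (s k)" using x_eq by simp
  then show "x \<in> (\<lambda>k. ray k (s k)) ` {..<m}" using k by blast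
qed

end

section \<open>The lattice map of a toric morphism\<close>

text \<open>The properties of a fan on which the argument with characters rests. The last one says
  that the dual monoid of a cone generates the character lattice, which expresses that the cone is
  strongly convex.\<close>

locale smooth_fan =
  fixes m :: nat and \<Sigma> :: "real vec set set"
  assumes cone_carrier: "\<sigma> \<in> \<Sigma> \<Longrightarrow> \<sigma> \<subseteq> carrier_vec m"
    and zero_cone: "{0\<^sub>v m} \<in> \<Sigma>"
    and zero_mem: "\<sigma> \<in> \<Sigma> \<Longrightarrow> 0\<^sub>v m \<in> \<sigma>"
    and dual_generates: "\<sigma> \<in> \<Sigma> \<Longrightarrow> w \<in> carrier_vec m \<Longrightarrow> \<exists>b\<in>dual_monoid m \<sigma>. w + b \<in> dual_monoid m \<sigma>"
begin

abbreviation "torus_points \<equiv> affine_points m {0\<^sub>v m}"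

lemma torus_restrict:
  assumes "\<sigma> \<in> \<Sigma>" "t \<in> torus_points"
  shows "restrict t (dual_monoid m \<sigma>) \<in> affine_points m \<sigma>"
  using assms restrict_affine_points[of "{0\<^sub>v m}" \<sigma> m t] cone_carrier zero_mem by blast

text \<open>No transitivity of the gluing relation is needed here: as the dual monoid generates the
  character lattice, an extension of a torus point to any larger monoid is unique.\<close>

lemma chart_torus:
  assumes \<tau>: "\<tau> \<in> \<Sigma>" and t: "t \<in> torus_points"
  shows "chart m \<Sigma> {0\<^sub>v m} t = chart m \<Sigma> \<tau> (restrict t (dual_monoid m \<tau>))"
proof -
  have "(\<rho>, \<gamma>) \<in> chart m \<Sigma> {0\<^sub>v m} t \<longleftrightarrow> (\<rho>, \<gamma>) \<in> chart m \<Sigma> \<tau> (restrict t (dual_monoid m \<tau>))"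
    for \<rho> \<gamma>
  proof (cases "\<rho> \<in> \<Sigma>")
    case \<rho>: True
    have zero_int: "{0\<^sub>v m} \<inter> \<rho> = {0\<^sub>v m}" "0\<^sub>v m \<in> \<tau> \<inter> \<rho>" "\<tau> \<inter> \<rho> \<subseteq> carrier_vec m"
      using zero_mem \<tau> \<rho> cone_carrier by auto
    have sub: "dual_monoid m \<tau> \<subseteq> dual_monoid m (\<tau> \<inter> \<rho>)" "dual_monoid m \<rho> \<subseteq> dual_monoid m (\<tau> \<inter> \<rho>)"
      by (rule dual_monoid_antimono, blast)+
    have t_ext: "restrict t (dual_monoid m {0\<^sub>v m}) = t" by (rule affine_points_restrict[OF t])
    have 1: "(\<rho>, \<gamma>) \<in> chart m \<Sigma> {0\<^sub>v m} t \<longleftrightarrow> \<gamma> = restrict t (dual_monoid m \<rho>)"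
      unfolding mem_chart_iff zero_int
      using t \<rho> zero_cone torus_restrict[OF \<rho> t] t_ext
      by (auto dest: affine_points_restrict intro!: bexI[of _ t])
    have ext: "restrict t (dual_monoid m (\<tau> \<inter> \<rho>)) \<in> affine_points m (\<tau> \<inter> \<rho>)"
      by (rule restrict_affine_points[OF _ _ t]) (use zero_int in auto)
    have unique: "restrict \<delta> (dual_monoid m \<rho>) = restrict t (dual_monoid m \<rho>)"
      if \<delta>: "\<delta> \<in> affine_points m (\<tau> \<inter> \<rho>)"
        and eq: "restrict t (dual_monoid m \<tau>) = restrict \<delta> (dual_monoid m \<tau>)" for \<delta>
    proof (rule restrict_ext)
      fix w assume "w \<in> dual_monoid m \<rho>"
      then have w: "w \<in> dual_monoid m (\<tau> \<inter> \<rho>)" "w \<in> carrier_vec m"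
        using sub dual_monoid_carrier[of m \<rho>] by auto
      obtain b where b: "b \<in> dual_monoid m \<tau>" "w + b \<in> dual_monoid m \<tau>"
        using dual_generates[OF \<tau> w(2)] by blast
      have bc: "b \<in> carrier_vec m" using b dual_monoid_carrier by blast
      have on: "\<delta> u = t u" if "u \<in> dual_monoid m \<tau>" for u
        using fun_cong[OF eq, of u] that by simp
      have "\<delta> w * t b = t w * t b"
        using affine_points_add[OF \<delta> w(1), of b] affine_points_add[OF t, of w b] b sub on w(2) bc
        by (auto simp: dual_monoid_zero)
      then show "\<delta> w = t w" using torus_point_nonzero[OF t bc] by simp
    qed
    have "(\<rho>, \<gamma>) \<in> chart m \<Sigma> \<tau> (restrict t (dual_monoid m \<tau>)) \<longleftrightarrow> \<gamma> = restrict t (dual_monoid m \<rho>)"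
    proof
      assume "(\<rho>, \<gamma>) \<in> chart m \<Sigma> \<tau> (restrict t (dual_monoid m \<tau>))"
      then show "\<gamma> = restrict t (dual_monoid m \<rho>)" unfolding mem_chart_iff using unique by metis
    next
      assume "\<gamma> = restrict t (dual_monoid m \<rho>)"
      then show "(\<rho>, \<gamma>) \<in> chart m \<Sigma> \<tau> (restrict t (dual_monoid m \<tau>))"
        unfolding mem_chart_iff
        using \<tau> \<rho> torus_restrict[OF \<rho> t] torus_restrict[OF \<tau> t] sub
        by (simp add: Int_absorb1 bexI[OF _ ext])
    qed
    then show ?thesis using 1 by simp
  qed (auto simp: mem_chart_iff)
  then show ?thesis by auto
qed

text \<open>The monomial of exponent 0 is the constant 1, which makes each whole chart a principal
  open set.\<close>

lemma one_monomial:
  assumes "\<sigma> \<in> \<Sigma>"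
  shows "(\<lambda>\<gamma>. \<gamma> (0\<^sub>v m)) \<in> coordinate_ring m \<sigma>"
    and "principal_open m \<Sigma> \<sigma> (\<lambda>\<gamma>. \<gamma> (0\<^sub>v m)) = chart m \<Sigma> \<sigma> ` affine_points m \<sigma>"
proof -
  show "(\<lambda>\<gamma>. \<gamma> (0\<^sub>v m)) \<in> coordinate_ring m \<sigma>"
    by (intro monomial_in_coordinate_ring dual_monoid_0_mem cone_carrier assms)
  have "{\<gamma> \<in> affine_points m \<sigma>. \<gamma> (0\<^sub>v m) \<noteq> 0} = affine_points m \<sigma>"
    by (auto simp: affine_points_zero)
  then show "principal_open m \<Sigma> \<sigma> (\<lambda>\<gamma>. \<gamma> (0\<^sub>v m)) = chart m \<Sigma> \<sigma> ` affine_points m \<sigma>"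
    by (simp add: principal_open_def)
qed

lemma chart_open:
  assumes \<sigma>: "\<sigma> \<in> \<Sigma>"
  shows "zariski_open m \<Sigma> (chart m \<Sigma> \<sigma> ` affine_points m \<sigma>)"
  unfolding zariski_open_def
proof (intro conjI ballI)
  show "chart m \<Sigma> \<sigma> ` affine_points m \<sigma> \<subseteq> toric_points m \<Sigma>"
    using \<sigma> by (auto simp: toric_points_eq)
  fix p assume "p \<in> chart m \<Sigma> \<sigma> ` affine_points m \<sigma>"
  then show "\<exists>\<sigma>'\<in>\<Sigma>. \<exists>h\<in>coordinate_ring m \<sigma>'. p \<in> principal_open m \<Sigma> \<sigma>' h \<and>
      principal_open m \<Sigma> \<sigma>' h \<subseteq> chart m \<Sigma> \<sigma> ` affine_points m \<sigma>"
    using one_monomial[OF \<sigma>] \<sigma> by (intro bexI[of _ \<sigma>] bexI[of _ "\<lambda>\<gamma>. \<gamma> (0\<^sub>v m)"]) auto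
qed

text \<open>The monomial \<open>u\<close> as a function on points of the glued variety; it makes
  sense on the chart of \<sigma> because charts are injective.\<close>

definition chart_monomial :: "real vec set \<Rightarrow> int vec \<Rightarrow> chart_point set \<Rightarrow> complex" where
  "chart_monomial \<sigma> u c = the_inv_into (affine_points m \<sigma>) (chart m \<Sigma> \<sigma>) c u"

lemma chart_monomial_chart:
  assumes "\<sigma> \<in> \<Sigma>" "\<gamma> \<in> affine_points m \<sigma>"
  shows "chart_monomial \<sigma> u (chart m \<Sigma> \<sigma> \<gamma>) = \<gamma> u"
proof -
  have "inj_on (chart m \<Sigma> \<sigma>) (affine_points m \<sigma>)"
    using chart_inj[OF assms(1)] by (intro inj_onI)
  then show ?thesis unfolding chart_monomial_def using assms by (simp add: the_inv_into_f_f)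
qed

lemma chart_monomial_regular:
  assumes \<sigma>: "\<sigma> \<in> \<Sigma>" and u: "u \<in> dual_monoid m \<sigma>"
  shows "regular_on m \<Sigma> (chart m \<Sigma> \<sigma> ` affine_points m \<sigma>) (chart_monomial \<sigma> u)"
  unfolding regular_on_def
proof (intro conjI ballI chart_open[OF \<sigma>])
  fix p assume p: "p \<in> chart m \<Sigma> \<sigma> ` affine_points m \<sigma>"
  have "chart_monomial \<sigma> u (chart m \<Sigma> \<sigma> \<gamma>) = \<gamma> u / \<gamma> (0\<^sub>v m)" if "\<gamma> \<in> affine_points m \<sigma>" for \<gamma>
    using chart_monomial_chart[OF \<sigma> that] affine_points_zero[OF that] by simp
  then show "\<exists>\<sigma>'\<in>\<Sigma>. \<exists>g\<in>coordinate_ring m \<sigma>'. \<exists>h\<in>coordinate_ring m \<sigma>'.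
      p \<in> principal_open m \<Sigma> \<sigma>' h \<and> principal_open m \<Sigma> \<sigma>' h \<subseteq> chart m \<Sigma> \<sigma> ` affine_points m \<sigma> \<and>
      (\<forall>\<gamma>\<in>affine_points m \<sigma>'. h \<gamma> \<noteq> 0 \<longrightarrow> chart_monomial \<sigma> u (chart m \<Sigma> \<sigma>' \<gamma>) = g \<gamma> / h \<gamma>)"
    using one_monomial[OF \<sigma>] monomial_in_coordinate_ring[OF u] p \<sigma>
    by (intro bexI[of _ \<sigma>] bexI[of _ "\<lambda>\<gamma>. \<gamma> u"] bexI[of _ "\<lambda>\<gamma>. \<gamma> (0\<^sub>v m)"]) auto
qed

end

section \<open>Pullback of characters along a toric morphism\<close>

locale toric_map = X: smooth_fan m \<Sigma> + Y: smooth_fan m' \<Sigma>' for m \<Sigma> m' \<Sigma>' +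
  fixes \<phi> :: "chart_point set \<Rightarrow> chart_point set"
    and \<psi> :: "(int vec \<Rightarrow> complex) \<Rightarrow> int vec \<Rightarrow> complex"
  assumes morphism: "variety_morphism (toric_variety m \<Sigma>) (toric_variety m' \<Sigma>') \<phi>"
    and hom: "\<psi> \<in> hom (torus_group m) (torus_group m')"
    and equivariant: "t \<in> affine_points m {0\<^sub>v m} \<Longrightarrow>
      \<phi> (chart m \<Sigma> {0\<^sub>v m} t) = chart m' \<Sigma>' {0\<^sub>v m'} (\<psi> t)"
begin

lemma torus_map: "t \<in> X.torus_points \<Longrightarrow> \<psi> t \<in> Y.torus_points"
  using hom by (auto simp: hom_def torus_group_def)

lemma torus_map_mult:
  "s \<in> X.torus_points \<Longrightarrow> t \<in> X.torus_points \<Longrightarrow>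
    \<psi> (\<lambda>w\<in>carrier_vec m. s w * t w) = (\<lambda>w\<in>carrier_vec m'. \<psi> s w * \<psi> t w)"
  using hom by (auto simp: hom_def torus_group_def)

text \<open>The monomial \<open>u\<close> is regular around \<open>\<phi> p\<close>, so its pullback
  is a quotient of coordinate functions in some chart around \<open>p\<close>. On torus points this
  quotient computes the character \<open>u\<close> of \<open>\<psi> t\<close>. With \<open>p\<close>
  in the torus it gives differentiability, with \<open>p\<close> a fixed point it gives signs of
  exponents.\<close>

lemma pullback_monomial:
  assumes \<sigma>: "\<sigma> \<in> \<Sigma>'" and u: "u \<in> dual_monoid m' \<sigma>"
    and p: "p \<in> toric_points m \<Sigma>" "\<phi> p \<in> chart m' \<Sigma>' \<sigma> ` affine_points m' \<sigma>"
  obtains \<tau> \<gamma> W W' b a where "\<tau> \<in> \<Sigma>" "\<gamma> \<in> affine_points m \<tau>" "p = chart m \<Sigma> \<tau> \<gamma>"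
    "W \<subseteq> dual_monoid m \<tau>" "W' \<subseteq> dual_monoid m \<tau>" "(\<Sum>w\<in>W'. b w * \<gamma> w) \<noteq> 0"
    "\<forall>t\<in>X.torus_points. (\<Sum>w\<in>W'. b w * t w) \<noteq> 0 \<longrightarrow>
      \<psi> t u = (\<Sum>w\<in>W. a w * t w) / (\<Sum>w\<in>W'. b w * t w)"
proof -
  define V where "V = chart m' \<Sigma>' \<sigma> ` affine_points m' \<sigma>"
  define V' where "V' = {p \<in> toric_points m \<Sigma>. \<phi> p \<in> V}"
  have "regular_on m \<Sigma> V' (Y.chart_monomial \<sigma> u \<circ> \<phi>)"
    using morphism Y.chart_monomial_regular[OF \<sigma> u] Y.chart_open[OF \<sigma>]
    unfolding variety_morphism_def toric_variety_def V'_def V_def by simp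
  moreover have "p \<in> V'" using p by (simp add: V'_def V_def)
  ultimately obtain \<tau> g h where \<tau>: "\<tau> \<in> \<Sigma>" and g: "g \<in> coordinate_ring m \<tau>" and h: "h \<in> coordinate_ring m \<tau>"
    and ph: "p \<in> principal_open m \<Sigma> \<tau> h"
    and gh: "\<And>\<gamma>. \<gamma> \<in> affine_points m \<tau> \<Longrightarrow> h \<gamma> \<noteq> 0 \<Longrightarrow>
      (Y.chart_monomial \<sigma> u \<circ> \<phi>) (chart m \<Sigma> \<tau> \<gamma>) = g \<gamma> / h \<gamma>"
    unfolding regular_on_def by meson
  obtain W a where W: "W \<subseteq> dual_monoid m \<tau>" and ga: "g = (\<lambda>\<gamma>. \<Sum>w\<in>W. a w * \<gamma> w)"
    using g unfolding coordinate_ring_def by blast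
  obtain W' b where W': "W' \<subseteq> dual_monoid m \<tau>" and hb: "h = (\<lambda>\<gamma>. \<Sum>w\<in>W'. b w * \<gamma> w)"
    using h unfolding coordinate_ring_def by blast
  obtain \<gamma> where \<gamma>: "\<gamma> \<in> affine_points m \<tau>" "p = chart m \<Sigma> \<tau> \<gamma>" "h \<gamma> \<noteq> 0"
    using ph unfolding principal_open_def by blast
  show ?thesis
  proof (rule that[OF \<tau> \<gamma>(1,2) W W'])
    show "(\<Sum>w\<in>W'. b w * \<gamma> w) \<noteq> 0" using \<gamma>(3) hb by simp
  next
    show "\<forall>t\<in>X.torus_points. (\<Sum>w\<in>W'. b w * t w) \<noteq> 0 \<longrightarrow>
        \<psi> t u = (\<Sum>w\<in>W. a w * t w) / (\<Sum>w\<in>W'. b w * t w)"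
    proof (intro ballI impI)
    fix t assume t: "t \<in> X.torus_points" and nz: "(\<Sum>w\<in>W'. b w * t w) \<noteq> 0"
    define t' where "t' = restrict t (dual_monoid m \<tau>)"
    have "(\<Sum>w\<in>W. a w * t' w) = (\<Sum>w\<in>W. a w * t w)"
      by (rule sum.cong) (use W in \<open>auto simp: t'_def\<close>)
    then have g': "g t' = (\<Sum>w\<in>W. a w * t w)" by (simp add: ga)
    have "(\<Sum>w\<in>W'. b w * t' w) = (\<Sum>w\<in>W'. b w * t w)"
      by (rule sum.cong) (use W' in \<open>auto simp: t'_def\<close>)
    then have h': "h t' = (\<Sum>w\<in>W'. b w * t w)" by (simp add: hb)
    have t'_mem: "t' \<in> affine_points m \<tau>" unfolding t'_def by (rule X.torus_restrict[OF \<tau> t])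
    have "\<phi> (chart m \<Sigma> \<tau> t') = chart m' \<Sigma>' \<sigma> (restrict (\<psi> t) (dual_monoid m' \<sigma>))"
      unfolding t'_def X.chart_torus[OF \<tau> t, symmetric] equivariant[OF t]
      by (rule Y.chart_torus[OF \<sigma> torus_map[OF t]])
    then have "(Y.chart_monomial \<sigma> u \<circ> \<phi>) (chart m \<Sigma> \<tau> t') = \<psi> t u"
      using Y.chart_monomial_chart[OF \<sigma> Y.torus_restrict[OF \<sigma> torus_map[OF t]]] u by simp
    then show "\<psi> t u = (\<Sum>w\<in>W. a w * t w) / (\<Sum>w\<in>W'. b w * t w)"
      using gh[OF t'_mem] h' g' nz by metis
    qed
  qed
qed

lemma character_on_one_param:
  assumes l: "l \<in> carrier_vec m" and u: "u \<in> carrier_vec m'"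
  shows "\<exists>n::int. \<forall>z. \<psi> (one_param m l z) u = exp (z * of_int n)"
proof -
  define F where "F z = \<psi> (one_param m l z) u" for z
  have op: "one_param m l z \<in> X.torus_points" for z by (rule one_param_torus[OF l])
  have add: "F (z + z') = F z * F z'" for z z'
  proof -
    have "one_param m l (z + z') = (\<lambda>w\<in>carrier_vec m. one_param m l z w * one_param m l z' w)"
      by (auto simp: one_param_def distrib_right exp_add)
    then show ?thesis using u torus_map_mult[OF op op] by (simp add: F_def)
  qed
  have F_nz: "F z \<noteq> 0" for z unfolding F_def by (rule torus_point_nonzero[OF torus_map[OF op] u])
  have F0: "F 0 = 1" using add[of 0 0] F_nz[of 0] by simp
  \<comment> \<open>All exponents of a one-parameter subgroup are integers, so 2 pi i is a period in
    the logarithmic coordinate.\<close>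
  have "exp (2 * pi * \<i> * of_int k) = 1" for k
    using cis_multiple_2pi[of "of_int k"] by (simp add: cis_conv_exp mult_ac)
  then have "one_param m l (2 * pi * \<i>) = one_param m l 0" by (simp add: one_param_def)
  then have period: "F (2 * pi * \<i>) = 1" using F0 by (simp add: F_def)
  define p where "p = chart m \<Sigma> {0\<^sub>v m} (one_param m l 0)"
  have p: "p \<in> toric_points m \<Sigma>" unfolding p_def toric_points_eq using X.zero_cone op by blast
  have \<phi>p: "\<phi> p \<in> chart m' \<Sigma>' {0\<^sub>v m'} ` Y.torus_points"
    unfolding p_def equivariant[OF op] using torus_map[OF op] by blast
  have u': "u \<in> dual_monoid m' {0\<^sub>v m'}" using u by (simp add: dual_monoid_zero)
  obtain \<tau> \<gamma> W W' b a where \<tau>: "\<tau> \<in> \<Sigma>" and \<gamma>: "\<gamma> \<in> affine_points m \<tau>" "p = chart m \<Sigma> \<tau> \<gamma>"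
    and W: "W \<subseteq> dual_monoid m \<tau>" "W' \<subseteq> dual_monoid m \<tau>" and nz: "(\<Sum>w\<in>W'. b w * \<gamma> w) \<noteq> 0"
    and quot: "\<forall>t\<in>X.torus_points. (\<Sum>w\<in>W'. b w * t w) \<noteq> 0 \<longrightarrow>
      \<psi> t u = (\<Sum>w\<in>W. a w * t w) / (\<Sum>w\<in>W'. b w * t w)"
    by (rule pullback_monomial[OF Y.zero_cone u' p \<phi>p])
  have Wc: "W \<subseteq> carrier_vec m" "W' \<subseteq> carrier_vec m" using W dual_monoid_carrier[of m \<tau>] by auto
  \<comment> \<open>The quotient is known only where its denominator is nonzero. As charts are
    injective, \<gamma> is the identity of the torus read in the chart \<tau>; so the denominator is
    nonzero at z = 0 and then also nearby.\<close>
  have \<gamma>_eq: "\<gamma> = restrict (one_param m l 0) (dual_monoid m \<tau>)"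
    using chart_inj[OF \<tau> \<gamma>(1) X.torus_restrict[OF \<tau> op]] \<gamma>(2) X.chart_torus[OF \<tau> op]
    unfolding p_def by metis
  define G where "G z = (\<Sum>w\<in>W. a w * exp (z * of_int (l \<bullet> w)))" for z
  define H where "H z = (\<Sum>w\<in>W'. b w * exp (z * of_int (l \<bullet> w)))" for z
  have G: "(\<Sum>w\<in>W. a w * one_param m l z w) = G z" for z
    unfolding G_def by (rule sum.cong) (use Wc in \<open>auto simp: one_param_def\<close>)
  have H: "(\<Sum>w\<in>W'. b w * one_param m l z w) = H z" for z
    unfolding H_def by (rule sum.cong) (use Wc in \<open>auto simp: one_param_def\<close>)
  have "(\<Sum>w\<in>W'. b w * \<gamma> w) = H 0"
    unfolding H[symmetric] \<gamma>_eq by (rule sum.cong) (use W in auto)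
  then have H0: "H 0 \<noteq> 0" using nz by simp
  have FGH: "F z = G z / H z" if "H z \<noteq> 0" for z
    unfolding F_def using bspec[OF quot op] that by (simp add: G H)
  obtain D where D: "(G has_field_derivative D) (at 0)"
    unfolding G_def using exp_sum_has_derivative by blast
  obtain E where E: "(H has_field_derivative E) (at 0)"
    unfolding H_def using exp_sum_has_derivative by blast
  have "(H \<longlongrightarrow> H 0) (at 0)" using DERIV_isCont[OF E] by (simp add: isCont_def)
  then have "eventually (\<lambda>z. H z \<noteq> 0) (at 0)" using H0 by (rule tendsto_imp_eventually_ne)
  then have "eventually (\<lambda>z. H z \<noteq> 0) (nhds 0)" using H0 by (simp add: eventually_nhds_conv_at)
  then have ev: "eventually (\<lambda>z. F z = G z / H z) (nhds 0)"
    by (rule eventually_mono) (rule FGH)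
  have "((\<lambda>z. G z / H z) has_field_derivative (D * H 0 - G 0 * E) / (H 0 * H 0)) (at 0)"
    by (rule DERIV_divide[OF D E H0])
  then have "(F has_field_derivative (D * H 0 - G 0 * E) / (H 0 * H 0)) (at 0)"
    using DERIV_cong_ev[OF refl ev refl] by simp
  then show ?thesis using exp_of_additive[of F] add F0 period unfolding F_def by blast
qed

text \<open>For a fixed cocharacter the exponent \<open>N u\<close> is additive in the character
  \<open>u\<close>, hence the pairing of \<open>u\<close> with a vector, which is the image
  cocharacter.\<close>

lemma lattice_map_exists:
  "\<exists>L. \<forall>l\<in>carrier_vec m. L l \<in> carrier_vec m' \<and> (\<forall>z. \<psi> (one_param m l z) = one_param m' (L l) z)"
proof -
  have "\<exists>v\<in>carrier_vec m'. \<forall>z. \<psi> (one_param m l z) = one_param m' v z" if l: "l \<in> carrier_vec m" for l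
  proof -
    have op: "\<psi> (one_param m l z) \<in> Y.torus_points" for z
      by (rule torus_map[OF one_param_torus[OF l]])
    obtain N :: "int vec \<Rightarrow> int"
      where N: "\<And>u z. u \<in> carrier_vec m' \<Longrightarrow> \<psi> (one_param m l z) u = exp (z * of_int (N u))"
      using character_on_one_param[OF l] by metis
    have "N (u + w) = N u + N w" if u: "u \<in> carrier_vec m'" and w: "w \<in> carrier_vec m'" for u w
    proof -
      have "exp (of_int (N (u + w)) :: complex) = exp (of_int (N u)) * exp (of_int (N w))"
        using affine_points_add[OF op, of u w 1] N[of u 1] N[of w 1] N[of "u + w" 1] u w
        by (simp add: dual_monoid_zero)
      then have "norm (exp (of_int (N (u + w)) :: complex)) = norm (exp (of_int (N u + N w) :: complex))"
        by (simp add: exp_add)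
      then have "real_of_int (N (u + w)) = real_of_int (N u) + real_of_int (N w)"
        by (simp add: norm_exp_eq_Re)
      then show ?thesis by linarith
    qed
    then obtain v where v: "v \<in> carrier_vec m'" "\<forall>u\<in>carrier_vec m'. N u = v \<bullet> u"
      using additive_functional by blast
    have "\<psi> (one_param m l z) = one_param m' v z" for z
    proof (rule extensionalityI[of _ "carrier_vec m'"])
      show "\<psi> (one_param m l z) \<in> extensional (carrier_vec m')"
        using op by (simp add: affine_points_def dual_monoid_zero)
    qed (use N v in \<open>auto simp: one_param_def\<close>)
    then show ?thesis using v by blast
  qed
  then show ?thesis by metis
qed

definition lattice_map :: "int vec \<Rightarrow> int vec" where
  "lattice_map = (SOME L. \<forall>l\<in>carrier_vec m. L l \<in> carrier_vec m' \<and>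
      (\<forall>z. \<psi> (one_param m l z) = one_param m' (L l) z))"

lemma lattice_map:
  assumes "l \<in> carrier_vec m"
  shows "lattice_map l \<in> carrier_vec m'" "\<psi> (one_param m l z) = one_param m' (lattice_map l) z"
  using someI_ex[OF lattice_map_exists] assms unfolding lattice_map_def by blast+

lemma lattice_map_add:
  assumes l: "l \<in> carrier_vec m" and k: "k \<in> carrier_vec m"
  shows "lattice_map (l + k) = lattice_map l + lattice_map k"
proof (rule one_param_inj)
  show "one_param m' (lattice_map (l + k)) z = one_param m' (lattice_map l + lattice_map k) z" for z
  proof -
    have add: "one_param n (l + k) z = (\<lambda>w\<in>carrier_vec n. one_param n l z w * one_param n k z w)"
      if "l \<in> carrier_vec n" "k \<in> carrier_vec n" for n l k
      using that
      by (auto simp: one_param_def add_scalar_prod_distrib[of _ n] distrib_left exp_add)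
    have "one_param m' (lattice_map (l + k)) z = \<psi> (one_param m (l + k) z)"
      using lattice_map(2)[of "l + k"] l k by simp
    also have "\<dots> = one_param m' (lattice_map l + lattice_map k) z"
      unfolding add[OF l k] torus_map_mult[OF one_param_torus[OF l] one_param_torus[OF k]]
        lattice_map(2)[OF l] lattice_map(2)[OF k]
      by (rule add[symmetric]) (use lattice_map l k in auto)
    finally show ?thesis .
  qed
qed (use lattice_map l k in auto)

text \<open>\<open>limit\<close> says that \<open>p\<close> is the limit of the one-parameter
  subgroup of \<open>l\<close> as z tends to minus infinity. It is required in every chart through
  \<open>p\<close>, because the chart of the local quotient cannot be prescribed. The pulled back
  monomial stays finite near \<open>p\<close>, so its exponent along the subgroup is not
  negative.\<close>

lemma lattice_map_nonneg:
  assumes l: "l \<in> carrier_vec m" and \<sigma>: "\<sigma> \<in> \<Sigma>'" and u: "u \<in> dual_monoid m' \<sigma>"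
    and p: "p \<in> toric_points m \<Sigma>" "\<phi> p \<in> chart m' \<Sigma>' \<sigma> ` affine_points m' \<sigma>"
    and limit: "\<And>\<tau> \<gamma> w. \<tau> \<in> \<Sigma> \<Longrightarrow> \<gamma> \<in> affine_points m \<tau> \<Longrightarrow> p = chart m \<Sigma> \<tau> \<gamma> \<Longrightarrow> w \<in> dual_monoid m \<tau> \<Longrightarrow>
      0 \<le> l \<bullet> w \<and> \<gamma> w = (if l \<bullet> w = 0 then 1 else 0)"
  shows "0 \<le> lattice_map l \<bullet> u"
proof -
  obtain \<tau> \<gamma> W W' b a where \<tau>: "\<tau> \<in> \<Sigma>" and \<gamma>: "\<gamma> \<in> affine_points m \<tau>" "p = chart m \<Sigma> \<tau> \<gamma>"
    and W: "W \<subseteq> dual_monoid m \<tau>" "W' \<subseteq> dual_monoid m \<tau>" and nz: "(\<Sum>w\<in>W'. b w * \<gamma> w) \<noteq> 0"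
    and quot: "\<forall>t\<in>X.torus_points. (\<Sum>w\<in>W'. b w * t w) \<noteq> 0 \<longrightarrow>
      \<psi> t u = (\<Sum>w\<in>W. a w * t w) / (\<Sum>w\<in>W'. b w * t w)"
    by (rule pullback_monomial[OF \<sigma> u p])
  have lim: "0 \<le> l \<bullet> w \<and> \<gamma> w = (if l \<bullet> w = 0 then 1 else 0)" if "w \<in> dual_monoid m \<tau>" for w
    using limit[OF \<tau> \<gamma> that] .
  have Wc: "W \<subseteq> carrier_vec m" "W' \<subseteq> carrier_vec m" "u \<in> carrier_vec m'"
    using W u dual_monoid_carrier[of m \<tau>] dual_monoid_carrier[of m' \<sigma>] by auto
  have G: "(\<Sum>w\<in>W. a w * one_param m l z w) = (\<Sum>w\<in>W. a w * exp (z * of_int (l \<bullet> w)))" for z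
    by (rule sum.cong) (use Wc in \<open>auto simp: one_param_def\<close>)
  have H: "(\<Sum>w\<in>W'. b w * one_param m l z w) = (\<Sum>w\<in>W'. b w * exp (z * of_int (l \<bullet> w)))" for z
    by (rule sum.cong) (use Wc in \<open>auto simp: one_param_def\<close>)
  show ?thesis
  proof (rule exp_quotient_nonneg)
    show "0 \<le> l \<bullet> w" if "w \<in> W \<union> W'" for w using lim W that by auto
    have "(\<Sum>w\<in>W'. b w * \<gamma> w) = (\<Sum>w\<in>W'. b w * (if l \<bullet> w = 0 then 1 else 0))"
      by (rule sum.cong) (use lim W in auto)
    then show "(\<Sum>w\<in>W'. b w * (if l \<bullet> w = 0 then 1 else 0)) \<noteq> 0" using nz by simp
    fix z :: complex
    assume "(\<Sum>w\<in>W'. b w * exp (z * of_int (l \<bullet> w))) \<noteq> 0"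
    then have "\<psi> (one_param m l z) u = (\<Sum>w\<in>W. a w * exp (z * of_int (l \<bullet> w))) /
        (\<Sum>w\<in>W'. b w * exp (z * of_int (l \<bullet> w)))"
      using bspec[OF quot one_param_torus[OF l]] by (simp add: G H)
    then show "exp (z * of_int (lattice_map l \<bullet> u)) = (\<Sum>w\<in>W. a w * exp (z * of_int (l \<bullet> w))) /
        (\<Sum>w\<in>W'. b w * exp (z * of_int (l \<bullet> w)))"
      using lattice_map(2)[OF l, of z] Wc by (simp add: one_param_def)
  qed
qed

end

section \<open>Torus-fixed points and the images of maximal cones\<close>

context bott begin

lemma cone_empty: "cone s {} = {0\<^sub>v m}"
proof (intro equalityI subsetI)
  fix v assume "v \<in> cone s {}"
  then obtain a where "v = comb s a" "\<forall>k<m. a k = 0" unfolding cone_def by auto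
  then have "v = comb s (\<lambda>_. 0)" by (simp add: comb_cong[of a "\<lambda>_. 0" s s])
  then show "v \<in> {0\<^sub>v m}" by simp
next
  fix v assume "v \<in> {0\<^sub>v m :: real vec}"
  then have "v = comb s (\<lambda>_. 0)" by simp
  then show "v \<in> cone s {}" unfolding cone_def by fastforce
qed

lemma zero_in_cone: "0\<^sub>v m \<in> cone s I"
proof -
  have "comb s (\<lambda>_. 0) \<in> cone s I" unfolding cone_def by fastforce
  then show ?thesis by simp
qed

lemma cone_in_fan: "I \<subseteq> {..<m} \<Longrightarrow> cone s I \<in> bott_fan B"
  unfolding bott_fan_eq by blast

lemma bott_smooth_fan: "smooth_fan m (bott_fan B)"
proof
  fix \<sigma> assume "\<sigma> \<in> bott_fan B"
  then obtain s I where \<sigma>: "\<sigma> = cone s I" and I: "I \<subseteq> {..<m}" unfolding bott_fan_eq by blast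
  show "\<sigma> \<subseteq> carrier_vec m" unfolding \<sigma> cone_def by auto
  show "0\<^sub>v m \<in> \<sigma>" unfolding \<sigma> by (rule zero_in_cone)
  fix w :: "int vec" assume w: "w \<in> carrier_vec m"
  \<comment> \<open>The pairings of \<open>b\<close> with the rays dominate those of
    \<open>w\<close>, so both \<open>b\<close> and \<open>w + b\<close> are non-negative on the
    cone.\<close>
  obtain b where b: "b \<in> carrier_vec m" "\<forall>k<m. b \<bullet> ray k (s k) = \<bar>w \<bullet> ray k (s k)\<bar>"
    using dual_exists[of s "\<lambda>k. \<bar>w \<bullet> ray k (s k)\<bar>"] by blast
  have "b \<in> dual_monoid m \<sigma>" "w + b \<in> dual_monoid m \<sigma>"
    unfolding \<sigma> dual_monoid_cone[OF I] using w b I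
    by (auto simp: add_scalar_prod_distrib[OF w b(1) ray_carrier])
  then show "\<exists>b\<in>dual_monoid m \<sigma>. w + b \<in> dual_monoid m \<sigma>" by blast
next
  show "{0\<^sub>v m} \<in> bott_fan B" using cone_in_fan[of "{}"] by (simp add: cone_empty)
qed

lemma dual_separates:
  assumes w: "w \<in> carrier_vec m" and zero: "\<And>k. k < m \<Longrightarrow> w \<bullet> ray k (s k) = 0"
  shows "w = 0\<^sub>v m"
proof (rule eq_vecI)
  fix i assume "i < dim_vec (0\<^sub>v m :: int vec)"
  then have i: "i < m" by simp
  obtain a :: "nat \<Rightarrow> int" where a: "unit_vec m i = comb s a"
    using comb_exists[of "unit_vec m i"] by auto
  have "w $ i = w \<bullet> unit_vec m i" using w i by simp
  also have "\<dots> = 0" unfolding a scalar_prod_comb_int[OF w] by (simp add: zero)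
  finally show "w $ i = 0\<^sub>v m $ i" using i by simp
qed (use w in simp)

text \<open>The torus-fixed point of a maximal cone.\<close>

definition vertex :: "(nat \<Rightarrow> bool) \<Rightarrow> int vec \<Rightarrow> complex" where
  "vertex s = (\<lambda>w\<in>dual_monoid m (cone s {..<m}). if w = 0\<^sub>v m then 1 else 0)"

text \<open>Two elements of the dual monoid of a maximal cone add up to 0 only if both are 0,
  because their pairings with the rays are non-negative. This makes \<open>vertex s\<close>
  multiplicative.\<close>

lemma vertex_affine: "vertex s \<in> affine_points m (cone s {..<m})"
proof -
  let ?D = "dual_monoid m (cone s {..<m})"
  have D: "?D = {w \<in> carrier_vec m. \<forall>k\<in>{..<m}. 0 \<le> w \<bullet> ray k (s k)}"
    by (rule dual_monoid_cone) simp
  have sub: "cone s {..<m} \<subseteq> carrier_vec m" unfolding cone_def by auto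
  have zero: "0\<^sub>v m \<in> ?D" by (rule dual_monoid_0_mem[OF sub])
  have "vertex s (u + w) = vertex s u * vertex s w" if u: "u \<in> ?D" and w: "w \<in> ?D" for u w
  proof -
    have c: "u \<in> carrier_vec m" "w \<in> carrier_vec m" using u w D by auto
    have "u = 0\<^sub>v m \<and> w = 0\<^sub>v m" if "u + w = 0\<^sub>v m"
    proof -
      have "u \<bullet> ray k (s k) = 0 \<and> w \<bullet> ray k (s k) = 0" if "k < m" for k
      proof -
        have "u \<bullet> ray k (s k) + w \<bullet> ray k (s k) = 0"
          using add_scalar_prod_distrib[OF c ray_carrier, of k "s k"] \<open>u + w = 0\<^sub>v m\<close> by simp
        moreover have "0 \<le> u \<bullet> ray k (s k)" "0 \<le> w \<bullet> ray k (s k)" using u w D that by auto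
        ultimately show ?thesis by linarith
      qed
      then show ?thesis using dual_separates c by blast
    qed
    moreover have "u + w \<in> ?D" by (rule dual_monoid_add[OF sub u w])
    ultimately show ?thesis using u w c by (auto simp: vertex_def)
  qed
  then show ?thesis using zero by (simp add: affine_points_def vertex_def)
qed

text \<open>The fixed point takes the value 0 at each dual basis vector, so no such vector is
  invertible in the dual monoid of the intersection. Hence for every ray the intersection contains a
  point with positive coefficient there, and the ray belongs to \<tau>.\<close>

lemma vertex_chart_subset:
  assumes \<tau>: "\<tau> \<in> bott_fan B"
    and \<delta>: "\<delta> \<in> affine_points m (cone s {..<m} \<inter> \<tau>)"
    and vertex: "vertex s = restrict \<delta> (dual_monoid m (cone s {..<m}))"
  shows "cone s {..<m} \<subseteq> \<tau>"
proof -
  let ?\<sigma> = "cone s {..<m}"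
  obtain t J where t: "\<tau> = cone t J" and J: "J \<subseteq> {..<m}" using \<tau> unfolding bott_fan_eq by blast
  have mem: "k \<in> J \<and> s k = t k" if k: "k < m" for k
  proof -
    obtain u where u: "u \<in> carrier_vec m" "\<forall>l<m. u \<bullet> ray l (s l) = (if l = k then 1 else 0)"
      using dual_exists[of s "\<lambda>l. if l = k then 1 else 0"] by blast
    have ud: "u \<in> dual_monoid m ?\<sigma>" by (subst dual_monoid_cone) (use u in auto)
    have "u \<noteq> 0\<^sub>v m" using u(2) k by auto
    then have "\<delta> u = 0" using fun_cong[OF vertex, of u] ud by (simp add: vertex_def)
    have ud': "u \<in> dual_monoid m (?\<sigma> \<inter> \<tau>)" using ud dual_monoid_antimono[of "?\<sigma> \<inter> \<tau>" ?\<sigma> m] by auto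
    have "- u \<notin> dual_monoid m (?\<sigma> \<inter> \<tau>)"
    proof
      assume "- u \<in> dual_monoid m (?\<sigma> \<inter> \<tau>)"
      then have "\<delta> (u + - u) = \<delta> u * \<delta> (- u)" by (rule affine_points_add[OF \<delta> ud'])
      moreover have "u + - u = 0\<^sub>v m" using u(1) by auto
      ultimately show False using affine_points_zero[OF \<delta>] \<open>\<delta> u = 0\<close> by simp
    qed
    then obtain x where x: "x \<in> ?\<sigma>" "x \<in> \<tau>" "\<not> 0 \<le> map_vec of_int (- u) \<bullet> x"
      using u(1) by (auto simp: dual_monoid_def)
    obtain a where a: "x = comb s a" "\<forall>k<m. 0 \<le> a k" using x(1) unfolding cone_def by blast
    obtain b where b: "x = comb t b" "\<forall>k<m. 0 \<le> b k" "\<forall>k<m. k \<notin> J \<longrightarrow> b k = 0"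
      using x(2) unfolding t cone_def by blast
    have uc: "- u \<in> carrier_vec m" using u(1) by simp
    have "map_vec of_int (- u) \<bullet> x = (\<Sum>l<m. a l * of_int (- u \<bullet> ray l (s l)))"
      unfolding a(1) by (rule scalar_prod_comb[OF uc])
    also have "\<dots> = (\<Sum>l<m. if l = k then - a k else 0)"
      by (rule sum.cong) (use u in \<open>auto simp: scalar_prod_uminus_left\<close>)
    finally have "0 < a k" using x(3) k by simp
    moreover have "a k = b k \<and> (a k \<noteq> 0 \<longrightarrow> s k = t k)"
      by (rule comb_unique[OF _ k]) (use a b in auto)
    ultimately show ?thesis using b(3) k by auto
  qed
  show ?thesis
  proof
    fix x assume "x \<in> ?\<sigma>"
    then obtain a where a: "x = comb s a" "\<forall>k<m. 0 \<le> a k" unfolding cone_def by blast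
    have "x = comb t a" unfolding a(1) by (rule comb_cong) (use mem in auto)
    then show "x \<in> \<tau>" unfolding t cone_def using a(2) mem by auto
  qed
qed

text \<open>The monomials of a chart through the fixed point are monomials of the maximal cone as
  well. An interior cocharacter pairs positively with all of these but 0, in accordance with the
  values of \<open>vertex s\<close>.\<close>

lemma vertex_limit:
  assumes a: "\<forall>k<m. 0 < a k"
    and \<tau>: "\<tau> \<in> bott_fan B" and \<gamma>: "\<gamma> \<in> affine_points m \<tau>"
    and eq: "chart m (bott_fan B) (cone s {..<m}) (vertex s) = chart m (bott_fan B) \<tau> \<gamma>"
    and w: "w \<in> dual_monoid m \<tau>"
  shows "0 \<le> comb s a \<bullet> w \<and> \<gamma> w = (if comb s a \<bullet> w = 0 then 1 else 0)"
proof -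
  let ?\<sigma> = "cone s {..<m}"
  have "(\<tau>, \<gamma>) \<in> chart m (bott_fan B) ?\<sigma> (vertex s)"
    unfolding eq by (rule self_mem_chart[OF \<tau> \<gamma>])
  then obtain \<delta> where \<delta>: "\<delta> \<in> affine_points m (?\<sigma> \<inter> \<tau>)"
    "vertex s = restrict \<delta> (dual_monoid m ?\<sigma>)" "\<gamma> = restrict \<delta> (dual_monoid m \<tau>)"
    unfolding mem_chart_iff by blast
  have wd: "w \<in> dual_monoid m ?\<sigma>"
    using vertex_chart_subset[OF \<tau> \<delta>(1,2)] w dual_monoid_antimono by blast
  have "\<gamma> w = vertex s w" using w wd \<delta>(2,3) by simp
  then have \<gamma>w: "\<gamma> w = (if w = 0\<^sub>v m then 1 else 0)" using wd by (simp add: vertex_def)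
  have wc: "w \<in> carrier_vec m" and wn: "\<forall>k<m. 0 \<le> w \<bullet> ray k (s k)"
    using wd by (auto simp: dual_monoid_cone)
  have dot: "comb s a \<bullet> w = (\<Sum>k<m. a k * (w \<bullet> ray k (s k)))"
    unfolding comm_scalar_prod[OF comb_carrier wc] by (rule scalar_prod_comb_int[OF wc])
  have nonneg: "0 \<le> a k * (w \<bullet> ray k (s k))" if "k \<in> {..<m}" for k
    using a wn that by (simp add: order_less_imp_le)
  have "comb s a \<bullet> w = 0 \<longleftrightarrow> w = 0\<^sub>v m"
  proof
    assume "comb s a \<bullet> w = 0"
    then have "\<forall>k\<in>{..<m}. a k * (w \<bullet> ray k (s k)) = 0"
      unfolding dot by (subst (asm) sum_nonneg_eq_0_iff) (use nonneg in auto)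
    then have "w \<bullet> ray k (s k) = 0" if "k < m" for k using a that by force
    then show "w = 0\<^sub>v m" by (rule dual_separates[OF wc])
  qed simp
  moreover have "0 \<le> comb s a \<bullet> w" unfolding dot by (rule sum_nonneg[OF nonneg])
  ultimately show ?thesis using \<gamma>w by simp
qed

end

text \<open>The image of the fixed point lies in the chart of some cone of the target, and the
  monomials of that chart have non-negative exponents along the images of interior cocharacters. Any
  maximal cone with that cone as a face can serve as \<open>s'\<close>.\<close>

lemma lattice_map_cone:
  assumes X: "bott m B" and Y: "bott m B'"
    and tm: "toric_map m (bott_fan B) m (bott_fan B') \<phi> \<psi>"
  shows "\<exists>s'. toric_map.lattice_map m m \<psi> ` bott.lattice_cone m B s \<subseteq> bott.lattice_cone m B' s'"
proof -
  interpret X: bott m B by fact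
  interpret Y: bott m B' by fact
  interpret T: toric_map m "bott_fan B" m "bott_fan B'" \<phi> \<psi> by fact
  define p where "p = chart m (bott_fan B) (X.cone s {..<m}) (X.vertex s)"
  have p: "p \<in> toric_points m (bott_fan B)"
    unfolding p_def toric_points_eq using X.vertex_affine X.cone_in_fan by blast
  then have "\<phi> p \<in> toric_points m (bott_fan B')"
    using T.morphism by (auto simp: variety_morphism_def toric_variety_def)
  then obtain \<sigma> \<gamma> where \<sigma>: "\<sigma> \<in> bott_fan B'" and \<gamma>: "\<gamma> \<in> affine_points m \<sigma>" "\<phi> p = chart m (bott_fan B') \<sigma> \<gamma>"
    unfolding toric_points_eq by blast
  obtain s' I where s': "\<sigma> = Y.cone s' I" and I: "I \<subseteq> {..<m}" using \<sigma> unfolding Y.bott_fan_eq by blast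
  have \<phi>p: "\<phi> p \<in> chart m (bott_fan B') \<sigma> ` affine_points m \<sigma>" using \<gamma> by blast
  have "T.lattice_map x \<in> Y.lattice_cone s'" if x: "x \<in> X.lattice_cone s" for x
  proof (rule Y.in_lattice_coneI)
    obtain a where a: "x = X.comb s a" "\<forall>k<m. 0 \<le> (a k :: int)"
      using x unfolding X.lattice_cone_def by blast
    have xc: "x \<in> carrier_vec m" using a(1) by simp
    show "T.lattice_map x \<in> carrier_vec m" by (rule T.lattice_map(1)[OF xc])
    fix u assume u: "u \<in> dual_monoid m (Y.cone s' {..<m})"
    then have uc: "u \<in> carrier_vec m" and ud: "u \<in> dual_monoid m \<sigma>"
      unfolding s' Y.dual_monoid_cone[OF I] using I by (auto simp: Y.dual_monoid_cone)
    have pos: "0 \<le> T.lattice_map (X.comb s b) \<bullet> u" if "\<forall>k<m. 0 < (b k :: int)" for b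
      by (rule T.lattice_map_nonneg[OF X.comb_carrier \<sigma> ud p \<phi>p])
        (rule X.vertex_limit[OF that], (assumption | simp add: p_def)+)
    have "\<exists>v\<in>carrier_vec m. \<forall>z\<in>carrier_vec m. T.lattice_map z \<bullet> u = v \<bullet> z"
      by (rule additive_functional)
        (use uc T.lattice_map(1) in \<open>simp add: T.lattice_map_add add_scalar_prod_distrib[of _ m]\<close>)
    then obtain v where v: "v \<in> carrier_vec m" "\<And>z. z \<in> carrier_vec m \<Longrightarrow> T.lattice_map z \<bullet> u = v \<bullet> z"
      by blast
    \<comment> \<open>\<open>x\<close> may lie on the boundary, so move a large multiple of it into the interior.\<close>
    have large: "0 \<le> int j * (v \<bullet> x) + (\<Sum>k<m. v \<bullet> X.ray k (s k))" for j
    proof -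
      have "0 \<le> v \<bullet> X.comb s (\<lambda>k. int j * a k + 1)"
        unfolding v(2)[OF X.comb_carrier, symmetric]
        by (rule pos) (use a(2) in \<open>simp add: add_nonneg_pos\<close>)
      then show ?thesis
        unfolding a(1) X.scalar_prod_comb_int[OF v(1)]
        by (simp add: distrib_right sum.distrib sum_distrib_left mult.assoc)
    qed
    have "0 \<le> v \<bullet> x"
    proof (rule ccontr)
      let ?c = "\<Sum>k<m. v \<bullet> X.ray k (s k)"
      assume "\<not> 0 \<le> v \<bullet> x"
      \<comment> \<open>The integer \<open>v \<bullet> x\<close> is at most -1, so a multiple
        exceeding the absolute value of \<open>?c\<close> contradicts \<open>large\<close>.\<close>
      then have "int (nat (\<bar>?c\<bar> + 1)) * (v \<bullet> x) \<le> int (nat (\<bar>?c\<bar> + 1)) * -1" by (intro mult_left_mono) auto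
      then show False using large[of "nat (\<bar>?c\<bar> + 1)"] by simp
    qed
    then have "0 \<le> T.lattice_map x \<bullet> u" using v(2)[OF xc] by simp
    then show "0 \<le> u \<bullet> T.lattice_map x"
      using comm_scalar_prod[OF uc T.lattice_map(1)[OF xc]] by simp
  qed
  then show ?thesis by blast
qed

section \<open>Lattice isomorphisms of Bott fans\<close>

text \<open>The conditions on cones are inclusions because that is what the limit argument
  provides.\<close>

locale lattice_iso = X: bott m B + Y: bott m B' for m B B' +
  fixes L L' :: "int vec \<Rightarrow> int vec"
  assumes L_carrier: "x \<in> carrier_vec m \<Longrightarrow> L x \<in> carrier_vec m"
    and L'_carrier: "x \<in> carrier_vec m \<Longrightarrow> L' x \<in> carrier_vec m"
    and L_add: "x \<in> carrier_vec m \<Longrightarrow> y \<in> carrier_vec m \<Longrightarrow> L (x + y) = L x + L y"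
    and L'_add: "x \<in> carrier_vec m \<Longrightarrow> y \<in> carrier_vec m \<Longrightarrow> L' (x + y) = L' x + L' y"
    and L'_L: "x \<in> carrier_vec m \<Longrightarrow> L' (L x) = x"
    and L_L': "x \<in> carrier_vec m \<Longrightarrow> L (L' x) = x"
    and L_cone: "\<exists>s'. L ` X.lattice_cone s \<subseteq> Y.lattice_cone s'"
    and L'_cone: "\<exists>s. L' ` Y.lattice_cone s' \<subseteq> X.lattice_cone s"
begin

lemma swap: "lattice_iso m B' B L' L"
  by unfold_locales (use L_carrier L'_carrier L_add L'_add L'_L L_L' L_cone L'_cone in auto)

text \<open>The composite of \<open>L\<close> and \<open>L'\<close> fixes every ray of
  \<open>s\<close> and maps it into the cone of \<open>s''\<close>. A ray determines its flag, so
  \<open>s''\<close> agrees with \<open>s\<close> on all indices and the inclusions are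
  equalities.\<close>

lemma cone_image: "\<exists>s'. L ` X.lattice_cone s = Y.lattice_cone s'"
proof -
  obtain s' where s': "L ` X.lattice_cone s \<subseteq> Y.lattice_cone s'" using L_cone by blast
  obtain s'' where s'': "L' ` Y.lattice_cone s' \<subseteq> X.lattice_cone s''" using L'_cone by blast
  have "s'' k = s k" if k: "k < m" for k
  proof -
    have r: "X.ray k (s k) \<in> X.lattice_cone s" by (rule X.ray_in_lattice_cone[OF k])
    have "L' (L (X.ray k (s k))) \<in> X.lattice_cone s''" using r s' s'' by blast
    then have "X.ray k (s k) \<in> X.lattice_cone s''" by (simp add: L'_L)
    then obtain a :: "nat \<Rightarrow> int" where a: "X.ray k (s k) = X.comb s'' a" "\<forall>k<m. 0 \<le> a k"
      unfolding X.lattice_cone_def by blast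
    have "X.comb s (\<lambda>l. if l = k then 1 else 0) = X.comb s'' a"
      using X.comb_single[OF k, of s] a(1) by metis
    from X.comb_unique[OF this k] show ?thesis using a(2) by auto
  qed
  then have "X.comb s'' a = X.comb s a" for a :: "nat \<Rightarrow> int" by (intro X.comb_cong) auto
  then have eq: "X.lattice_cone s'' = X.lattice_cone s" by (simp add: X.lattice_cone_def)
  have "y \<in> L ` X.lattice_cone s" if y: "y \<in> Y.lattice_cone s'" for y
  proof -
    have "L' y \<in> X.lattice_cone s" using y s'' eq by blast
    moreover have "L (L' y) = y" by (rule L_L'[OF subsetD[OF Y.lattice_cone_carrier y]])
    ultimately show ?thesis using imageI[of "L' y" _ L] by simp
  qed
  then show ?thesis using s' by blast
qed

lemma L'_zero: "L' (0\<^sub>v m) = 0\<^sub>v m"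
proof (rule eq_vecI)
  have c: "L' (0\<^sub>v m) \<in> carrier_vec m" by (simp add: L'_carrier)
  then show "dim_vec (L' (0\<^sub>v m)) = dim_vec (0\<^sub>v m)" by simp
  fix i assume "i < dim_vec (0\<^sub>v m :: int vec)"
  moreover have "L' (0\<^sub>v m) = L' (0\<^sub>v m) + L' (0\<^sub>v m)" using L'_add[of "0\<^sub>v m" "0\<^sub>v m"] by simp
  then have "L' (0\<^sub>v m) $ i = (L' (0\<^sub>v m) + L' (0\<^sub>v m)) $ i" by simp
  ultimately show "L' (0\<^sub>v m) $ i = 0\<^sub>v m $ i" using c by simp
qed

text \<open>Additive bijections between the two monoids of lattice points preserve indecomposable
  elements.\<close>

lemma ray_image:
  assumes img: "L ` X.lattice_cone s = Y.lattice_cone s'" and k: "k < m"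
  shows "\<exists>k'<m. L (X.ray k (s k)) = Y.ray k' (s' k')"
proof -
  let ?x = "X.ray k (s k)"
  have x: "?x \<in> X.lattice_cone s" by (rule X.ray_in_lattice_cone[OF k])
  have Lx: "L ?x \<in> Y.lattice_cone s'" using img x by blast
  have irr: "?x \<noteq> 0\<^sub>v m"
    "\<And>y z. y \<in> X.lattice_cone s \<Longrightarrow> z \<in> X.lattice_cone s \<Longrightarrow> ?x = y + z \<Longrightarrow> y = 0\<^sub>v m \<or> z = 0\<^sub>v m"
    using X.irreducible_iff[OF x] k by blast+
  have preimage: "L' y \<in> X.lattice_cone s" "y \<in> carrier_vec m" if y: "y \<in> Y.lattice_cone s'" for y
  proof -
    obtain z where z: "z \<in> X.lattice_cone s" "y = L z" using y img by blast
    then have "L' y = z" using L'_L subsetD[OF X.lattice_cone_carrier z(1)] by simp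
    then show "L' y \<in> X.lattice_cone s" using z(1) by simp
    show "y \<in> carrier_vec m" by (rule subsetD[OF Y.lattice_cone_carrier y])
  qed
  have zero: "y = 0\<^sub>v m" if "L' y = 0\<^sub>v m" "y \<in> carrier_vec m" for y
    using L_L'[OF that(2)] L_L'[of "0\<^sub>v m"] L'_zero that(1) by simp
  have "L ?x \<noteq> 0\<^sub>v m" using irr(1) L'_zero L'_L[of ?x] by auto
  moreover have "y = 0\<^sub>v m \<or> z = 0\<^sub>v m"
    if y: "y \<in> Y.lattice_cone s'" and z: "z \<in> Y.lattice_cone s'" and e: "L ?x = y + z" for y z
  proof -
    have "?x = L' y + L' z"
      using L'_add[OF preimage(2)[OF y] preimage(2)[OF z]] e L'_L[of ?x] by simp
    then have "L' y = 0\<^sub>v m \<or> L' z = 0\<^sub>v m" using irr(2) preimage(1) y z by blast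
    then show ?thesis using zero preimage(2) y z by blast
  qed
  ultimately have "L ?x \<in> (\<lambda>k. Y.ray k (s' k)) ` {..<m}" using Y.irreducible_iff[OF Lx] by blast
  then show ?thesis by blast
qed

text \<open>Two rays from different pairs lie in a common maximal cone, so their images do too; and
  a maximal cone never contains a complete pair.\<close>

lemma same_cone_back:
  assumes "k < m" "l < m" "k \<noteq> l \<or> b = c"
  obtains s where "\<exists>k'<m. L' (Y.ray k b) = X.ray k' (s k')" "\<exists>l'<m. L' (Y.ray l c) = X.ray l' (s l')"
proof -
  interpret S: lattice_iso m B' B L' L by (rule swap)
  define s' where "s' = (\<lambda>_. c)(k := b)"
  obtain s where s: "L' ` Y.lattice_cone s' = X.lattice_cone s" using S.cone_image by blast
  have "s' k = b" "s' l = c" using assms(3) by (auto simp: s'_def)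
  then show ?thesis using that S.ray_image[OF s assms(1)] S.ray_image[OF s assms(2)] by simp
qed

text \<open>Rays of different pairs share a maximal cone and the two rays of one pair do not, so
  pairs go to pairs. \<open>S k\<close> records whether pair \<open>k\<close> is exchanged.\<close>

lemma ray_permutation:
  obtains \<pi> S where "bij_betw \<pi> {..<m} {..<m}"
    "\<forall>k<m. \<forall>b. L' (Y.ray (\<pi> k) b) = X.ray k (b \<noteq> S k)"
proof -
  have "\<exists>k' b'. k' < m \<and> L (X.ray k b) = Y.ray k' b'" if k: "k < m" for k b
  proof -
    obtain s' where "L ` X.lattice_cone (\<lambda>_. b) = Y.lattice_cone s'" using cone_image by blast
    from ray_image[OF this k] show ?thesis by blast
  qed
  then obtain \<kappa> \<beta> where \<kappa>: "\<And>k b. k < m \<Longrightarrow> \<kappa> k b < m"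
    and L_ray: "\<And>k b. k < m \<Longrightarrow> L (X.ray k b) = Y.ray (\<kappa> k b) (\<beta> k b)"
    by metis
  have L'_ray: "L' (Y.ray (\<kappa> k b) (\<beta> k b)) = X.ray k b" if "k < m" for k b
    using L_ray[OF that, of b] L'_L[of "X.ray k b"] by simp
  have pair: "\<kappa> k True = \<kappa> k False" if k: "k < m" for k
  proof (rule ccontr)
    assume "\<kappa> k True \<noteq> \<kappa> k False"
    then obtain s where s: "\<exists>k'<m. L' (Y.ray (\<kappa> k True) (\<beta> k True)) = X.ray k' (s k')"
      "\<exists>l'<m. L' (Y.ray (\<kappa> k False) (\<beta> k False)) = X.ray l' (s l')"
      using same_cone_back[OF \<kappa>[OF k, of True] \<kappa>[OF k, of False]] by metis
    then have "s k = True" "s k = False"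
      unfolding L'_ray[OF k] using X.ray_inj[OF k] by blast+
    then show False by simp
  qed
  define \<pi> where "\<pi> k = \<kappa> k False" for k
  have \<beta>: "\<beta> k b = (b \<noteq> \<beta> k False)" if k: "k < m" for k b
  proof -
    have "\<beta> k True \<noteq> \<beta> k False"
    proof
      assume "\<beta> k True = \<beta> k False"
      then have "X.ray k True = X.ray k False" using L'_ray[OF k, of True] L'_ray[OF k, of False] pair[OF k] by simp
      then show False using X.ray_inj[OF k k] by blast
    qed
    then show ?thesis by (cases b) auto
  qed
  have "inj_on \<pi> {..<m}"
  proof (rule inj_onI)
    fix k l assume "k \<in> {..<m}" "l \<in> {..<m}" and eq: "\<pi> k = \<pi> l"
    then have kl: "k < m" "l < m" by auto
    obtain b where "\<beta> l b = \<beta> k False" using \<beta>[OF kl(2), of True] \<beta>[OF kl(2), of False] by (cases "\<beta> k False = \<beta> l False") auto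
    moreover have "\<kappa> l b = \<kappa> k False" using eq pair[OF kl(2)] by (cases b) (auto simp: \<pi>_def)
    ultimately have "X.ray k False = X.ray l b" using L'_ray[OF kl(1), of False] L'_ray[OF kl(2), of b] by simp
    then show "k = l" using X.ray_inj[OF kl] by blast
  qed
  moreover have "\<pi> ` {..<m} \<subseteq> {..<m}" using \<kappa> by (auto simp: \<pi>_def)
  ultimately have bij: "bij_betw \<pi> {..<m} {..<m}"
    by (simp add: bij_betw_def endo_inj_surj)
  have "L' (Y.ray (\<pi> k) b) = X.ray k (b \<noteq> \<beta> k False)" if k: "k < m" for k b
  proof -
    have "\<kappa> k (b \<noteq> \<beta> k False) = \<pi> k" using pair[OF k] unfolding \<pi>_def by (cases "b \<noteq> \<beta> k False") simp_all
    moreover have "\<beta> k (b \<noteq> \<beta> k False) = b" using \<beta>[OF k, of "b \<noteq> \<beta> k False"] by blast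
    ultimately show ?thesis using L'_ray[OF k, of "b \<noteq> \<beta> k False"] by simp
  qed
  then have "\<forall>k<m. \<forall>b. L' (Y.ray (\<pi> k) b) = X.ray k (b \<noteq> \<beta> k False)" by simp
  then show ?thesis by (rule that[OF bij])
qed

text \<open>The primitive relations \<open>ray k False + ray k True\<close> correspond under the isomorphism. If some
  pair \<open>p\<close> is flipped, comparing coefficients at \<open>p\<close> shows that row \<open>p\<close> of one matrix is the negative
  of a row of the other one off the diagonal, so by the sign condition both vanish there.\<close>

lemma permuted_entries:
  assumes signs: "\<And>i j k l. i < m \<Longrightarrow> j < m \<Longrightarrow> i \<noteq> j \<Longrightarrow> k < m \<Longrightarrow> l < m \<Longrightarrow> k \<noteq> l \<Longrightarrow>
      B $$ (i, j) = - B' $$ (k, l) \<Longrightarrow> B $$ (i, j) = 0"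
  shows "\<exists>\<pi>. bij_betw \<pi> {..<m} {..<m} \<and> (\<forall>j<m. \<forall>k<m. B $$ (j, k) = B' $$ (\<pi> j, \<pi> k))"
proof -
  obtain \<pi> S where \<pi>: "bij_betw \<pi> {..<m} {..<m}"
    and "\<forall>k<m. \<forall>b. L' (Y.ray (\<pi> k) b) = X.ray k (b \<noteq> S k)"
    by (rule ray_permutation)
  then have L'_ray: "L' (Y.ray (\<pi> k) b) = X.ray k (b \<noteq> S k)" if "k < m" for k b
    using that by blast
  have \<pi>_lt: "\<pi> k < m" if "k < m" for k using \<pi> that by (auto simp: bij_betw_def)
  have \<pi>_inj: "\<pi> k = \<pi> l \<longleftrightarrow> k = l" if "k < m" "l < m" for k l
    using \<pi> that by (auto simp: bij_betw_def inj_on_def)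
  \<comment> \<open>The columns of \<open>N\<close> are the right-hand sides of the primitive
    relations: in the sum of a pair, the diagonal entry -1 cancels against the unit vector.\<close>
  define N where "N j k = (X.ray k False + X.ray k True) $ j" for j k
  define N' where "N' j k = (Y.ray k False + Y.ray k True) $ j" for j k
  have N: "N j k = (if j = k then 0 else B $$ (j, k))" if "j < m" "k < m" for j k
    using that X.diag by (simp add: N_def X.ray_def)
  have N': "N' j k = (if j = k then 0 else B' $$ (j, k))" if "j < m" "k < m" for j k
    using that Y.diag by (simp add: N'_def Y.ray_def)
  have rel: "X.ray k False + X.ray k True = X.comb S (\<lambda>p. N' (\<pi> p) (\<pi> k))" if k: "k < m" for k
  proof -
    define w where "w = Y.ray (\<pi> k) False + Y.ray (\<pi> k) True"
    \<comment> \<open>The rays with flag \<open>False\<close> are unit vectors, so the coordinates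
      of \<open>w\<close> are its coefficients.\<close>
    have w: "w = vec m (\<lambda>j. \<Sum>p<m. N' (\<pi> p) (\<pi> k) * Y.ray (\<pi> p) False $ j)"
    proof (rule eq_vecI)
      fix j assume "j < dim_vec (vec m (\<lambda>j. \<Sum>p<m. N' (\<pi> p) (\<pi> k) * Y.ray (\<pi> p) False $ j))"
      then have j: "j < m" by simp
      have "(\<Sum>p<m. N' (\<pi> p) (\<pi> k) * Y.ray (\<pi> p) False $ j) = (\<Sum>q<m. N' q (\<pi> k) * Y.ray q False $ j)"
        by (rule sum.reindex_bij_betw[OF \<pi>])
      also have "\<dots> = (\<Sum>q<m. if q = j then N' j (\<pi> k) else 0)"
        by (rule sum.cong) (use j in \<open>auto simp: Y.ray_def\<close>)
      also have "\<dots> = w $ j" using j by (simp add: N'_def w_def)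
      finally show "w $ j = vec m (\<lambda>j. \<Sum>p<m. N' (\<pi> p) (\<pi> k) * Y.ray (\<pi> p) False $ j) $ j"
        using j by simp
    qed (simp add: w_def)
    have "L' w = X.ray k (False \<noteq> S k) + X.ray k (True \<noteq> S k)"
      unfolding w_def by (subst L'_add) (simp_all add: L'_ray[OF k])
    also have "\<dots> = X.ray k False + X.ray k True"
      using comm_add_vec[OF X.ray_carrier X.ray_carrier] by (cases "S k") simp_all
    finally have "X.ray k False + X.ray k True = L' w" ..
    also have "\<dots> = vec m (\<lambda>j. \<Sum>p<m. N' (\<pi> p) (\<pi> k) * L' (Y.ray (\<pi> p) False) $ j)"
      unfolding w by (rule additive_sum[where m = m]) (use L'_carrier L'_add in auto)
    also have "\<dots> = X.comb S (\<lambda>p. N' (\<pi> p) (\<pi> k))"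
      unfolding X.comb_def by (intro eq_vecI) (auto simp: L'_ray intro!: sum.cong)
    finally show ?thesis .
  qed
  \<comment> \<open>In coordinate \<open>j\<close> the summands with \<open>p < j\<close> vanish:
    for an exchanged pair by the induction hypothesis, otherwise because the ray is the unit vector
    at \<open>p\<close>. What remains is an equality up to the sign \<open>S j\<close>, and
    \<open>signs\<close> excludes the negative sign unless both sides are 0.\<close>
  have "N j k = N' (\<pi> j) (\<pi> k) \<and> (S j \<longrightarrow> N' (\<pi> j) (\<pi> k) = 0)" if "j < m" "k < m" for j k
    using that
  proof (induction j arbitrary: k rule: less_induct)
    case (less j)
    have "N' (\<pi> p) (\<pi> k) * X.ray p (S p) $ j = 0" if "p < j" for p
    proof (cases "S p")
      case True
      then show ?thesis using less.IH[OF that] less.prems that by simp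
    next
      case False
      then show ?thesis using less.prems that by (simp add: X.ray_def)
    qed
    then have "(\<Sum>p<j. N' (\<pi> p) (\<pi> k) * X.ray p (S p) $ j) = 0" by (intro sum.neutral) auto
    then have "N j k = N' (\<pi> j) (\<pi> k) * (if S j then -1 else 1)"
      using X.comb_index[OF less.prems(1), of S "\<lambda>p. N' (\<pi> p) (\<pi> k)"] rel[OF less.prems(2)]
      by (simp add: N_def)
    moreover have "N j k = 0" if "N j k = - N' (\<pi> j) (\<pi> k)"
    proof (cases "j = k")
      case False
      then show ?thesis
        using signs[of j k "\<pi> j" "\<pi> k"] that less.prems \<pi>_lt \<pi>_inj by (simp add: N N')
    qed (use N less.prems in simp)
    ultimately show ?case by (auto split: if_splits)
  qed
  then have "B $$ (j, k) = B' $$ (\<pi> j, \<pi> k)" if "j < m" "k < m" for j k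
    using that N[OF that] N'[of "\<pi> j" "\<pi> k"] \<pi>_lt \<pi>_inj X.diag Y.diag
    by (cases "j = k") auto
  then show ?thesis using \<pi> by blast
qed

end

lemma toric_isomorphic_lattice_iso:
  assumes X: "bott m B" and Y: "bott m B'"
    and iso: "toric_isomorphic (bott_manifold B) (bott_manifold B')"
  shows "\<exists>L L'. lattice_iso m B B' L L'"
proof -
  interpret X: bott m B by fact
  interpret Y: bott m B' by fact
  obtain \<phi> \<phi>' where \<phi>: "toric_morphism (toric_variety m (bott_fan B)) (toric_variety m (bott_fan B')) \<phi>"
    and \<phi>': "toric_morphism (toric_variety m (bott_fan B')) (toric_variety m (bott_fan B)) \<phi>'"
    and inv: "\<forall>p\<in>toric_points m (bott_fan B). \<phi>' (\<phi> p) = p"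
      "\<forall>q\<in>toric_points m (bott_fan B'). \<phi> (\<phi>' q) = q"
    using iso unfolding toric_isomorphic_def bott_manifold_def by (auto simp: toric_variety_def)
  have map: "\<exists>\<psi>. toric_map m (bott_fan C) m (bott_fan D) f \<psi>"
    if "bott m C" "bott m D" "toric_morphism (toric_variety m (bott_fan C)) (toric_variety m (bott_fan D)) f"
    for C D f
    using that bott.bott_smooth_fan
    by (fastforce simp: toric_morphism_def toric_map_def toric_map_axioms_def toric_variety_def torus_group_def)
  obtain \<psi> where tm: "toric_map m (bott_fan B) m (bott_fan B') \<phi> \<psi>" using map[OF X Y \<phi>] by blast
  obtain \<psi>' where tm': "toric_map m (bott_fan B') m (bott_fan B) \<phi>' \<psi>'" using map[OF Y X \<phi>'] by blast
  \<comment> \<open>That the lattice maps are mutually inverse is read off from points: the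
    composite of the morphisms fixes every point of a one-parameter subgroup, and the torus chart is
    injective.\<close>
  have inverse: "toric_map.lattice_map m m h' (toric_map.lattice_map m m h l) = l"
    if t: "toric_map m \<Sigma> m \<Sigma>' f h" and t': "toric_map m \<Sigma>' m \<Sigma> f' h'" and l: "l \<in> carrier_vec m"
      and inv: "\<forall>p\<in>toric_points m \<Sigma>. f' (f p) = p" for \<Sigma> \<Sigma>' f h f' h' l
  proof -
    interpret T: toric_map m \<Sigma> m \<Sigma>' f h by fact
    interpret T': toric_map m \<Sigma>' m \<Sigma> f' h' by fact
    let ?l = "T.lattice_map l"
    have lc: "?l \<in> carrier_vec m" by (rule T.lattice_map(1)[OF l])
    show ?thesis
    proof (rule one_param_inj)
      fix z
      have op: "one_param m l z \<in> affine_points m {0\<^sub>v m}" by (rule one_param_torus[OF l])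
      have op': "one_param m (T'.lattice_map ?l) z \<in> affine_points m {0\<^sub>v m}"
        by (rule one_param_torus[OF T'.lattice_map(1)[OF lc]])
      have "chart m \<Sigma> {0\<^sub>v m} (one_param m l z) \<in> toric_points m \<Sigma>"
        unfolding toric_points_eq using T.X.zero_cone op by blast
      then have "f' (f (chart m \<Sigma> {0\<^sub>v m} (one_param m l z))) = chart m \<Sigma> {0\<^sub>v m} (one_param m l z)"
        using inv by blast
      moreover have "f' (f (chart m \<Sigma> {0\<^sub>v m} (one_param m l z))) =
          chart m \<Sigma> {0\<^sub>v m} (one_param m (T'.lattice_map ?l) z)"
        by (simp add: T.equivariant[OF op] T.lattice_map(2)[OF l] T'.equivariant[OF one_param_torus[OF lc]]
            T'.lattice_map(2)[OF lc])
      ultimately show "one_param m (T'.lattice_map ?l) z = one_param m l z"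
        using chart_inj[OF T.X.zero_cone op' op] by simp
    qed (use l T'.lattice_map(1)[OF lc] in auto)
  qed
  interpret T: toric_map m "bott_fan B" m "bott_fan B'" \<phi> \<psi> by fact
  interpret T': toric_map m "bott_fan B'" m "bott_fan B" \<phi>' \<psi>' by fact
  have "lattice_iso m B B' T.lattice_map T'.lattice_map"
    by unfold_locales
      (use T.lattice_map(1) T'.lattice_map(1) T.lattice_map_add T'.lattice_map_add
        inverse[OF tm tm' _ inv(1)] inverse[OF tm' tm _ inv(2)]
        lattice_map_cone[OF X Y tm] lattice_map_cone[OF Y X tm'] in simp_all)
  then show ?thesis by blast
qed

section \<open>Coordinate permutations\<close>

text \<open>Coordinates are pulled back along \<rho>, so the unit vector at \<open>\<rho> k\<close>
  goes to the unit vector at \<open>k\<close> when \<rho> is a permutation.\<close>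

definition reindex :: "nat \<Rightarrow> (nat \<Rightarrow> nat) \<Rightarrow> 'a vec \<Rightarrow> 'a vec" where
  "reindex m \<rho> v = vec m (\<lambda>i. v $ \<rho> i)"

text \<open>A point is a function on characters and is therefore transported by precomposition with
  the inverse reindexing.\<close>

definition move_point :: "nat \<Rightarrow> (nat \<Rightarrow> nat) \<Rightarrow> (nat \<Rightarrow> nat) \<Rightarrow> real vec set \<Rightarrow>
    (int vec \<Rightarrow> complex) \<Rightarrow> int vec \<Rightarrow> complex" where
  "move_point m \<rho> \<rho>' \<sigma> \<gamma> = (\<lambda>w\<in>dual_monoid m (reindex m \<rho> ` \<sigma>). \<gamma> (reindex m \<rho>' w))"

definition move :: "nat \<Rightarrow> (nat \<Rightarrow> nat) \<Rightarrow> (nat \<Rightarrow> nat) \<Rightarrow> chart_point \<Rightarrow> chart_point" where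
  "move m \<rho> \<rho>' = (\<lambda>(\<sigma>, \<gamma>). (reindex m \<rho> ` \<sigma>, move_point m \<rho> \<rho>' \<sigma> \<gamma>))"

text \<open>Both a permutation and its inverse are parameters, so the locale can be instantiated
  with their roles exchanged; each inclusion then yields its converse.\<close>

locale coordinate_perm =
  fixes m :: nat and \<rho> \<rho>' :: "nat \<Rightarrow> nat"
  assumes lt: "i < m \<Longrightarrow> \<rho> i < m" and lt': "i < m \<Longrightarrow> \<rho>' i < m"
    and inv: "i < m \<Longrightarrow> \<rho> (\<rho>' i) = i" and inv': "i < m \<Longrightarrow> \<rho>' (\<rho> i) = i"
begin

lemma inverse: "coordinate_perm m \<rho>' \<rho>"
  by unfold_locales (use lt lt' inv inv' in auto)

lemma bij: "bij_betw \<rho> {..<m} {..<m}"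
  by (rule bij_betw_byWitness[where f' = \<rho>']) (use lt lt' inv inv' in auto)

abbreviation "P \<equiv> reindex m \<rho>"
abbreviation "Q \<equiv> reindex m \<rho>'"
abbreviation "push \<equiv> move_point m \<rho> \<rho>'"

lemma P_carrier [simp]: "reindex m f v \<in> carrier_vec m"
  by (simp add: reindex_def)

lemma P_Q: "v \<in> carrier_vec m \<Longrightarrow> P (Q v) = v"
  by (intro eq_vecI) (auto simp: reindex_def lt inv')

lemma Q_P: "v \<in> carrier_vec m \<Longrightarrow> Q (P v) = v"
  by (intro eq_vecI) (auto simp: reindex_def lt' inv)

lemma Q_P_image: "\<sigma> \<subseteq> carrier_vec m \<Longrightarrow> Q ` P ` \<sigma> = \<sigma>"
  by (force simp: image_iff Q_P subset_iff)

lemma P_image_carrier: "P ` \<sigma> \<subseteq> carrier_vec m"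
  by auto

lemma P_scalar_prod:
  assumes "v \<in> carrier_vec m" "w \<in> carrier_vec m"
  shows "P w \<bullet> P v = w \<bullet> v"
proof -
  have "(\<Sum>i<m. w $ \<rho> i * v $ \<rho> i) = (\<Sum>i<m. w $ i * v $ i)"
    by (rule sum.reindex_bij_betw[OF bij, of "\<lambda>i. w $ i * v $ i"])
  then show ?thesis using assms by (simp add: scalar_prod_def reindex_def atLeast0LessThan)
qed

lemma Q_map_vec: "w \<in> carrier_vec m \<Longrightarrow> Q (map_vec f w) = map_vec f (Q w)"
  by (intro eq_vecI) (auto simp: reindex_def lt')

lemma Q_add: "u \<in> carrier_vec m \<Longrightarrow> w \<in> carrier_vec m \<Longrightarrow> Q (u + w) = Q u + Q w"
  by (intro eq_vecI) (auto simp: reindex_def lt')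

lemma Q_zero: "Q (0\<^sub>v m) = 0\<^sub>v m"
  by (intro eq_vecI) (auto simp: reindex_def lt')

lemma P_zero: "P (0\<^sub>v m) = 0\<^sub>v m"
  by (intro eq_vecI) (auto simp: reindex_def lt)

lemma dual_image:
  assumes "\<sigma> \<subseteq> carrier_vec m"
  shows "w \<in> dual_monoid m (P ` \<sigma>) \<longleftrightarrow> w \<in> carrier_vec m \<and> Q w \<in> dual_monoid m \<sigma>"
proof -
  have "map_vec of_int w \<bullet> P v = map_vec of_int (Q w) \<bullet> v"
    if "w \<in> carrier_vec m" "v \<in> \<sigma>" for v :: "real vec"
  proof -
    have "v \<in> carrier_vec m" using assms that by blast
    then have "map_vec of_int w \<bullet> P v = P (Q (map_vec of_int w)) \<bullet> P v"
      using that by (simp add: P_Q)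
    also have "\<dots> = Q (map_vec of_int w) \<bullet> v"
      by (rule P_scalar_prod) (use \<open>v \<in> carrier_vec m\<close> in auto)
    finally show ?thesis using that by (simp add: Q_map_vec)
  qed
  then show ?thesis by (auto simp: dual_monoid_def)
qed

lemma move_point_affine:
  assumes \<sigma>: "\<sigma> \<subseteq> carrier_vec m" and \<gamma>: "\<gamma> \<in> affine_points m \<sigma>"
  shows "push \<sigma> \<gamma> \<in> affine_points m (P ` \<sigma>)"
  using affine_points_zero[OF \<gamma>] affine_points_add[OF \<gamma>] dual_monoid_0_mem[OF P_image_carrier, of \<sigma>]
    dual_monoid_add[OF P_image_carrier, of _ \<sigma>]
  by (auto simp: affine_points_def move_point_def Q_zero Q_add dual_image[OF \<sigma>])

lemma move_point_inverse:
  assumes \<sigma>: "\<sigma> \<subseteq> carrier_vec m" and \<gamma>: "\<gamma> \<in> affine_points m \<sigma>"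
  shows "move_point m \<rho>' \<rho> (P ` \<sigma>) (push \<sigma> \<gamma>) = \<gamma>"
proof (rule extensionalityI[of _ "dual_monoid m \<sigma>"])
  show "\<gamma> \<in> extensional (dual_monoid m \<sigma>)" using \<gamma> by (simp add: affine_points_def)
  show "move_point m \<rho>' \<rho> (P ` \<sigma>) (push \<sigma> \<gamma>) \<in> extensional (dual_monoid m \<sigma>)"
    by (simp add: move_point_def Q_P_image[OF \<sigma>])
  fix w assume w: "w \<in> dual_monoid m \<sigma>"
  then have "w \<in> carrier_vec m" by (simp add: dual_monoid_def)
  then show "move_point m \<rho>' \<rho> (P ` \<sigma>) (push \<sigma> \<gamma>) w = \<gamma> w"
    using w by (simp add: move_point_def Q_P_image[OF \<sigma>] dual_image[OF \<sigma>] Q_P)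
qed

lemma move_inverse:
  assumes "\<sigma> \<subseteq> carrier_vec m" "\<gamma> \<in> affine_points m \<sigma>"
  shows "move m \<rho>' \<rho> (move m \<rho> \<rho>' (\<sigma>, \<gamma>)) = (\<sigma>, \<gamma>)"
  by (simp add: move_def Q_P_image[OF assms(1)] move_point_inverse[OF assms])

end

locale permuted_fan = coordinate_perm +
  fixes \<Sigma> :: "real vec set set"
  assumes fan_carrier: "\<sigma> \<in> \<Sigma> \<Longrightarrow> \<sigma> \<subseteq> carrier_vec m"
begin

abbreviation "\<Sigma>' \<equiv> (`) P ` \<Sigma>"

lemma inverse_fan: "(`) Q ` \<Sigma>' = \<Sigma>"
proof -
  have "(`) Q ` \<Sigma>' = (\<lambda>\<sigma>. \<sigma>) ` \<Sigma>"
    unfolding image_image by (rule image_cong) (use Q_P_image fan_carrier in \<open>auto simp: image_image\<close>)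
  then show ?thesis by simp
qed

lemma inverse_permuted_fan: "permuted_fan m \<rho>' \<rho> \<Sigma>'"
  using inverse by (auto simp: permuted_fan_def permuted_fan_axioms_def)

text \<open>The witness \<delta> of the gluing, which lives on the intersection of the two cones, is
  moved along with the two points.\<close>

lemma move_chart_subset:
  assumes "(\<tau>, \<eta>) \<in> chart m \<Sigma> \<sigma> \<gamma>"
  shows "move m \<rho> \<rho>' (\<tau>, \<eta>) \<in> chart m \<Sigma>' (P ` \<sigma>) (push \<sigma> \<gamma>)"
proof -
  obtain \<delta> where \<sigma>: "\<sigma> \<in> \<Sigma>" "\<gamma> \<in> affine_points m \<sigma>" and \<tau>: "\<tau> \<in> \<Sigma>" "\<eta> \<in> affine_points m \<tau>"
    and \<delta>: "\<delta> \<in> affine_points m (\<sigma> \<inter> \<tau>)" "\<gamma> = restrict \<delta> (dual_monoid m \<sigma>)"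
      "\<eta> = restrict \<delta> (dual_monoid m \<tau>)"
    using assms unfolding mem_chart_iff by blast
  have c: "\<sigma> \<subseteq> carrier_vec m" "\<tau> \<subseteq> carrier_vec m" "\<sigma> \<inter> \<tau> \<subseteq> carrier_vec m"
    using fan_carrier \<sigma> \<tau> by auto
  have "inj_on P (carrier_vec m)" by (rule inj_on_inverseI[of _ Q]) (rule Q_P)
  then have "P ` (\<sigma> \<inter> \<tau>) = P ` \<sigma> \<inter> P ` \<tau>" by (rule inj_on_image_Int[OF _ c(1,2)])
  then have "push (\<sigma> \<inter> \<tau>) \<delta> \<in> affine_points m (P ` \<sigma> \<inter> P ` \<tau>)"
    using move_point_affine[OF c(3) \<delta>(1)] by simp
  moreover have "push \<sigma>' (restrict \<delta> (dual_monoid m \<sigma>')) =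
      restrict (push (\<sigma> \<inter> \<tau>) \<delta>) (dual_monoid m (P ` \<sigma>'))"
    if "\<sigma>' \<subseteq> carrier_vec m" "\<sigma> \<inter> \<tau> \<subseteq> \<sigma>'" for \<sigma>'
  proof -
    have "dual_monoid m (P ` \<sigma>') \<subseteq> dual_monoid m (P ` (\<sigma> \<inter> \<tau>))"
      by (rule dual_monoid_antimono) (use that in blast)
    then show ?thesis by (auto simp: move_point_def restrict_def fun_eq_iff dual_image[OF that(1)] subset_iff)
  qed
  then have "push \<sigma> \<gamma> = restrict (push (\<sigma> \<inter> \<tau>) \<delta>) (dual_monoid m (P ` \<sigma>))"
    "push \<tau> \<eta> = restrict (push (\<sigma> \<inter> \<tau>) \<delta>) (dual_monoid m (P ` \<tau>))"
    using c \<delta>(2,3) by simp_all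
  ultimately show ?thesis
    unfolding move_def prod.case mem_chart_iff
    using \<sigma> \<tau> move_point_affine[OF c(1) \<sigma>(2)] move_point_affine[OF c(2) \<tau>(2)] by blast
qed

definition move_class :: "chart_point set \<Rightarrow> chart_point set" where
  "move_class c = move m \<rho> \<rho>' ` c"

lemma move_class_chart:
  assumes \<sigma>: "\<sigma> \<in> \<Sigma>" and \<gamma>: "\<gamma> \<in> affine_points m \<sigma>"
  shows "move_class (chart m \<Sigma> \<sigma> \<gamma>) = chart m \<Sigma>' (P ` \<sigma>) (push \<sigma> \<gamma>)"
proof -
  interpret I: permuted_fan m \<rho>' \<rho> \<Sigma>' by (rule inverse_permuted_fan)
  have "x \<in> move m \<rho> \<rho>' ` chart m \<Sigma> \<sigma> \<gamma>"
    if x: "x \<in> chart m \<Sigma>' (P ` \<sigma>) (push \<sigma> \<gamma>)" for x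
  proof -
    obtain \<tau> \<eta> where x_eq: "x = (\<tau>, \<eta>)" by (cases x)
    then have "\<tau> \<subseteq> carrier_vec m" "\<eta> \<in> affine_points m \<tau>" using x by (auto simp: mem_chart_iff)
    from I.move_inverse[OF this] have "move m \<rho> \<rho>' (move m \<rho>' \<rho> x) = x" by (simp add: x_eq)
    moreover have "move m \<rho>' \<rho> x \<in> chart m \<Sigma> \<sigma> \<gamma>"
      using I.move_chart_subset[of \<tau> \<eta> "P ` \<sigma>" "push \<sigma> \<gamma>"] x
      by (simp add: x_eq inverse_fan Q_P_image[OF fan_carrier[OF \<sigma>]]
          move_point_inverse[OF fan_carrier[OF \<sigma>] \<gamma>])
    ultimately show ?thesis by (metis imageI)
  qed
  moreover have "move m \<rho> \<rho>' x \<in> chart m \<Sigma>' (P ` \<sigma>) (push \<sigma> \<gamma>)"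
    if "x \<in> chart m \<Sigma> \<sigma> \<gamma>" for x
    using that move_chart_subset by (cases x) simp
  ultimately show ?thesis unfolding move_class_def by blast
qed

lemma move_class_points:
  assumes "p \<in> toric_points m \<Sigma>" shows "move_class p \<in> toric_points m \<Sigma>'"
proof -
  obtain \<sigma> \<gamma> where \<sigma>: "\<sigma> \<in> \<Sigma>" "\<gamma> \<in> affine_points m \<sigma>" and p: "p = chart m \<Sigma> \<sigma> \<gamma>"
    using assms unfolding toric_points_eq by blast
  have "move_class p = chart m \<Sigma>' (P ` \<sigma>) (push \<sigma> \<gamma>)"
    unfolding p by (rule move_class_chart[OF \<sigma>])
  moreover have "push \<sigma> \<gamma> \<in> affine_points m (P ` \<sigma>)"
    by (rule move_point_affine[OF fan_carrier[OF \<sigma>(1)] \<sigma>(2)])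
  ultimately show ?thesis unfolding toric_points_eq using \<sigma>(1) by blast
qed

lemma move_class_inverse:
  assumes "p \<in> toric_points m \<Sigma>" shows "move m \<rho>' \<rho> ` move_class p = p"
proof -
  obtain \<sigma> \<gamma> where p: "p = chart m \<Sigma> \<sigma> \<gamma>" using assms by (auto simp: toric_points_eq)
  have "move m \<rho>' \<rho> (move m \<rho> \<rho>' x) = x" if "x \<in> p" for x
    using that move_inverse fan_carrier unfolding p by (cases x) (auto simp: mem_chart_iff)
  then show ?thesis unfolding move_class_def by force
qed

lemma coordinate_ring_move:
  assumes \<sigma>: "\<sigma> \<in> \<Sigma>" and g: "g \<in> coordinate_ring m (P ` \<sigma>)"
  shows "\<exists>f\<in>coordinate_ring m \<sigma>. \<forall>\<gamma>. f \<gamma> = g (push \<sigma> \<gamma>)"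
proof -
  obtain W a where W: "finite W" "W \<subseteq> dual_monoid m (P ` \<sigma>)" and ga: "g = (\<lambda>\<gamma>. \<Sum>w\<in>W. a w * \<gamma> w)"
    using g unfolding coordinate_ring_def by blast
  have Wc: "W \<subseteq> carrier_vec m" using W dual_monoid_carrier[of m "P ` \<sigma>"] by blast
  have inj: "inj_on Q W" by (rule inj_on_inverseI[of _ P]) (use Wc P_Q in blast)
  have "(\<Sum>w\<in>Q ` W. a (P w) * \<gamma> w) = g (push \<sigma> \<gamma>)" for \<gamma>
    unfolding ga sum.reindex[OF inj] comp_def
    by (rule sum.cong) (use W Wc in \<open>auto simp: move_point_def P_Q subset_iff\<close>)
  moreover have "Q ` W \<subseteq> dual_monoid m \<sigma>"
    using W(2) dual_image[OF fan_carrier[OF \<sigma>]] by blast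
  then have "(\<lambda>\<gamma>. \<Sum>w\<in>Q ` W. a (P w) * \<gamma> w) \<in> coordinate_ring m \<sigma>"
    unfolding coordinate_ring_def using W(1)
    by (intro CollectI exI[of _ "Q ` W"] exI[of _ "\<lambda>w. a (P w)"]) simp
  ultimately show ?thesis by (intro bexI[of _ "\<lambda>\<gamma>. \<Sum>w\<in>Q ` W. a (P w) * \<gamma> w"]) simp_all
qed

lemma principal_open_move:
  assumes \<sigma>: "\<sigma> \<in> \<Sigma>" and f: "\<forall>\<gamma>. f \<gamma> = h (push \<sigma> \<gamma>)"
    and p: "p \<in> toric_points m \<Sigma>"
  shows "move_class p \<in> principal_open m \<Sigma>' (P ` \<sigma>) h \<longleftrightarrow> p \<in> principal_open m \<Sigma> \<sigma> f"
proof
  interpret I: permuted_fan m \<rho>' \<rho> \<Sigma>' by (rule inverse_permuted_fan)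
  assume "move_class p \<in> principal_open m \<Sigma>' (P ` \<sigma>) h"
  then obtain \<gamma>' where \<gamma>': "\<gamma>' \<in> affine_points m (P ` \<sigma>)" "h \<gamma>' \<noteq> 0"
    "move_class p = chart m \<Sigma>' (P ` \<sigma>) \<gamma>'"
    unfolding principal_open_def by blast
  define \<gamma> where "\<gamma> = move_point m \<rho>' \<rho> (P ` \<sigma>) \<gamma>'"
  have \<gamma>: "\<gamma> \<in> affine_points m \<sigma>"
    using I.move_point_affine[OF P_image_carrier \<gamma>'(1)] Q_P_image[OF fan_carrier[OF \<sigma>]]
    unfolding \<gamma>_def by simp
  have "push \<sigma> \<gamma> = \<gamma>'"
    using I.move_point_inverse[OF P_image_carrier \<gamma>'(1)] Q_P_image[OF fan_carrier[OF \<sigma>]]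
    unfolding \<gamma>_def by simp
  then have "move_class (chart m \<Sigma> \<sigma> \<gamma>) = move_class p" "f \<gamma> \<noteq> 0"
    using move_class_chart[OF \<sigma> \<gamma>] \<gamma>' f by auto
  moreover have "chart m \<Sigma> \<sigma> \<gamma> \<in> toric_points m \<Sigma>" using \<sigma> \<gamma> by (auto simp: toric_points_eq)
  ultimately have "p = chart m \<Sigma> \<sigma> \<gamma>" "f \<gamma> \<noteq> 0" using move_class_inverse p by metis+
  then show "p \<in> principal_open m \<Sigma> \<sigma> f" unfolding principal_open_def using \<gamma> by blast
next
  assume "p \<in> principal_open m \<Sigma> \<sigma> f"
  then obtain \<gamma> where "\<gamma> \<in> affine_points m \<sigma>" "f \<gamma> \<noteq> 0" "p = chart m \<Sigma> \<sigma> \<gamma>"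
    unfolding principal_open_def by blast
  then show "move_class p \<in> principal_open m \<Sigma>' (P ` \<sigma>) h"
    unfolding principal_open_def
    using move_class_chart[OF \<sigma>] move_point_affine[OF fan_carrier[OF \<sigma>]] f by auto
qed

lemma principal_open_points: "\<sigma> \<in> \<Sigma> \<Longrightarrow> principal_open m \<Sigma> \<sigma> f \<subseteq> toric_points m \<Sigma>"
  by (auto simp: principal_open_def toric_points_eq)

abbreviation "preimage V \<equiv> {p \<in> toric_points m \<Sigma>. move_class p \<in> V}"

lemma preimage_open:
  assumes V: "zariski_open m \<Sigma>' V"
  shows "zariski_open m \<Sigma> (preimage V)"
  unfolding zariski_open_def
proof (intro conjI ballI)
  fix p assume "p \<in> preimage V"
  then have p: "p \<in> toric_points m \<Sigma>" "move_class p \<in> V" by auto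
  then obtain \<sigma> h where \<sigma>: "\<sigma> \<in> \<Sigma>" and h: "h \<in> coordinate_ring m (P ` \<sigma>)"
    and ph: "move_class p \<in> principal_open m \<Sigma>' (P ` \<sigma>) h" and sub: "principal_open m \<Sigma>' (P ` \<sigma>) h \<subseteq> V"
    using V unfolding zariski_open_def by blast
  obtain f where f: "f \<in> coordinate_ring m \<sigma>" "\<forall>\<gamma>. f \<gamma> = h (push \<sigma> \<gamma>)"
    using coordinate_ring_move[OF \<sigma> h] by blast
  have "p \<in> principal_open m \<Sigma> \<sigma> f" using principal_open_move[OF \<sigma> f(2) p(1)] ph by simp
  moreover have "principal_open m \<Sigma> \<sigma> f \<subseteq> preimage V"
    using principal_open_move[OF \<sigma> f(2)] principal_open_points[OF \<sigma>, of f] sub by blast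
  ultimately show "\<exists>\<sigma>\<in>\<Sigma>. \<exists>h\<in>coordinate_ring m \<sigma>. p \<in> principal_open m \<Sigma> \<sigma> h \<and>
      principal_open m \<Sigma> \<sigma> h \<subseteq> preimage V"
    using \<sigma> f(1) by blast
qed blast

lemma preimage_regular:
  assumes V: "regular_on m \<Sigma>' V r"
  shows "regular_on m \<Sigma> (preimage V) (r \<circ> move_class)"
  unfolding regular_on_def
proof (intro conjI ballI)
  show "zariski_open m \<Sigma> (preimage V)"
    by (rule preimage_open) (use V in \<open>simp add: regular_on_def\<close>)
  fix p assume "p \<in> preimage V"
  then have p: "p \<in> toric_points m \<Sigma>" "move_class p \<in> V" by auto
  obtain \<sigma>' g h where \<sigma>': "\<sigma>' \<in> \<Sigma>'" and g: "g \<in> coordinate_ring m \<sigma>'"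
    and h: "h \<in> coordinate_ring m \<sigma>'"
    and ph: "move_class p \<in> principal_open m \<Sigma>' \<sigma>' h" and sub: "principal_open m \<Sigma>' \<sigma>' h \<subseteq> V"
    and r: "\<forall>\<gamma>\<in>affine_points m \<sigma>'. h \<gamma> \<noteq> 0 \<longrightarrow> r (chart m \<Sigma>' \<sigma>' \<gamma>) = g \<gamma> / h \<gamma>"
    using V p(2) unfolding regular_on_def by meson
  obtain \<sigma> where \<sigma>: "\<sigma> \<in> \<Sigma>" "\<sigma>' = P ` \<sigma>" using \<sigma>' by blast
  obtain f where f: "f \<in> coordinate_ring m \<sigma>" "\<forall>\<gamma>. f \<gamma> = h (push \<sigma> \<gamma>)"
    using coordinate_ring_move[OF \<sigma>(1)] h \<sigma>(2) by blast
  obtain e where e: "e \<in> coordinate_ring m \<sigma>" "\<forall>\<gamma>. e \<gamma> = g (push \<sigma> \<gamma>)"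
    using coordinate_ring_move[OF \<sigma>(1)] g \<sigma>(2) by blast
  have "p \<in> principal_open m \<Sigma> \<sigma> f" using principal_open_move[OF \<sigma>(1) f(2) p(1)] ph \<sigma>(2) by simp
  moreover have "principal_open m \<Sigma> \<sigma> f \<subseteq> preimage V"
    using principal_open_move[OF \<sigma>(1) f(2)] principal_open_points[OF \<sigma>(1), of f] sub \<sigma>(2) by blast
  moreover have "(r \<circ> move_class) (chart m \<Sigma> \<sigma> \<gamma>) = e \<gamma> / f \<gamma>"
    if "\<gamma> \<in> affine_points m \<sigma>" "f \<gamma> \<noteq> 0" for \<gamma>
    using r move_point_affine[OF fan_carrier[OF \<sigma>(1)] that(1)] that(2)
    by (simp add: move_class_chart[OF \<sigma>(1) that(1)] e f \<sigma>(2))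
  ultimately show "\<exists>\<sigma>\<in>\<Sigma>. \<exists>g\<in>coordinate_ring m \<sigma>. \<exists>h\<in>coordinate_ring m \<sigma>.
      p \<in> principal_open m \<Sigma> \<sigma> h \<and> principal_open m \<Sigma> \<sigma> h \<subseteq> preimage V \<and>
      (\<forall>\<gamma>\<in>affine_points m \<sigma>. h \<gamma> \<noteq> 0 \<longrightarrow> (r \<circ> move_class) (chart m \<Sigma> \<sigma> \<gamma>) = g \<gamma> / h \<gamma>)"
    using \<sigma>(1) f(1) e(1) by blast
qed

lemma move_toric_morphism:
  assumes zero: "{0\<^sub>v m} \<in> \<Sigma>"
  shows "toric_morphism (toric_variety m \<Sigma>) (toric_variety m \<Sigma>') (image (move m \<rho> \<rho>'))"
proof -
  have mc: "image (move m \<rho> \<rho>') = move_class" by (simp add: fun_eq_iff move_class_def)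
  have P0: "P ` {0\<^sub>v m} = {0\<^sub>v m :: real vec}"
    by (simp add: P_zero)
  have "variety_morphism (toric_variety m \<Sigma>) (toric_variety m \<Sigma>') move_class"
    unfolding variety_morphism_def toric_variety_def
    using move_class_points preimage_open preimage_regular by simp
  moreover have "push {0\<^sub>v m} \<in> hom (torus_group m) (torus_group m)"
  proof (rule homI)
    fix s t assume "s \<in> carrier (torus_group m)" "t \<in> carrier (torus_group m)"
    show "push {0\<^sub>v m} (s \<otimes>\<^bsub>torus_group m\<^esub> t) =
        push {0\<^sub>v m} s \<otimes>\<^bsub>torus_group m\<^esub> push {0\<^sub>v m} t"
      by (auto simp: torus_group_def move_point_def P_zero dual_monoid_zero)
  qed (use move_point_affine[OF fan_carrier[OF zero]] P0 in \<open>simp add: torus_group_def\<close>)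
  moreover have "move_class (chart m \<Sigma> {0\<^sub>v m} t) = chart m \<Sigma>' {0\<^sub>v m} (push {0\<^sub>v m} t)"
    if "t \<in> affine_points m {0\<^sub>v m}" for t
    using move_class_chart[OF zero that] P0 by simp
  ultimately show ?thesis
    unfolding mc toric_morphism_def by (auto simp: toric_variety_def torus_group_def)
qed

lemma permuted_isomorphic:
  assumes zero: "{0\<^sub>v m} \<in> \<Sigma>"
  shows "toric_isomorphic (toric_variety m \<Sigma>) (toric_variety m \<Sigma>')"
proof -
  interpret I: permuted_fan m \<rho>' \<rho> \<Sigma>' by (rule inverse_permuted_fan)
  have "P ` {0\<^sub>v m} = {0\<^sub>v m :: real vec}" by (simp add: P_zero)
  then have zero': "{0\<^sub>v m} \<in> \<Sigma>'" using zero by force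
  have "toric_morphism (toric_variety m \<Sigma>') (toric_variety m \<Sigma>) (image (move m \<rho>' \<rho>))"
    using I.move_toric_morphism[OF zero'] inverse_fan by simp
  moreover have "move m \<rho>' \<rho> ` (move m \<rho> \<rho>' ` p) = p" if "p \<in> toric_points m \<Sigma>" for p
    using move_class_inverse[OF that] by (simp add: move_class_def)
  moreover have "move m \<rho> \<rho>' ` (move m \<rho>' \<rho> ` p) = p" if "p \<in> toric_points m \<Sigma>'" for p
    using I.move_class_inverse[OF that] by (simp add: I.move_class_def)
  ultimately show ?thesis
    using move_toric_morphism[OF zero] unfolding toric_isomorphic_def toric_variety_def
    by (intro exI[of _ "image (move m \<rho> \<rho>')"] exI[of _ "image (move m \<rho>' \<rho>)"]) simp
qed

end

text \<open>Reindexing sends ray \<open>\<rho> k\<close> of \<open>B\<close> to ray \<open>k\<close>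
  of \<open>B'\<close> with the same flag. Flags are thus composed with \<rho>, and index sets are
  mapped by \<rho>'.\<close>

lemma reindex_bott_fan:
  assumes X: "bott m B" and Y: "bott m B'" and \<rho>: "coordinate_perm m \<rho> \<rho>'"
    and entries: "\<And>i k. i < m \<Longrightarrow> k < m \<Longrightarrow> B' $$ (i, k) = B $$ (\<rho> i, \<rho> k)"
  shows "(`) (reindex m \<rho>) ` bott_fan B \<subseteq> bott_fan B'"
proof -
  interpret X: bott m B by fact
  interpret Y: bott m B' by fact
  interpret coordinate_perm m \<rho> \<rho>' by fact
  have ray: "Y.ray k b $ i = X.ray (\<rho> k) b $ \<rho> i" if "i < m" "k < m" for i k b
    using that entries lt inv' by (cases b) (auto simp: X.ray_def Y.ray_def, metis)
  have comb: "P (X.comb s a) = Y.comb (s \<circ> \<rho>) (a \<circ> \<rho>)" for s and a :: "nat \<Rightarrow> real"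
  proof (rule eq_vecI)
    fix i assume "i < dim_vec (Y.comb (s \<circ> \<rho>) (a \<circ> \<rho>))"
    then have i: "i < m" by simp
    have "(\<Sum>k<m. a k * of_int (X.ray k (s k) $ \<rho> i)) =
        (\<Sum>k<m. a (\<rho> k) * of_int (X.ray (\<rho> k) (s (\<rho> k)) $ \<rho> i))"
      by (rule sum.reindex_bij_betw[OF bij, symmetric])
    then show "P (X.comb s a) $ i = Y.comb (s \<circ> \<rho>) (a \<circ> \<rho>) $ i"
      using i lt by (simp add: reindex_def X.comb_def Y.comb_def ray)
  qed (simp add: reindex_def)
  have "P ` X.cone s I = Y.cone (s \<circ> \<rho>) (\<rho>' ` I)" if I: "I \<subseteq> {..<m}" for s I
  proof (intro equalityI subsetI)
    fix v assume "v \<in> P ` X.cone s I"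
    then obtain a where a: "v = P (X.comb s a)" "\<forall>k<m. 0 \<le> a k" "\<forall>k<m. k \<notin> I \<longrightarrow> a k = 0"
      unfolding X.cone_def by blast
    have "(a \<circ> \<rho>) k = 0" if "k < m" "k \<notin> \<rho>' ` I" for k
      using a(3) lt[OF that(1)] inv'[OF that(1)] that(2) by (metis comp_apply imageI)
    then show "v \<in> Y.cone (s \<circ> \<rho>) (\<rho>' ` I)"
      unfolding Y.cone_def a(1) comb using a(2) lt
      by (intro CollectI exI[of _ "a \<circ> \<rho>"] conjI) auto
  next
    fix v assume "v \<in> Y.cone (s \<circ> \<rho>) (\<rho>' ` I)"
    then obtain b where b: "v = Y.comb (s \<circ> \<rho>) b" "\<forall>k<m. 0 \<le> b k" "\<forall>k<m. k \<notin> \<rho>' ` I \<longrightarrow> b k = 0"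
      unfolding Y.cone_def by blast
    have "(b \<circ> \<rho>') k = 0" if "k < m" "k \<notin> I" for k
    proof -
      have "\<rho>' k \<notin> \<rho>' ` I" using that I inv by (metis image_iff lessThan_iff subsetD)
      then show ?thesis using b(3) lt'[OF that(1)] by simp
    qed
    then have "X.comb s (b \<circ> \<rho>') \<in> X.cone s I"
      unfolding X.cone_def using b(2) lt'
      by (intro CollectI exI[of _ "b \<circ> \<rho>'"] conjI) auto
    moreover have "v = P (X.comb s (b \<circ> \<rho>'))"
      unfolding comb b(1) by (rule Y.comb_cong) (auto simp: inv')
    ultimately show "v \<in> P ` X.cone s I" by blast
  qed
  moreover have "\<rho>' ` I \<subseteq> {..<m}" if "I \<subseteq> {..<m}" for I using that lt' by auto
  ultimately show ?thesis using Y.cone_in_fan by (auto simp: X.bott_fan_eq)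
qed

lemma permuted_bott_isomorphic:
  assumes X: "bott m B" and Y: "bott m B'" and \<pi>: "bij_betw \<pi> {..<m} {..<m}"
    and entries: "\<And>j k. j < m \<Longrightarrow> k < m \<Longrightarrow> B $$ (j, k) = B' $$ (\<pi> j, \<pi> k)"
  shows "toric_isomorphic (bott_manifold B) (bott_manifold B')"
proof -
  \<comment> \<open>Reindexing pulls coordinates back, so it has to use the inverse of
    \<pi>.\<close>
  define \<rho> where "\<rho> = the_inv_into {..<m} \<pi>"
  have \<pi>': "\<pi> k < m" "\<rho> k < m" "\<rho> (\<pi> k) = k" "\<pi> (\<rho> k) = k" if "k < m" for k
    using \<pi> that bij_betw_the_inv_into[OF \<pi>] unfolding \<rho>_def
    by (auto simp: bij_betw_def the_inv_into_f_f f_the_inv_into_f)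
  have perm: "coordinate_perm m \<rho> \<pi>" by unfold_locales (use \<pi>' in auto)
  interpret X: bott m B by fact
  interpret Y: bott m B' by fact
  interpret permuted_fan m \<rho> \<pi> "bott_fan B"
    using perm smooth_fan.cone_carrier[OF X.bott_smooth_fan]
    by (auto simp: permuted_fan_def permuted_fan_axioms_def)
  have "(`) P ` bott_fan B \<subseteq> bott_fan B'"
    by (rule reindex_bott_fan[OF X Y perm]) (use entries \<pi>' in auto)
  moreover have "bott_fan B' \<subseteq> (`) P ` bott_fan B"
  proof
    fix \<sigma> assume \<sigma>: "\<sigma> \<in> bott_fan B'"
    have "(`) Q ` bott_fan B' \<subseteq> bott_fan B"
      by (rule reindex_bott_fan[OF Y X inverse]) (use entries in auto)
    then have "Q ` \<sigma> \<in> bott_fan B" using \<sigma> by blast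
    moreover have "P ` Q ` \<sigma> = \<sigma>"
      by (rule coordinate_perm.Q_P_image[OF inverse smooth_fan.cone_carrier[OF Y.bott_smooth_fan \<sigma>]])
    ultimately show "\<sigma> \<in> (`) P ` bott_fan B" by (metis imageI)
  qed
  ultimately have "bott_fan B' = (`) P ` bott_fan B" by blast
  then show ?thesis
    using permuted_isomorphic smooth_fan.zero_cone[OF X.bott_smooth_fan]
    by (simp add: bott_manifold_def)
qed

section \<open>Assemblies and their matrices\<close>

definition same_block :: "nat set list list \<Rightarrow> nat \<Rightarrow> nat \<Rightarrow> bool" where
  "same_block \<sigma> j k \<longleftrightarrow> (\<exists>\<eta>\<in>set \<sigma>. \<exists>b<length \<eta>. j \<in> \<eta> ! b \<and> k \<in> \<eta> ! b)"

text \<open>The counterpart of \<open>bs_matrix\<close>, with equal letters replaced by common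
  blocks and consecutive letters by consecutive blocks. The indices are the integers 1 to m
  themselves, hence \<open>Suc\<close> wherever matrix positions are compared with them.\<close>

definition entry :: "nat set list list \<Rightarrow> nat \<Rightarrow> nat \<Rightarrow> int" where
  "entry \<sigma> j k = (if j < k then 0 else if j = k then -1 else if same_block \<sigma> j k then -2
     else if neighbors \<sigma> j k then 1 else 0)"

lemma same_block_sym: "same_block \<sigma> j k \<longleftrightarrow> same_block \<sigma> k j"
  unfolding same_block_def by blast

lemma neighbors_sym: "neighbors \<sigma> j k \<Longrightarrow> neighbors \<sigma> k j"
  unfolding neighbors_def by (metis)

lemma same_block_imp_neighbors: "same_block \<sigma> j k \<Longrightarrow> j \<noteq> k \<Longrightarrow> neighbors \<sigma> j k"
  unfolding same_block_def neighbors_def by blast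

lemma entry_zero_iff: "k < j \<Longrightarrow> entry \<sigma> j k = 0 \<longleftrightarrow> \<not> neighbors \<sigma> j k"
  using same_block_imp_neighbors[of \<sigma> j k] by (auto simp: entry_def)

lemma reversal_block:
  assumes r: "reversal_equiv \<sigma> \<tau>" and \<eta>: "\<eta> \<in> set \<sigma>"
  shows "\<exists>\<theta>\<in>set \<tau>. \<theta> = \<eta> \<or> \<theta> = rev \<eta>"
proof -
  obtain i where i: "i < length \<sigma>" "\<eta> = \<sigma> ! i" using \<eta> by (auto simp: in_set_conv_nth)
  then have "\<tau> ! i = \<eta> \<or> \<tau> ! i = rev \<eta>" "\<tau> ! i \<in> set \<tau>"
    using r by (auto simp: reversal_equiv_def list_all2_conv_all_nth)
  then show ?thesis by blast
qed

lemma reversal_equiv_sym: "reversal_equiv \<sigma> \<tau> \<Longrightarrow> reversal_equiv \<tau> \<sigma>"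
  by (auto simp: reversal_equiv_def list_all2_conv_all_nth)

lemma reversal_equiv_refl: "reversal_equiv \<sigma> \<sigma>"
  by (simp add: reversal_equiv_def list.rel_refl)

lemma reversal_same_block:
  assumes "reversal_equiv \<sigma> \<tau>" "same_block \<sigma> j k"
  shows "same_block \<tau> j k"
proof -
  have *: "same_block \<rho> j k \<longleftrightarrow> (\<exists>\<eta>\<in>set \<rho>. \<exists>X\<in>set \<eta>. j \<in> X \<and> k \<in> X)" for \<rho>
    unfolding same_block_def by (metis in_set_conv_nth)
  obtain \<eta> X where \<eta>: "\<eta> \<in> set \<sigma>" and X: "X \<in> set \<eta>" "j \<in> X" "k \<in> X" using assms(2) * by blast
  obtain \<theta> where \<theta>: "\<theta> \<in> set \<tau>" "\<theta> = \<eta> \<or> \<theta> = rev \<eta>"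
    using reversal_block[OF assms(1) \<eta>] by blast
  have "X \<in> set \<theta>" using \<theta>(2) X(1) by auto
  then show ?thesis unfolding * using X(2,3) \<theta>(1) by blast
qed

lemma reversal_neighbors:
  assumes "reversal_equiv \<sigma> \<tau>" "neighbors \<sigma> j k"
  shows "neighbors \<tau> j k"
proof -
  obtain \<eta> b c where \<eta>: "\<eta> \<in> set \<sigma>" and jk: "j \<noteq> k" and b: "b < length \<eta>" "c < length \<eta>"
    "c + 1 = b \<or> c = b \<or> c = b + 1" "k \<in> \<eta> ! b" "j \<in> \<eta> ! c"
    using assms(2) unfolding neighbors_def by blast
  obtain \<theta> where \<theta>: "\<theta> \<in> set \<tau>" "\<theta> = \<eta> \<or> \<theta> = rev \<eta>" using reversal_block[OF assms(1) \<eta>] by blast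
  from \<theta>(2) show ?thesis
  proof
    assume "\<theta> = \<eta>"
    then show ?thesis unfolding neighbors_def using \<theta>(1) jk b by blast
  next
    assume \<theta>_eq: "\<theta> = rev \<eta>"
    define b' c' where "b' = length \<eta> - 1 - b" and "c' = length \<eta> - 1 - c"
    have "b' < length \<theta>" "c' < length \<theta>" "c' + 1 = b' \<or> c' = b' \<or> c' = b' + 1"
      using b by (auto simp: b'_def c'_def \<theta>_eq)
    moreover have "k \<in> \<theta> ! b'" "j \<in> \<theta> ! c'"
      using b by (auto simp: b'_def c'_def \<theta>_eq rev_nth)
    ultimately show ?thesis unfolding neighbors_def using \<theta>(1) jk by blast
  qed
qed

lemma reversal_entry:
  assumes "reversal_equiv \<sigma> \<tau>" shows "entry \<sigma> j k = entry \<tau> j k"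
proof -
  have "same_block \<sigma> j k \<longleftrightarrow> same_block \<tau> j k" "neighbors \<sigma> j k \<longleftrightarrow> neighbors \<tau> j k"
    using reversal_same_block[OF assms] reversal_same_block[OF reversal_equiv_sym[OF assms]]
      reversal_neighbors[OF assms] reversal_neighbors[OF reversal_equiv_sym[OF assms]] by blast+
  then show ?thesis by (simp add: entry_def)
qed

section \<open>Adjacent swaps and the matrix\<close>

abbreviation adj_swap :: "nat \<Rightarrow> nat \<Rightarrow> nat" where
  "adj_swap j \<equiv> Transposition.transpose j (Suc j)"

lemma set_swap_adjacent:
  "set (swap_adjacent j \<sigma>) = map (image (adj_swap j)) ` set \<sigma>"
  by (simp add: swap_adjacent_def)

lemma swap_same_block:
  "same_block (swap_adjacent j \<sigma>) (adj_swap j a) (adj_swap j b)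
    \<longleftrightarrow> same_block \<sigma> a b"
  unfolding same_block_def set_swap_adjacent
  by (simp add: inj_image_mem_iff[OF inj_transpose] cong: conj_cong)

lemma swap_neighbors:
  "neighbors (swap_adjacent j \<sigma>) (adj_swap j a) (adj_swap j b)
    \<longleftrightarrow> neighbors \<sigma> a b"
  unfolding neighbors_def set_swap_adjacent
  by (simp add: inj_image_mem_iff[OF inj_transpose] inj_eq[OF inj_transpose] cong: conj_cong)

text \<open>The swap changes the relative order of no pair except \<open>j\<close> and
  \<open>j + 1\<close>. For that pair both entries are 0, on one side of the diagonal by definition
  and on the other because the two are not neighbors.\<close>

lemma swap_entry:
  assumes "\<not> neighbors \<sigma> j (j + 1)"
  shows "entry (swap_adjacent j \<sigma>) (adj_swap j a) (adj_swap j b)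
    = entry \<sigma> a b"
proof -
  let ?t = "adj_swap j"
  have inj: "?t a = ?t b \<longleftrightarrow> a = b" by (rule inj_eq[OF inj_transpose])
  consider "a = b" | "a < b" "\<not> (a = j \<and> b = j + 1)" | "b < a" "\<not> (b = j \<and> a = j + 1)"
    | "a = j \<and> b = j + 1 \<or> b = j \<and> a = j + 1" by linarith
  then show ?thesis
  proof cases
    case 1
    then show ?thesis by (simp add: entry_def)
  next
    case 2
    then have "?t a < ?t b" by (auto simp: Transposition.transpose_def)
    then show ?thesis using 2 by (simp add: entry_def)
  next
    case 3
    then have "?t b < ?t a" by (auto simp: Transposition.transpose_def)
    then show ?thesis using 3 by (simp add: entry_def swap_same_block swap_neighbors)
  next
    case 4
    then have "\<not> neighbors \<sigma> a b" "\<not> same_block \<sigma> a b" "a \<noteq> b"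
      using assms neighbors_sym same_block_imp_neighbors by (metis n_not_Suc_n Suc_eq_plus1)+
    then show ?thesis by (simp add: entry_def swap_same_block swap_neighbors inj)
  qed
qed

section \<open>Blocks of an assembly\<close>

lemma assembly_entries:
  assumes "assembly m \<sigma>" and "\<eta> \<in> set \<sigma>"
  shows "{} \<notin> set \<eta>" "sorted_wrt disjnt \<eta>" "support \<eta> \<subseteq> {1..m}" "support \<eta> \<noteq> {}"
  using assms partition_onD1[of "{1..m}" "support ` set \<sigma>"] partition_onD3[of "{1..m}" "support ` set \<sigma>"]
  by (auto simp: assembly_def ordered_partition_def)

lemma Min_support_inj:
  assumes part: "partition_on A P" and "finite A" and X: "X \<in> P" "Y \<in> P" and eq: "Min X = Min (Y :: nat set)"
  shows "X = Y"
proof (rule ccontr)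
  assume "X \<noteq> Y"
  then have "X \<inter> Y = {}" using partition_onD2[OF part] X by (auto simp: disjoint_def)
  moreover have "finite X" "finite Y" "X \<noteq> {}" "Y \<noteq> {}"
    using X partition_onD1[OF part] partition_onD3[OF part] \<open>finite A\<close>
    by (auto intro: finite_subset[of _ A])
  then have "Min X \<in> X" "Min Y \<in> Y" by auto
  ultimately show False using eq by auto
qed

lemma assembly_unique:
  assumes \<sigma>: "assembly m \<sigma>" and \<eta>: "\<eta> \<in> set \<sigma>" "\<theta> \<in> set \<sigma>" and x: "x \<in> support \<eta>" "x \<in> support \<theta>"
  shows "\<eta> = \<theta>"
proof -
  have "disjoint (support ` set \<sigma>)"
    using \<sigma> partition_onD2 unfolding assembly_def by blast
  then have "support \<eta> = support \<theta>" using \<eta> x by (auto simp: disjoint_def)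
  moreover have inj: "inj_on (\<lambda>\<eta>. Min (support \<eta>)) (set \<sigma>)"
    using \<sigma> by (simp add: assembly_def distinct_map strict_sorted_iff)
  ultimately show ?thesis using inj_onD[OF inj _ \<eta>] by simp
qed

lemma block_support: "b < length \<eta> \<Longrightarrow> \<eta> ! b \<subseteq> support \<eta>"
  unfolding support_def using nth_mem by blast

lemma assembly_block_unique:
  assumes \<sigma>: "assembly m \<sigma>" and \<eta>: "\<eta> \<in> set \<sigma>" and b: "b < length \<eta>" "c < length \<eta>"
    and x: "x \<in> \<eta> ! b" "x \<in> \<eta> ! c"
  shows "b = c"
proof (rule ccontr)
  assume "b \<noteq> c"
  have "disjnt (\<eta> ! i) (\<eta> ! j)" if "i < j" "j < length \<eta>" for i j
    using assembly_entries(2)[OF \<sigma> \<eta>] that by (simp add: sorted_wrt_iff_nth_less)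
  then have "disjnt (\<eta> ! b) (\<eta> ! c) \<or> disjnt (\<eta> ! c) (\<eta> ! b)"
    using b \<open>b \<noteq> c\<close> by (meson linorder_neqE_nat)
  then show False using x by (auto simp: disjnt_def)
qed

lemma assembly_cover:
  assumes \<sigma>: "assembly m \<sigma>" and x: "x \<in> {1..m}"
  shows "\<exists>\<eta>\<in>set \<sigma>. \<exists>b<length \<eta>. x \<in> \<eta> ! b"
proof -
  have "{1..m} = \<Union> (support ` set \<sigma>)" using \<sigma> partition_onD1 unfolding assembly_def by blast
  then obtain \<eta> where "\<eta> \<in> set \<sigma>" "x \<in> support \<eta>" using x by blast
  then show ?thesis unfolding support_def by (metis UnionE in_set_conv_nth)
qed

lemma assembly_same_block_iff:
  assumes \<sigma>: "assembly m \<sigma>" and \<eta>: "\<eta> \<in> set \<sigma>" "b < length \<eta>" "x \<in> \<eta> ! b"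
  shows "same_block \<sigma> x y \<longleftrightarrow> y \<in> \<eta> ! b"
proof
  assume "same_block \<sigma> x y"
  then obtain \<theta> c where \<theta>: "\<theta> \<in> set \<sigma>" "c < length \<theta>" "x \<in> \<theta> ! c" "y \<in> \<theta> ! c"
    unfolding same_block_def by blast
  have "\<eta> = \<theta>"
    by (rule assembly_unique[OF \<sigma> \<eta>(1) \<theta>(1), of x]) (use \<eta> \<theta> block_support in blast)+
  then show "y \<in> \<eta> ! b" using assembly_block_unique[OF \<sigma> \<eta>(1,2)] \<eta>(3) \<theta> by blast
qed (use \<eta> in \<open>auto simp: same_block_def\<close>)

lemma assembly_neighbors_iff:
  assumes \<sigma>: "assembly m \<sigma>" and \<eta>: "\<eta> \<in> set \<sigma>" "b < length \<eta>" "x \<in> \<eta> ! b" and "x \<noteq> y"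
  shows "neighbors \<sigma> y x \<longleftrightarrow> (\<exists>c<length \<eta>. (c + 1 = b \<or> c = b \<or> c = b + 1) \<and> y \<in> \<eta> ! c)"
proof
  assume "neighbors \<sigma> y x"
  then obtain \<theta> b' c where \<theta>: "\<theta> \<in> set \<sigma>" "b' < length \<theta>" "x \<in> \<theta> ! b'" "c < length \<theta>"
    "c + 1 = b' \<or> c = b' \<or> c = b' + 1" "y \<in> \<theta> ! c"
    unfolding neighbors_def by blast
  have "\<eta> = \<theta>"
    by (rule assembly_unique[OF \<sigma> \<eta>(1) \<theta>(1), of x]) (use \<eta> \<theta> block_support in blast)+
  moreover have "b = b'"
    by (rule assembly_block_unique[OF \<sigma> \<eta>(1,2)]) (use \<open>\<eta> = \<theta>\<close> \<theta> \<eta> in auto)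
  ultimately show "\<exists>c<length \<eta>. (c + 1 = b \<or> c = b \<or> c = b + 1) \<and> y \<in> \<eta> ! c" using \<theta> by blast
next
  assume "\<exists>c<length \<eta>. (c + 1 = b \<or> c = b \<or> c = b + 1) \<and> y \<in> \<eta> ! c"
  then show "neighbors \<sigma> y x" unfolding neighbors_def using \<eta> \<open>x \<noteq> y\<close> by blast
qed

text \<open>Different members of a partition have different minima, so sorting by minima makes them
  strictly increasing.\<close>

lemma assembly_sort:
  assumes op: "\<And>\<eta>. \<eta> \<in> set \<sigma> \<Longrightarrow> ordered_partition \<eta>"
    and part: "partition_on {1..m} (support ` set \<sigma>)" and dist: "distinct (map support \<sigma>)"
  shows "assembly m (sort_key (\<lambda>\<eta>. Min (support \<eta>)) \<sigma>)"
proof -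
  let ?key = "\<lambda>\<eta>. Min (support \<eta>)"
  have "inj_on Min (support ` set \<sigma>)"
    by (rule inj_onI) (rule Min_support_inj[OF part], auto)
  then have "inj_on ?key (set \<sigma>)"
    using dist comp_inj_on[of support "set \<sigma>" Min] by (simp add: distinct_map comp_def)
  then have "distinct (map ?key (sort_key ?key \<sigma>))"
    using dist by (simp add: distinct_map)
  then show ?thesis
    using op part by (simp add: assembly_def strict_sorted_iff)
qed

lemma sum_list_length_sort: "(\<Sum>\<eta>\<leftarrow>sort_key f \<sigma>. length \<eta>) = (\<Sum>\<eta>\<leftarrow>\<sigma>. length \<eta>)"
  by (metis mset_map mset_sort sum_mset_sum_list)

lemma assembly_distinct_support:
  assumes "assembly m \<sigma>" shows "distinct (map support \<sigma>)"
proof -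
  have "distinct (map Min (map support \<sigma>))"
    using assms by (simp add: assembly_def strict_sorted_iff comp_def)
  then show ?thesis using distinct_map by blast
qed

lemma swap_AOP:
  assumes \<sigma>: "\<sigma> \<in> AOP n m" and j: "1 \<le> j" "j + 1 \<le> m"
  shows "swap_adjacent j \<sigma> \<in> AOP n m"
proof -
  let ?t = "adj_swap j"
  let ?map = "map (map (image ?t)) \<sigma>"
  have as: "assembly m \<sigma>" using \<sigma> by (simp add: AOP_def)
  have inj: "inj ?t" by (rule inj_transpose)
  have sup: "support (map (image ?t) \<eta>) = ?t ` support \<eta>" for \<eta>
    by (auto simp: support_def)
  have perm: "?t ` {1..m} = {1..m}" using j by (intro transpose_image_eq) auto
  have swap_eq: "swap_adjacent j \<sigma> = sort_key (\<lambda>\<eta>. Min (support \<eta>)) ?map"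
    by (simp add: swap_adjacent_def)
  have "assembly m (swap_adjacent j \<sigma>)"
    unfolding swap_eq
  proof (rule assembly_sort)
    fix \<eta> assume "\<eta> \<in> set ?map"
    then obtain \<theta> where \<theta>: "\<theta> \<in> set \<sigma>" "\<eta> = map (image ?t) \<theta>" by auto
    have "disjnt (?t ` X) (?t ` Y) \<longleftrightarrow> disjnt X Y" for X Y
      unfolding disjnt_def image_Int[OF inj, symmetric] by simp
    then show "ordered_partition \<eta>"
      using assembly_entries(1,2)[OF as \<theta>(1)] by (auto simp: ordered_partition_def \<theta>(2) sorted_wrt_map)
  next
    have "support ` set ?map = image ?t ` (support ` set \<sigma>)" by (auto simp: sup image_image)
    moreover have part: "partition_on {1..m} (support ` set \<sigma>)" using as by (simp add: assembly_def)
    have "inj_on ?t {1..m}" using inj by (rule inj_on_subset) simp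
    from partition_on_inj_image[OF part this]
    have "partition_on (?t ` {1..m}) (image ?t ` (support ` set \<sigma>) - {{}})" .
    moreover have "{} \<notin> image ?t ` (support ` set \<sigma>)" using partition_onD3[OF part] by blast
    ultimately show "partition_on {1..m} (support ` set ?map)" using perm by simp
  next
    have "inj_on (image ?t) (set (map support \<sigma>))" by (rule inj_onI) (simp only: inj_image_eq_iff[OF inj])
    then have "distinct (map (image ?t) (map support \<sigma>))"
      using assembly_distinct_support[OF as] by (simp only: distinct_map)
    then show "distinct (map support ?map)" by (simp add: comp_def sup)
  qed
  moreover have "(\<Sum>\<eta>\<leftarrow>swap_adjacent j \<sigma>. length \<eta>) = (\<Sum>\<eta>\<leftarrow>\<sigma>. length \<eta>)"
    unfolding swap_adjacent_def sum_list_length_sort by (simp add: comp_def)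
  ultimately show ?thesis using \<sigma> by (simp add: AOP_def swap_adjacent_def)
qed

section \<open>Recovering an assembly from its matrix up to reversals\<close>

lemma unit_step_injective:
  fixes q :: "nat \<Rightarrow> nat"
  assumes step: "\<And>i. Suc i < r \<Longrightarrow> q (Suc i) = q i + 1 \<or> q i = q (Suc i) + 1"
    and inj: "inj_on q {..<r}"
  shows "(\<forall>i<r. q i = q 0 + i) \<or> (\<forall>i<r. q i + i = q 0)"
proof -
  \<comment> \<open>The descending case is written as a sum to avoid truncated subtraction.\<close>
  have "(\<forall>i<p. q i = q 0 + i) \<or> (\<forall>i<p. q i + i = q 0)" if "p \<le> r" for p
    using that
  proof (induction p)
    case (Suc p)
    show ?case
    proof (cases "p < 2")
      case True
      then have "p = 0 \<or> p = 1" by auto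
      then show ?thesis using step[of 0] Suc.prems by (auto simp: less_Suc_eq)
    next
      case False
      then obtain k where k: "p = Suc (Suc k)" by (metis add_2_eq_Suc le_Suc_ex not_less)
      have st: "q p = q (Suc k) + 1 \<or> q (Suc k) = q p + 1" using step[of "Suc k"] k Suc.prems by simp
      \<comment> \<open>A walk with unit steps that turned around here would revisit
        \<open>q k\<close>.\<close>
      have ne: "q p \<noteq> q k" using inj_onD[OF inj, of p k] k Suc.prems by auto
      from Suc.IH Suc.prems have "(\<forall>i<p. q i = q 0 + i) \<or> (\<forall>i<p. q i + i = q 0)" by simp
      then show ?thesis
      proof
        assume a: "\<forall>i<p. q i = q 0 + i"
        then have "q k = q 0 + k" "q (Suc k) = q 0 + Suc k" using k by (blast intro: lessI less_SucI)+
        then have "q p = q 0 + p" using st ne k by linarith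
        then have "\<forall>i<Suc p. q i = q 0 + i" using a less_Suc_eq by metis
        then show ?thesis ..
      next
        assume a: "\<forall>i<p. q i + i = q 0"
        then have "q k + k = q 0" "q (Suc k) + Suc k = q 0" using k by (blast intro: lessI less_SucI)+
        then have "q p + p = q 0" using st ne k by linarith
        then have "\<forall>i<Suc p. q i + i = q 0" using a less_Suc_eq by metis
        then show ?thesis ..
      qed
    qed
  qed simp
  then show ?thesis by blast
qed

text \<open>Pick one element from each block of \<eta>. Elements of consecutive blocks are
  neighbors, so all of them lie in one ordered partition \<theta> of \<tau>, and their positions
  there form an injective walk with unit steps, which is monotone.\<close>

lemma entries_embed:
  assumes \<sigma>: "assembly m \<sigma>" and \<tau>: "assembly m \<tau>"
    and same: "\<And>x y. x \<in> {1..m} \<Longrightarrow> y \<in> {1..m} \<Longrightarrow> same_block \<sigma> x y \<longleftrightarrow> same_block \<tau> x y"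
    and neigh: "\<And>x y. x \<in> {1..m} \<Longrightarrow> y \<in> {1..m} \<Longrightarrow> neighbors \<sigma> x y \<longleftrightarrow> neighbors \<tau> x y"
    and \<eta>: "\<eta> \<in> set \<sigma>"
  shows "\<exists>\<theta>\<in>set \<tau>. \<exists>q. length \<eta> \<le> length \<theta> \<and> (\<forall>i<length \<eta>. q i < length \<theta> \<and> \<eta> ! i = \<theta> ! q i) \<and>
    ((\<forall>i<length \<eta>. q i = q 0 + i) \<or> (\<forall>i<length \<eta>. q i + i = q 0))"
proof -
  let ?r = "length \<eta>"
  have nonempty: "\<eta> ! i \<noteq> {}" and range: "\<eta> ! i \<subseteq> {1..m}" if "i < ?r" for i
    using that assembly_entries[OF \<sigma> \<eta>] block_support[of i \<eta>] nth_mem[of i \<eta>] by (metis, blast)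
  define x where "x i = (SOME x. x \<in> \<eta> ! i)" for i
  have x: "x i \<in> \<eta> ! i" "x i \<in> {1..m}" if "i < ?r" for i
    using nonempty[OF that] range[OF that] some_in_eq[of "\<eta> ! i"] unfolding x_def by auto
  have x_ne: "x i \<noteq> x j" if "i < ?r" "j < ?r" "i \<noteq> j" for i j
    using assembly_block_unique[OF \<sigma> \<eta> that(1,2)] x that by metis
  have r0: "0 < ?r" using assembly_entries(4)[OF \<sigma> \<eta>] by (auto simp: support_def)
  obtain \<theta> b0 where \<theta>: "\<theta> \<in> set \<tau>" and b0: "b0 < length \<theta>" "x 0 \<in> \<theta> ! b0"
    using assembly_cover[OF \<tau> x(2)[OF r0]] by blast
  have nb: "neighbors \<tau> (x (Suc i)) (x i)" if "Suc i < ?r" for i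
  proof -
    have "neighbors \<sigma> (x (Suc i)) (x i)"
      unfolding neighbors_def using \<eta> that x(1)[of i] x(1)[of "Suc i"] x_ne[of "Suc i" i]
      by (intro conjI bexI[of _ \<eta>] exI[of _ i] exI[of _ "Suc i"]) auto
    then show ?thesis using neigh[OF x(2)[OF that] x(2)[of i]] that by simp
  qed
  have ex: "\<exists>b<length \<theta>. x i \<in> \<theta> ! b" if "i < ?r" for i
    using that
  proof (induction i)
    case (Suc i)
    then obtain b where "b < length \<theta>" "x i \<in> \<theta> ! b" by auto
    then show ?case
      using assembly_neighbors_iff[OF \<tau> \<theta>, of b "x i" "x (Suc i)"] nb[OF Suc.prems]
        x_ne[of i "Suc i"] Suc.prems by auto
  qed (use b0 in blast)
  then obtain q where q: "\<And>i. i < ?r \<Longrightarrow> q i < length \<theta> \<and> x i \<in> \<theta> ! q i" by metis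
  have block: "\<eta> ! i = \<theta> ! q i" if i: "i < ?r" for i
  proof -
    have "q i < length \<theta>" using q[OF i] by simp
    then have "\<theta> ! q i \<subseteq> {1..m}" using block_support assembly_entries(3)[OF \<tau> \<theta>] by blast
    moreover have "y \<in> \<eta> ! i \<longleftrightarrow> y \<in> \<theta> ! q i" if "y \<in> {1..m}" for y
      using assembly_same_block_iff[OF \<sigma> \<eta> i x(1)[OF i], of y]
        assembly_same_block_iff[OF \<tau> \<theta> _ conjunct2[OF q[OF i]], of y]
        same[OF x(2)[OF i] that] q[OF i] by blast
    ultimately show ?thesis using range[OF i] by blast
  qed
  have inj: "inj_on q {..<?r}"
  proof (rule inj_onI)
    fix i j assume "i \<in> {..<?r}" "j \<in> {..<?r}" "q i = q j"
    then have "\<eta> ! i = \<eta> ! j" "i < ?r" "j < ?r" using block by auto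
    then show "i = j" using assembly_block_unique[OF \<sigma> \<eta>, of i j "x i"] x(1)[of i] by simp
  qed
  have "q (Suc i) = q i + 1 \<or> q i = q (Suc i) + 1" if i: "Suc i < ?r" for i
  proof -
    have i': "i < ?r" using i by simp
    have qi: "q i < length \<theta>" "x i \<in> \<theta> ! q i" "q (Suc i) < length \<theta>" "x (Suc i) \<in> \<theta> ! q (Suc i)"
      using q[OF i] q[OF i'] by auto
    obtain c where c: "c < length \<theta>" "c + 1 = q i \<or> c = q i \<or> c = q i + 1" "x (Suc i) \<in> \<theta> ! c"
      using assembly_neighbors_iff[OF \<tau> \<theta> qi(1,2), of "x (Suc i)"] nb[OF i] x_ne[OF i' i] by auto
    have "c = q (Suc i)" by (rule assembly_block_unique[OF \<tau> \<theta> c(1) qi(3) c(3) qi(4)])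
    moreover have "q i \<noteq> q (Suc i)" using inj_onD[OF inj, of i "Suc i"] i by auto
    ultimately show ?thesis using c(2) by auto
  qed
  from unit_step_injective[OF this inj]
  have "(\<forall>i<?r. q i = q 0 + i) \<or> (\<forall>i<?r. q i + i = q 0)" by blast
  moreover have "?r \<le> length \<theta>"
    using card_inj_on_le[OF inj, of "{..<length \<theta>}"] q by auto
  ultimately show ?thesis using \<theta> q block by blast
qed

text \<open>Embedding \<eta> into \<theta> and \<theta> back into \<sigma> returns to \<eta>, since
  ordered partitions of \<sigma> with a common element coincide. So the lengths agree and \<eta>
  fills all of \<theta>.\<close>

lemma entries_reversal:
  assumes \<sigma>: "assembly m \<sigma>" and \<tau>: "assembly m \<tau>"
    and same: "\<And>x y. x \<in> {1..m} \<Longrightarrow> y \<in> {1..m} \<Longrightarrow> same_block \<sigma> x y \<longleftrightarrow> same_block \<tau> x y"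
    and neigh: "\<And>x y. x \<in> {1..m} \<Longrightarrow> y \<in> {1..m} \<Longrightarrow> neighbors \<sigma> x y \<longleftrightarrow> neighbors \<tau> x y"
    and \<eta>: "\<eta> \<in> set \<sigma>"
  shows "\<exists>\<theta>\<in>set \<tau>. \<theta> = \<eta> \<or> \<theta> = rev \<eta>"
proof -
  let ?r = "length \<eta>"
  obtain \<theta> q where \<theta>: "\<theta> \<in> set \<tau>" and q: "\<forall>i<?r. q i < length \<theta> \<and> \<eta> ! i = \<theta> ! q i"
    and mono: "(\<forall>i<?r. q i = q 0 + i) \<or> (\<forall>i<?r. q i + i = q 0)" and le: "?r \<le> length \<theta>"
    using entries_embed[OF \<sigma> \<tau> same neigh \<eta>] by blast
  obtain \<eta>' q' where \<eta>': "\<eta>' \<in> set \<sigma>" and q': "\<forall>i<length \<theta>. q' i < length \<eta>' \<and> \<theta> ! i = \<eta>' ! q' i"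
    and le': "length \<theta> \<le> length \<eta>'"
    using entries_embed[OF \<tau> \<sigma> same[symmetric] neigh[symmetric] \<theta>] by blast
  have r0: "0 < ?r" using assembly_entries(4)[OF \<sigma> \<eta>] by (auto simp: support_def)
  have "\<eta> ! 0 \<noteq> {}" using assembly_entries(1)[OF \<sigma> \<eta>] r0 by (metis nth_mem)
  then obtain x where x: "x \<in> \<eta> ! 0" by blast
  have "\<eta> ! 0 = \<eta>' ! q' (q 0)" "q' (q 0) < length \<eta>'" using q q' r0 by auto
  then have "\<eta> = \<eta>'"
    using assembly_unique[OF \<sigma> \<eta> \<eta>', of x] x block_support[OF r0] block_support[of "q' (q 0)" \<eta>'] by auto
  have len: "length \<theta> = ?r" using le le' \<open>\<eta> = \<eta>'\<close> by simp
  \<comment> \<open>With equal lengths an ascending walk must start at 0 and a descending one at the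
    last index \<open>l\<close>.\<close>
  obtain l where l: "?r = Suc l" using r0 by (cases "length \<eta>") auto
  from mono have "\<theta> = \<eta> \<or> \<theta> = rev \<eta>"
  proof
    assume a: "\<forall>i<?r. q i = q 0 + i"
    then have "q l = q 0 + l" using l lessI by metis
    moreover have "q l < ?r" using q l len by auto
    ultimately have "q l = q 0 + l" "q l < ?r" .
    then have "q 0 = 0" using l by simp
    then have "\<theta> ! i = \<eta> ! i" if "i < ?r" for i using a q that by (metis add_0)
    then show ?thesis using len nth_equalityI by metis
  next
    assume a: "\<forall>i<?r. q i + i = q 0"
    then have "q l + l = q 0" using l lessI by metis
    moreover have "q 0 < ?r" using q r0 len by auto
    ultimately have "q l + l = q 0" "q 0 < ?r" .
    then have q0: "q 0 = l" using l by simp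
    have "\<theta> ! i = rev \<eta> ! i" if i: "i < length \<theta>" for i
    proof -
      have "l - i < ?r" using l by simp
      then have "q (l - i) + (l - i) = l" using a q0 by metis
      then have "q (l - i) = i" using i len l by simp
      moreover have "\<eta> ! (l - i) = \<theta> ! q (l - i)" using q l by auto
      ultimately show ?thesis using i len l by (simp add: rev_nth)
    qed
    then show ?thesis using len nth_equalityI[of \<theta> "rev \<eta>"] by simp
  qed
  then show ?thesis using \<theta> by blast
qed

text \<open>Reversal preserves supports, so both lists have the same set of minima; as both are
  sorted by minima, they match position by position.\<close>

lemma entries_imp_reversal_equiv:
  assumes \<sigma>: "assembly m \<sigma>" and \<tau>: "assembly m \<tau>"
    and eq: "\<And>j k. j \<in> {1..m} \<Longrightarrow> k \<in> {1..m} \<Longrightarrow> entry \<sigma> j k = entry \<tau> j k"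
  shows "reversal_equiv \<sigma> \<tau>"
proof -
  let ?key = "\<lambda>\<eta>. Min (support \<eta>)"
  have same: "same_block \<sigma> x y \<longleftrightarrow> same_block \<tau> x y"
    and neigh: "neighbors \<sigma> x y \<longleftrightarrow> neighbors \<tau> x y" if xy: "x \<in> {1..m}" "y \<in> {1..m}" for x y
  proof -
    \<comment> \<open>An entry below the diagonal determines both relations, as -2, 1 and 0 are
      distinct and members of a block are neighbors. The remaining pairs follow by symmetry.\<close>
    have *: "(same_block \<sigma> x y \<longleftrightarrow> same_block \<tau> x y) \<and> (neighbors \<sigma> x y \<longleftrightarrow> neighbors \<tau> x y)"
      if "y < x" "x \<in> {1..m}" "y \<in> {1..m}" for x y
      using eq[OF that(2,3)] that(1) same_block_imp_neighbors[of \<sigma> x y] same_block_imp_neighbors[of \<tau> x y]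
      by (auto simp: entry_def split: if_splits)
    have "same_block \<rho> x x" if "assembly m \<rho>" for \<rho>
      using assembly_cover[OF that xy(1)] unfolding same_block_def by blast
    moreover have "\<not> neighbors \<rho> x x" for \<rho> by (simp add: neighbors_def)
    ultimately have "(same_block \<sigma> x y \<longleftrightarrow> same_block \<tau> x y) \<and> (neighbors \<sigma> x y \<longleftrightarrow> neighbors \<tau> x y)"
      using *[of y x] *[of x y] xy \<sigma> \<tau> same_block_sym neighbors_sym by (metis linorder_neqE_nat)
    then show "same_block \<sigma> x y \<longleftrightarrow> same_block \<tau> x y" "neighbors \<sigma> x y \<longleftrightarrow> neighbors \<tau> x y" by auto
  qed
  have sup_rev: "support (rev \<eta>) = support \<eta>" for \<eta> by (simp add: support_def)
  have fwd: "\<exists>\<theta>\<in>set \<tau>. \<theta> = \<eta> \<or> \<theta> = rev \<eta>" if "\<eta> \<in> set \<sigma>" for \<eta>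
    by (rule entries_reversal[OF \<sigma> \<tau> same neigh that])
  have bwd: "\<exists>\<eta>\<in>set \<sigma>. \<eta> = \<theta> \<or> \<eta> = rev \<theta>" if "\<theta> \<in> set \<tau>" for \<theta>
    by (rule entries_reversal[OF \<tau> \<sigma> same[symmetric] neigh[symmetric] that])
  have key_rev: "?key \<eta> = ?key \<theta>" if "\<theta> = \<eta> \<or> \<theta> = rev \<eta>" for \<eta> \<theta> using that sup_rev by auto
  have "?key \<eta> \<in> ?key ` set \<tau>" if "\<eta> \<in> set \<sigma>" for \<eta> using fwd[OF that] key_rev by blast
  moreover have "?key \<theta> \<in> ?key ` set \<sigma>" if "\<theta> \<in> set \<tau>" for \<theta> using bwd[OF that] key_rev by blast
  ultimately have "set (map ?key \<sigma>) = set (map ?key \<tau>)" by auto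
  moreover have sorted: "sorted_wrt (<) (map ?key \<sigma>)" "sorted_wrt (<) (map ?key \<tau>)"
    using \<sigma> \<tau> by (auto simp: assembly_def)
  ultimately have keys: "map ?key \<sigma> = map ?key \<tau>" using strict_sorted_equal by blast
  then have len: "length \<sigma> = length \<tau>" using map_eq_imp_length_eq by blast
  have inj: "inj_on ?key (set \<tau>)" using sorted(2) by (simp add: strict_sorted_iff distinct_map)
  have "\<tau> ! i = \<sigma> ! i \<or> \<tau> ! i = rev (\<sigma> ! i)" if i: "i < length \<sigma>" for i
  proof -
    obtain \<theta> where \<theta>: "\<theta> \<in> set \<tau>" "\<theta> = \<sigma> ! i \<or> \<theta> = rev (\<sigma> ! i)" using fwd[of "\<sigma> ! i"] i by auto
    have "?key \<theta> = ?key (\<sigma> ! i)" using \<theta>(2) sup_rev by auto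
    also have "\<dots> = ?key (\<tau> ! i)" using arg_cong[OF keys, of "\<lambda>l. l ! i"] i len by simp
    finally have "\<theta> = \<tau> ! i" using inj_onD[OF inj _ \<theta>(1)] i len by simp
    then show ?thesis using \<theta>(2) by simp
  qed
  then show ?thesis using len by (simp add: reversal_equiv_def list_all2_conv_all_nth)
qed

section \<open>Conjugate matrices and chains of admissible swaps\<close>

definition perm_equiv :: "nat \<Rightarrow> nat set list list \<Rightarrow> nat set list list \<Rightarrow> bool" where
  "perm_equiv m \<sigma> \<tau> \<longleftrightarrow> (\<exists>\<pi>. bij_betw \<pi> {..<m} {..<m} \<and>
     (\<forall>j<m. \<forall>k<m. entry \<sigma> (Suc j) (Suc k) = entry \<tau> (Suc (\<pi> j)) (Suc (\<pi> k))))"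

definition swap_step :: "nat \<Rightarrow> nat set list list \<Rightarrow> nat set list list \<Rightarrow> bool" where
  "swap_step m \<sigma> \<tau> \<longleftrightarrow> (\<exists>j. admissible m j \<sigma> \<and> swap_adjacent j \<sigma> = \<tau>)"

lemma swap_step_AOP: "swap_step m \<sigma> \<tau> \<Longrightarrow> \<sigma> \<in> AOP n m \<Longrightarrow> \<tau> \<in> AOP n m"
  unfolding swap_step_def admissible_def using swap_AOP by blast

lemma perm_equiv_refl: "perm_equiv m \<sigma> \<sigma>"
  unfolding perm_equiv_def by (intro exI[of _ id]) auto

lemma perm_equiv_trans:
  assumes "perm_equiv m \<sigma> \<tau>" "perm_equiv m \<tau> \<rho>" shows "perm_equiv m \<sigma> \<rho>"
proof -
  obtain \<pi> \<kappa> where \<pi>: "bij_betw \<pi> {..<m} {..<m}" and \<kappa>: "bij_betw \<kappa> {..<m} {..<m}"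
    and e: "\<forall>j<m. \<forall>k<m. entry \<sigma> (Suc j) (Suc k) = entry \<tau> (Suc (\<pi> j)) (Suc (\<pi> k))"
    and f: "\<forall>j<m. \<forall>k<m. entry \<tau> (Suc j) (Suc k) = entry \<rho> (Suc (\<kappa> j)) (Suc (\<kappa> k))"
    using assms unfolding perm_equiv_def by blast
  have "\<pi> j < m" if "j < m" for j using \<pi> that by (auto simp: bij_betw_def)
  then show ?thesis
    unfolding perm_equiv_def using bij_betw_trans[OF \<pi> \<kappa>] e f by (intro exI[of _ "\<kappa> \<circ> \<pi>"]) simp
qed

lemma perm_equiv_sym:
  assumes "perm_equiv m \<sigma> \<tau>" shows "perm_equiv m \<tau> \<sigma>"
proof -
  obtain \<pi> where \<pi>: "bij_betw \<pi> {..<m} {..<m}"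
    and e: "\<forall>j<m. \<forall>k<m. entry \<sigma> (Suc j) (Suc k) = entry \<tau> (Suc (\<pi> j)) (Suc (\<pi> k))"
    using assms unfolding perm_equiv_def by blast
  define \<kappa> where "\<kappa> = the_inv_into {..<m} \<pi>"
  have \<kappa>: "bij_betw \<kappa> {..<m} {..<m}" unfolding \<kappa>_def by (rule bij_betw_the_inv_into[OF \<pi>])
  have "\<pi> (\<kappa> j) = j" "\<kappa> j < m" if "j < m" for j
    using f_the_inv_into_f_bij_betw[OF \<pi>, of j] \<kappa> that by (auto simp: \<kappa>_def bij_betw_def)
  then show ?thesis unfolding perm_equiv_def using \<kappa> e by (intro exI[of _ \<kappa>]) simp
qed

lemma transpose_bij: "i < m \<Longrightarrow> j < m \<Longrightarrow> bij_betw (Transposition.transpose i j) {..<m} {..<m}"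
  by (rule bij_betw_byWitness[where f' = "Transposition.transpose i j"])
    (auto simp: Transposition.transpose_def)

lemma transpose_Suc: "Transposition.transpose (Suc i) (Suc j) (Suc k) = Suc (Transposition.transpose i j k)"
  by (simp add: Transposition.transpose_def)

lemma swap_step_perm_equiv:
  assumes "swap_step m \<sigma> \<tau>" shows "perm_equiv m \<sigma> \<tau>"
proof -
  obtain j where j: "admissible m j \<sigma>" "swap_adjacent j \<sigma> = \<tau>" using assms by (auto simp: swap_step_def)
  then obtain i where i: "j = Suc i" "Suc i < m" by (cases j) (auto simp: admissible_def)
  have "\<not> neighbors \<sigma> (Suc i) (Suc i + 1)" using j i by (simp add: admissible_def)
  then have "entry \<tau> (Suc (adj_swap i a)) (Suc (adj_swap i b)) =
      entry \<sigma> (Suc a) (Suc b)" for a b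
    unfolding transpose_Suc[symmetric] j(2)[symmetric] i(1) by (rule swap_entry)
  then show ?thesis unfolding perm_equiv_def using transpose_bij[of i m "Suc i"] i(2) by fastforce
qed

lemma swap_steps_perm_equiv: "(swap_step m)\<^sup>*\<^sup>* \<sigma> \<tau> \<Longrightarrow> perm_equiv m \<sigma> \<tau>"
  by (induction rule: rtranclp_induct)
    (auto intro: perm_equiv_refl perm_equiv_trans swap_step_perm_equiv)

text \<open>Without descents \<pi> increases strictly; counting up from 0 gives
  \<open>k \<le> \<pi> k\<close>, and counting down from the top gives the other inequality.\<close>

lemma ascending_perm_id:
  fixes \<pi> :: "nat \<Rightarrow> nat"
  assumes \<pi>: "bij_betw \<pi> {..<m} {..<m}" and asc: "\<And>i. Suc i < m \<Longrightarrow> \<pi> i \<le> \<pi> (Suc i)" and k: "k < m"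
  shows "\<pi> k = k"
proof -
  have strict: "\<pi> i < \<pi> (Suc i)" if "Suc i < m" for i
    using asc[OF that] bij_betw_imp_inj_on[OF \<pi>] that by (metis Suc_lessD inj_onD lessThan_iff n_not_Suc_n order_less_le)
  have lower: "i \<le> \<pi> i" if "i < m" for i
    using that by (induction i) (auto dest!: strict)
  have upper: "\<pi> i + (m - Suc i) < m" if "i < m" for i
  proof -
    have "\<pi> (m - Suc d) + d < m" if "d < m" for d
      using that
    proof (induction d)
      case 0
      then show ?case using \<pi> by (auto simp: bij_betw_def)
    next
      case (Suc d)
      then have "\<pi> (m - Suc (Suc d)) < \<pi> (Suc (m - Suc (Suc d)))" by (intro strict) simp
      moreover have "Suc (m - Suc (Suc d)) = m - Suc d" using Suc.prems by simp
      ultimately show ?case using Suc by simp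
    qed
    from this[of "m - Suc i"] show ?thesis using that by simp
  qed
  show ?thesis using lower[OF k] upper[OF k] k by simp
qed

text \<open>Bubble sort: exchanging an adjacent descent of the permutation increases the sum over
  \<open>k * \<pi> k\<close>. The exchange is admissible because the entry at the descent lies above the diagonal
  of the target matrix.\<close>

lemma perm_equiv_swap_steps:
  assumes "\<sigma> \<in> AOP n m" "\<tau> \<in> AOP n m" "perm_equiv m \<sigma> \<tau>"
  shows "\<exists>\<rho>. (swap_step m)\<^sup>*\<^sup>* \<sigma> \<rho> \<and> reversal_equiv \<rho> \<tau>"
proof -
  have *: "\<exists>\<rho>. (swap_step m)\<^sup>*\<^sup>* \<sigma> \<rho> \<and> reversal_equiv \<rho> \<tau>"
    if "\<sigma> \<in> AOP n m" "bij_betw \<pi> {..<m} {..<m}"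
      "\<forall>j<m. \<forall>k<m. entry \<sigma> (Suc j) (Suc k) = entry \<tau> (Suc (\<pi> j)) (Suc (\<pi> k))" for \<sigma> \<pi>
    using that
  \<comment> \<open>All factors are below \<open>m\<close>, so the cube of \<open>m\<close> bounds
    the sum and the difference measures how far sorting has progressed.\<close>
  proof (induction "m * (m * m) - (\<Sum>k<m. k * \<pi> k)" arbitrary: \<sigma> \<pi> rule: less_induct)
    case less
    note \<sigma> = less.prems(1) and \<pi> = less.prems(2) and ent = less.prems(3)
    have lt: "\<pi> k < m" if "k < m" for k using \<pi> that by (auto simp: bij_betw_def)
    show ?case
    proof (cases "\<exists>i. Suc i < m \<and> \<pi> (Suc i) < \<pi> i")
      case False
      \<comment> \<open>No descent is left, so the matrices are equal and determine the assembly up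
        to reversals.\<close>
      then have id: "\<pi> k = k" if "k < m" for k using ascending_perm_id[OF \<pi> _ that] by (meson not_less)
      have "entry \<sigma> j k = entry \<tau> j k" if "j \<in> {1..m}" "k \<in> {1..m}" for j k
      proof -
        obtain j' k' where "j = Suc j'" "k = Suc k'" "j' < m" "k' < m"
          using \<open>j \<in> _\<close> \<open>k \<in> _\<close> by (cases j; cases k) auto
        then show ?thesis using ent id by simp
      qed
      then have "reversal_equiv \<sigma> \<tau>"
        using entries_imp_reversal_equiv[of m \<sigma> \<tau>] \<sigma> assms(2) by (simp add: AOP_def)
      then show ?thesis by blast
    next
      case True
      then obtain i where i: "Suc i < m" "\<pi> (Suc i) < \<pi> i" by blast
      let ?t = "adj_swap i"
      have t: "bij_betw ?t {..<m} {..<m}" by (rule transpose_bij) (use i in auto)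
      have "entry \<sigma> (Suc (Suc i)) (Suc i) = entry \<tau> (Suc (\<pi> (Suc i))) (Suc (\<pi> i))" using ent i by simp
      also have "\<dots> = 0" using i(2) by (simp add: entry_def)
      finally have "entry \<sigma> (Suc (Suc i)) (Suc i) = 0" .
      then have nn: "\<not> neighbors \<sigma> (Suc i) (Suc i + 1)"
        using entry_zero_iff[of "Suc i" "Suc (Suc i)" \<sigma>] neighbors_sym by auto
      define \<sigma>' where "\<sigma>' = swap_adjacent (Suc i) \<sigma>"
      have step: "swap_step m \<sigma> \<sigma>'"
        unfolding swap_step_def \<sigma>'_def admissible_def using nn i by (intro exI[of _ "Suc i"]) simp
      have ent_t: "entry \<sigma>' (Suc (?t a)) (Suc (?t b)) = entry \<sigma> (Suc a) (Suc b)" for a b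
        unfolding transpose_Suc[symmetric] \<sigma>'_def by (rule swap_entry[OF nn])
      have ent': "entry \<sigma>' (Suc a) (Suc b) = entry \<tau> (Suc ((\<pi> \<circ> ?t) a)) (Suc ((\<pi> \<circ> ?t) b))"
        if "a < m" "b < m" for a b
      proof -
        have "?t a < m" "?t b < m" using t that by (auto simp: bij_betw_def)
        then show ?thesis using ent_t[of "?t a" "?t b"] ent by simp
      qed
      have sum_eq: "(\<Sum>k<m. k * f k) = i * f i + Suc i * f (Suc i) + (\<Sum>k\<in>{..<m} - {i} - {Suc i}. k * f k)"
        for f :: "nat \<Rightarrow> nat"
        using i by (simp add: sum.remove[of "{..<m}" i] sum.remove[of "{..<m} - {i}" "Suc i"])
      have rest: "(\<Sum>k\<in>{..<m} - {i} - {Suc i}. k * (\<pi> \<circ> ?t) k) = (\<Sum>k\<in>{..<m} - {i} - {Suc i}. k * \<pi> k)"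
        by (rule sum.cong) (auto simp: Transposition.transpose_def)
      \<comment> \<open>Only the terms at \<open>i\<close> and \<open>Suc i\<close> change, and
        together they grow by \<open>\<pi> i - \<pi> (Suc i)\<close>.\<close>
      have "(\<Sum>k<m. k * \<pi> k) < (\<Sum>k<m. k * (\<pi> \<circ> ?t) k)"
        unfolding sum_eq rest using i(2) by simp
      moreover have "(\<Sum>k<m. k * (\<pi> \<circ> ?t) k) \<le> (\<Sum>k<m. m * m)"
      proof (rule sum_mono)
        fix k assume "k \<in> {..<m}"
        then have "?t k < m" using t by (auto simp: bij_betw_def)
        then show "k * (\<pi> \<circ> ?t) k \<le> m * m" using lt[of "?t k"] \<open>k \<in> _\<close> by (intro mult_le_mono) auto
      qed
      ultimately have "m * (m * m) - (\<Sum>k<m. k * (\<pi> \<circ> ?t) k) < m * (m * m) - (\<Sum>k<m. k * \<pi> k)"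
        by simp
      moreover have "\<sigma>' \<in> AOP n m" by (rule swap_step_AOP[OF step \<sigma>])
      moreover have "bij_betw (\<pi> \<circ> ?t) {..<m} {..<m}" by (rule bij_betw_trans[OF t \<pi>])
      ultimately obtain \<rho> where "(swap_step m)\<^sup>*\<^sup>* \<sigma>' \<rho>" "reversal_equiv \<rho> \<tau>"
        using less.hyps ent' by blast
      then show ?thesis using step by (meson converse_rtranclp_into_rtranclp)
    qed
  qed
  show ?thesis using assms(3) *[OF assms(1)] unfolding perm_equiv_def by blast
qed

text \<open>The definition allows reversals only at the two ends of a chain, so transitivity is not
  visible in it. Matrices make it visible: reversals fix the matrix and swaps conjugate it;
  conversely, conjugate matrices are connected by swaps followed by reversals at the end.\<close>

lemma approx_rel_iff:
  "(\<sigma>, \<tau>) \<in> approx_rel n m \<longleftrightarrow> \<sigma> \<in> AOP n m \<and> \<tau> \<in> AOP n m \<and> perm_equiv m \<sigma> \<tau>"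
proof
  assume "(\<sigma>, \<tau>) \<in> approx_rel n m"
  then obtain k and \<rho> :: "nat \<Rightarrow> nat set list list" where AOP: "\<sigma> \<in> AOP n m" "\<tau> \<in> AOP n m"
    and ends: "reversal_equiv (\<rho> 0) \<sigma>" "reversal_equiv (\<rho> k) \<tau>"
    and steps: "\<forall>i\<in>{1..k}. \<exists>j. admissible m j (\<rho> (i - 1)) \<and> swap_adjacent j (\<rho> (i - 1)) = \<rho> i"
    unfolding approx_rel_def by blast
  have "(swap_step m)\<^sup>*\<^sup>* (\<rho> 0) (\<rho> i)" if "i \<le> k" for i
    using that
  proof (induction i)
    case (Suc i)
    have "swap_step m (\<rho> i) (\<rho> (Suc i))" using bspec[OF steps, of "Suc i"] Suc.prems by (simp add: swap_step_def)
    then show ?case using Suc by (meson Suc_leD rtranclp.rtrancl_into_rtrancl)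
  qed simp
  then have "perm_equiv m (\<rho> 0) (\<rho> k)" using swap_steps_perm_equiv by blast
  moreover have "perm_equiv m (\<rho> 0) (\<rho> k) \<longleftrightarrow> perm_equiv m \<sigma> \<tau>"
    unfolding perm_equiv_def reversal_entry[OF ends(1)] reversal_entry[OF ends(2)] ..
  ultimately show "\<sigma> \<in> AOP n m \<and> \<tau> \<in> AOP n m \<and> perm_equiv m \<sigma> \<tau>" using AOP by simp
next
  assume a: "\<sigma> \<in> AOP n m \<and> \<tau> \<in> AOP n m \<and> perm_equiv m \<sigma> \<tau>"
  then obtain \<rho> where \<rho>: "(swap_step m)\<^sup>*\<^sup>* \<sigma> \<rho>" "reversal_equiv \<rho> \<tau>" using perm_equiv_swap_steps by blast
  have "\<exists>(k :: nat) f. f 0 = \<sigma> \<and> f k = \<rho> \<and> (\<forall>i\<le>k. f i \<in> AOP n m) \<and> (\<forall>i\<in>{1..k}. swap_step m (f (i - 1)) (f i))"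
    using \<rho>(1)
  proof (induction rule: rtranclp_induct)
    case base
    show ?case using a by (intro exI[of _ 0] exI[of _ "\<lambda>_. \<sigma>"]) auto
  next
    case (step \<rho> \<rho>')
    then obtain k :: nat and f where f: "f 0 = \<sigma>" "f k = \<rho>" "\<forall>i\<le>k. f i \<in> AOP n m"
      "\<forall>i\<in>{1..k}. swap_step m (f (i - 1)) (f i)" by blast
    define g where "g = f(Suc k := \<rho>')"
    have "\<rho>' \<in> AOP n m" using swap_step_AOP[OF step.hyps(2)] f by auto
    then have "\<forall>i\<le>Suc k. g i \<in> AOP n m" using f(3) by (simp add: g_def le_Suc_eq)
    moreover have "swap_step m (g (i - 1)) (g i)" if "i \<in> {1..Suc k}" for i
      using that f(2,4) step.hyps(2) by (cases "i = Suc k") (auto simp: g_def)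
    moreover have "g 0 = \<sigma>" "g (Suc k) = \<rho>'" using f(1) by (auto simp: g_def)
    ultimately show ?case by blast
  qed
  then obtain k :: nat and f where "f 0 = \<sigma>" "f k = \<rho>" "\<forall>i\<le>k. f i \<in> AOP n m"
    "\<forall>i\<in>{1..k}. swap_step m (f (i - 1)) (f i)" by blast
  then show "(\<sigma>, \<tau>) \<in> approx_rel n m"
    unfolding approx_rel_def using a \<rho>(2) reversal_equiv_refl
    by (auto simp: swap_step_def intro!: exI[of _ k] exI[of _ f])
qed

lemma approx_rel_equiv: "equiv (AOP n m) (approx_rel n m)"
proof (rule equivI)
  show "approx_rel n m \<subseteq> AOP n m \<times> AOP n m" by (auto simp: approx_rel_iff)
  show "refl_on (AOP n m) (approx_rel n m)" by (rule refl_onI) (simp add: approx_rel_iff perm_equiv_refl)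
  show "sym (approx_rel n m)" by (rule symI) (auto simp: approx_rel_iff intro: perm_equiv_sym)
  show "trans (approx_rel n m)" by (rule transI) (auto simp: approx_rel_iff intro: perm_equiv_trans)
qed

section \<open>Words and assemblies\<close>

text \<open>Words and assemblies are related through their matrices; either side may have several
  partners.\<close>

definition codes :: "nat \<Rightarrow> nat set list list \<Rightarrow> nat list \<Rightarrow> bool" where
  "codes m \<sigma> is \<longleftrightarrow> (\<forall>j<m. \<forall>k<m. bs_matrix is $$ (j, k) = entry \<sigma> (Suc j) (Suc k))"

text \<open>Members of one block count as neighbors, so being neighbors corresponds to letters at
  distance at most 1; two inequalities express this without truncated subtraction.\<close>

lemma codesI:
  assumes len: "length is = m"
    and same: "\<And>x y. x \<in> {1..m} \<Longrightarrow> y \<in> {1..m} \<Longrightarrow> same_block \<sigma> x y \<longleftrightarrow> is ! (x - 1) = is ! (y - 1)"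
    and neigh: "\<And>x y. x \<in> {1..m} \<Longrightarrow> y \<in> {1..m} \<Longrightarrow> x \<noteq> y \<Longrightarrow>
      neighbors \<sigma> x y \<longleftrightarrow> is ! (x - 1) \<le> is ! (y - 1) + 1 \<and> is ! (y - 1) \<le> is ! (x - 1) + 1"
  shows "codes m \<sigma> is"
proof -
  have "bs_matrix is $$ (j, k) = entry \<sigma> (Suc j) (Suc k)" if jk: "j < m" "k < m" for j k
  proof -
    have "Suc j \<in> {1..m}" "Suc k \<in> {1..m}" using jk by auto
    from same[OF this] neigh[OF this] show ?thesis
      using jk len by (auto simp: bs_matrix_def entry_def)
  qed
  then show ?thesis by (simp add: codes_def)
qed

text \<open>The word of an assembly lists its ordered partitions one after the other, leaving one letter
  unused between consecutive ones.\<close>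

lemma word_of_assembly:
  assumes \<sigma>: "\<sigma> \<in> AOP n m"
  shows "\<exists>is. length is = m \<and> set is \<subseteq> {1..n} \<and> codes m \<sigma> is"
proof -
  have as: "assembly m \<sigma>" and bound: "(\<Sum>\<eta>\<leftarrow>\<sigma>. length \<eta>) + (length \<sigma> - 1) \<le> n"
    using \<sigma> by (auto simp: AOP_def)
  have dist: "distinct \<sigma>" using assembly_distinct_support[OF as] distinct_map by blast
  have "\<exists>a b. a < length \<sigma> \<and> b < length (\<sigma> ! a) \<and> x \<in> \<sigma> ! a ! b" if "x \<in> {1..m}" for x
    using assembly_cover[OF as that] by (metis in_set_conv_nth)
  then obtain a b where ab: "\<And>x. x \<in> {1..m} \<Longrightarrow> a x < length \<sigma> \<and> b x < length (\<sigma> ! a x) \<and> x \<in> \<sigma> ! a x ! b x"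
    by metis
  have uniq: "a y = i \<and> b y = c"
    if y: "y \<in> {1..m}" and i: "i < length \<sigma>" "c < length (\<sigma> ! i)" "y \<in> \<sigma> ! i ! c" for y i c
  proof -
    have "\<sigma> ! a y = \<sigma> ! i"
      by (rule assembly_unique[OF as, of _ _ y]) (use ab[OF y] i block_support in \<open>auto dest: subsetD\<close>)
    then have "a y = i" using dist ab[OF y] i by (simp add: nth_eq_iff_index_eq)
    moreover have "b y = c"
      using assembly_block_unique[OF as, of "\<sigma> ! i" "b y" c y] ab[OF y] i \<open>a y = i\<close> by simp
    ultimately show ?thesis by simp
  qed
  \<comment> \<open>\<open>off i\<close> is the number of letters reserved before ordered partition
    \<open>i\<close>, each earlier one taken together with its gap.\<close>
  define off where "off i = (\<Sum>k<i. length (\<sigma> ! k) + 1)" for i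
  have off_mono: "off (Suc i) \<le> off i'" if "i < i'" for i i'
    unfolding off_def by (rule sum_mono2) (use that in auto)
  have off_Suc: "off (Suc i) = off i + length (\<sigma> ! i) + 1" for i by (simp add: off_def)
  define w where "w x = off (a x) + b x + 1" for x
  have w_pos: "1 \<le> w x" for x by (simp add: w_def)
  have w_le: "w x \<le> off (a x) + length (\<sigma> ! a x)" if "x \<in> {1..m}" for x
    using ab[OF that] by (simp add: w_def)
  \<comment> \<open>The gap keeps letters of different ordered partitions at distance at least 2, so
    their entries are 0.\<close>
  have far: "w x + 2 \<le> w y" if "x \<in> {1..m}" "a x < a y" for x y
    using w_le[OF that(1)] off_mono[OF that(2)] unfolding off_Suc by (simp add: w_def)
  have w_n: "w x \<le> n" if x: "x \<in> {1..m}" for x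
  proof -
    have ax: "a x < length \<sigma>" using ab[OF x] by simp
    \<comment> \<open>This total includes a gap behind the last ordered partition, one more than the
      bound of \<open>AOP\<close> counts; \<open>w x\<close> lies below the total by at least
      1.\<close>
    have "off (length \<sigma>) = (\<Sum>\<eta>\<leftarrow>\<sigma>. length \<eta>) + length \<sigma>"
      by (simp only: off_def sum.distrib) (simp add: sum_list_sum_nth atLeast0LessThan)
    then show ?thesis using w_le[OF x] off_mono[OF ax] bound ax unfolding off_Suc by linarith
  qed
  define is' where "is' = map w [1..<Suc m]"
  have nth: "is' ! (x - 1) = w x" if "x \<in> {1..m}" for x
    using that by (auto simp: is'_def nth_append simp del: upt_Suc)
  have "codes m \<sigma> is'"
  proof (rule codesI)
    fix x y assume x: "x \<in> {1..m}" and y: "y \<in> {1..m}"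
    have ax: "a x < length \<sigma>" "\<sigma> ! a x \<in> set \<sigma>" "b x < length (\<sigma> ! a x)" "x \<in> \<sigma> ! a x ! b x"
      using ab[OF x] by auto
    have "same_block \<sigma> x y \<longleftrightarrow> a y = a x \<and> b y = b x"
      using assembly_same_block_iff[OF as ax(2-4), of y] uniq[OF y ax(1,3)] ab[OF y] by metis
    also have "\<dots> \<longleftrightarrow> w x = w y"
      using far[OF x, of y] far[OF y, of x] by (cases "a x" "a y" rule: linorder_cases) (auto simp: w_def)
    finally show "same_block \<sigma> x y \<longleftrightarrow> is' ! (x - 1) = is' ! (y - 1)" by (simp only: nth[OF x] nth[OF y])
    assume ne: "x \<noteq> y"
    have "neighbors \<sigma> x y \<longleftrightarrow> neighbors \<sigma> y x" using neighbors_sym by blast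
    also have "\<dots> \<longleftrightarrow> (\<exists>c<length (\<sigma> ! a x). (c + 1 = b x \<or> c = b x \<or> c = b x + 1) \<and> y \<in> \<sigma> ! a x ! c)"
      by (rule assembly_neighbors_iff[OF as ax(2-4) ne])
    also have "\<dots> \<longleftrightarrow> a y = a x \<and> (b y + 1 = b x \<or> b y = b x \<or> b y = b x + 1)"
      using uniq[OF y ax(1)] ab[OF y] by metis
    also have "\<dots> \<longleftrightarrow> w x \<le> w y + 1 \<and> w y \<le> w x + 1"
      using far[OF x, of y] far[OF y, of x] by (cases "a x" "a y" rule: linorder_cases) (auto simp: w_def)
    finally show "neighbors \<sigma> x y \<longleftrightarrow> is' ! (x - 1) \<le> is' ! (y - 1) + 1 \<and> is' ! (y - 1) \<le> is' ! (x - 1) + 1"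
      by (simp only: nth[OF x] nth[OF y])
  qed (simp add: is'_def)
  moreover have "length is' = m" "set is' \<subseteq> {1..n}" using w_pos w_n by (auto simp: is'_def)
  ultimately show ?thesis by blast
qed

text \<open>The assembly of a word has one ordered partition for every maximal interval \<open>{v..<v + len v}\<close>
  of letters that occur.\<close>

lemma assembly_of_word:
  assumes len_is: "length is = m" and V: "set is \<subseteq> {1..n}"
  shows "\<exists>\<sigma>\<in>AOP n m. codes m \<sigma> is"
proof -
  define V where "V = set is"
  \<comment> \<open>First letters of maximal runs. Letters are positive, so for \<open>v = 1\<close>
    the predecessor 0 is correctly not a letter.\<close>
  define S where "S = {v \<in> V. v - 1 \<notin> V}"
  define len where "len v = (LEAST l. v + l \<notin> V)" for v
  define X where "X u = {x \<in> {1..m}. is ! (x - 1) = u}" for u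
  have Vn: "V \<subseteq> {1..n}" using V by (simp add: V_def)
  have finS: "finite S" "S \<subseteq> V" by (auto simp: S_def V_def)
  have letter: "is ! (x - 1) \<in> V" if "x \<in> {1..m}" for x
    using that len_is by (auto simp: V_def)
  have X_ne: "X u \<noteq> {}" if "u \<in> V" for u
  proof -
    obtain i where "i < m" "is ! i = u" using \<open>u \<in> V\<close> len_is by (auto simp: V_def in_set_conv_nth)
    then have "Suc i \<in> X u" by (simp add: X_def)
    then show ?thesis by blast
  qed
  have end_run: "v + len v \<notin> V" for v
    unfolding len_def
  proof (rule LeastI)
    show "v + Suc n \<notin> V" using Vn by auto
  qed
  have in_run: "v + l \<in> V" if "l < len v" for v l
    using not_less_Least[of l "\<lambda>l. v + l \<notin> V"] that unfolding len_def by blast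
  have run_exists: "\<exists>v\<in>S. v \<le> p \<and> p < v + len v" if "p \<in> V" for p
    using that
  proof (induction p rule: less_induct)
    case (less p)
    have p1: "1 \<le> p" using less.prems Vn by auto
    show ?case
    proof (cases "p - 1 \<in> V")
      case False
      then have "p \<in> S" using less.prems by (simp add: S_def)
      moreover have "0 < len p" using end_run[of p] less.prems by (cases "len p") auto
      ultimately show ?thesis by (intro bexI[of _ p]) auto
    next
      case True
      then obtain v where v: "v \<in> S" "v \<le> p - 1" "p - 1 < v + len v" using less.IH[of "p - 1"] p1 by auto
      moreover have "p \<noteq> v + len v" using end_run[of v] less.prems by auto
      ultimately show ?thesis using p1 by (intro bexI[of _ v]) auto
    qed
  qed
  \<comment> \<open>The inequality is strict because the letter \<open>v + len v\<close> does not
    occur; it separates the two runs.\<close>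
  have gap: "v + len v < v'" if v: "v \<in> S" "v' \<in> S" "v < v'" for v v'
  proof (rule ccontr)
    assume "\<not> v + len v < v'"
    moreover have "v' \<noteq> v + len v" using end_run[of v] v(2) by (auto simp: S_def)
    ultimately have "v' - 1 - v < len v" using v(3) by auto
    from in_run[OF this] have "v' - 1 \<in> V" using v(3) by simp
    then show False using v(2) by (simp add: S_def)
  qed
  define blk where "blk v = map X [v..<v + len v]" for v
  define \<sigma>0 where "\<sigma>0 = map blk (sorted_list_of_set S)"
  \<comment> \<open>The runs come in the order of their letters, whereas an assembly is ordered by
    the minima of the supports.\<close>
  define \<sigma> where "\<sigma> = sort_key (\<lambda>\<eta>. Min (support \<eta>)) \<sigma>0"
  have set0: "set \<sigma>0 = blk ` S" using finS by (simp add: \<sigma>0_def)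
  have set_\<sigma>: "set \<sigma> = blk ` S" using set0 by (simp add: \<sigma>_def)
  have mem_support: "x \<in> support (blk v) \<longleftrightarrow> x \<in> {1..m} \<and> v \<le> is ! (x - 1) \<and> is ! (x - 1) < v + len v" for x v
    by (auto simp: support_def blk_def X_def)
  have support_ne: "support (blk v) \<noteq> {}" if v: "v \<in> S" for v
  proof -
    have "0 < len v" using end_run[of v] v by (cases "len v") (auto simp: S_def)
    then have "X v \<subseteq> support (blk v)" by (auto simp: support_def blk_def intro!: bexI[of _ v])
    then show ?thesis using X_ne[of v] v by (auto simp: S_def)
  qed
  have support_unique: "v = v'" if "v \<in> S" "v' \<in> S" "x \<in> support (blk v)" "x \<in> support (blk v')" for v v' x
    using that gap[of v v'] gap[of v' v] unfolding mem_support by (cases v v' rule: linorder_cases) auto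
  have "assembly m \<sigma>"
    unfolding \<sigma>_def
  proof (rule assembly_sort)
    fix \<eta> assume "\<eta> \<in> set \<sigma>0"
    then obtain v where v: "\<eta> = blk v" "v \<in> S" using set0 by blast
    have "X u \<noteq> {}" if "u \<in> {v..<v + len v}" for u
      using in_run[of "u - v" v] that by (intro X_ne) auto
    then have "{} \<notin> X ` {v..<v + len v}" by (metis imageE)
    moreover have "sorted_wrt disjnt (map X [v..<v + len v])"
      unfolding sorted_wrt_map
      by (rule sorted_wrt_mono_rel[OF _ sorted_wrt_upt]) (auto simp: X_def disjnt_def)
    ultimately show "ordered_partition \<eta>" by (simp add: ordered_partition_def v blk_def)
  next
    show "partition_on {1..m} (support ` set \<sigma>0)"
      unfolding set0
    proof (rule partition_onI)
      show "\<Union> (support ` blk ` S) = {1..m}"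
        using run_exists letter by (auto simp: mem_support)
      show "disjnt p q" if "p \<in> support ` blk ` S" "q \<in> support ` blk ` S" "p \<noteq> q" for p q
        using that support_unique by (fastforce simp: disjnt_def)
      show "{} \<notin> support ` blk ` S" using support_ne by auto
    qed
  next
    have "inj_on (\<lambda>v. support (blk v)) S"
    proof (rule inj_onI)
      fix v v' assume v: "v \<in> S" "v' \<in> S" and eq: "support (blk v) = support (blk v')"
      obtain x where "x \<in> support (blk v)" using support_ne[OF v(1)] by blast
      then show "v = v'" using support_unique[OF v] eq by simp
    qed
    then show "distinct (map support \<sigma>0)"
      using finS by (simp add: \<sigma>0_def distinct_map comp_def)
  qed
  moreover have "(\<Sum>\<eta>\<leftarrow>\<sigma>. length \<eta>) + (length \<sigma> - 1) \<le> n"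
  proof -
    have "(\<Sum>\<eta>\<leftarrow>\<sigma>. length \<eta>) = (\<Sum>v\<leftarrow>sorted_list_of_set S. len v)"
      unfolding \<sigma>_def sum_list_length_sort by (simp add: \<sigma>0_def comp_def blk_def)
    also have "\<dots> = (\<Sum>v\<in>S. len v)"
      using finS by (simp add: sum_list_distinct_conv_sum_set)
    finally have 1: "(\<Sum>\<eta>\<leftarrow>\<sigma>. length \<eta>) = (\<Sum>v\<in>S. len v)" .
    have 2: "length \<sigma> = card S" using finS by (simp add: \<sigma>_def \<sigma>0_def)
    \<comment> \<open>Each run is counted with the missing letter behind it. These enlarged
      intervals are still disjoint and lie in \<open>{1..Suc n}\<close>; the extra 1 turns
      \<open>card S\<close> into the \<open>length \<sigma> - 1\<close> of the bound.\<close>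
    have "(\<Sum>v\<in>S. len v) + card S = (\<Sum>v\<in>S. card {v..v + len v})"
      by (simp add: sum.distrib flip: sum_Suc)
    also have "\<dots> = card (\<Union>v\<in>S. {v..v + len v})"
    proof (rule card_UN_disjoint[symmetric])
      show "\<forall>v\<in>S. \<forall>v'\<in>S. v \<noteq> v' \<longrightarrow> {v..v + len v} \<inter> {v'..v' + len v'} = {}"
      proof (intro ballI impI)
        fix v v' assume "v \<in> S" "v' \<in> S" "v \<noteq> v'"
        then show "{v..v + len v} \<inter> {v'..v' + len v'} = {}"
          using gap[of v v'] gap[of v' v] by (cases v v' rule: linorder_cases) auto
      qed
    qed (use finS in auto)
    also have "\<dots> \<le> card {1..Suc n}"
    proof (rule card_mono)
      have "{v..v + len v} \<subseteq> {1..Suc n}" if v: "v \<in> S" for v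
      proof -
        have "v \<in> {1..n}" using v finS Vn by blast
        moreover have "v + len v \<le> Suc n"
        proof (cases "len v")
          case (Suc l)
          then have "v + l \<in> V" using in_run[of l v] by simp
          then show ?thesis using Vn Suc by auto
        qed (use \<open>v \<in> {1..n}\<close> in auto)
        ultimately show ?thesis by auto
      qed
      then show "(\<Union>v\<in>S. {v..v + len v}) \<subseteq> {1..Suc n}" by blast
    qed simp
    finally have 3: "(\<Sum>v\<in>S. len v) + card S \<le> Suc n" by simp
    have "S = {} \<or> 0 < card S" using finS(1) by (simp add: card_gt_0_iff)
    then show ?thesis unfolding 1 2 using 3 by auto
  qed
  ultimately have "\<sigma> \<in> AOP n m" by (simp add: AOP_def)
  moreover have "codes m \<sigma> is"
  proof (rule codesI[OF len_is])
    fix x y assume x: "x \<in> {1..m}" and y: "y \<in> {1..m}"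
    define p q where "p = is ! (x - 1)" and "q = is ! (y - 1)"
    have nth_blk: "blk v ! b = X (v + b)" if "b < len v" for v b using that by (simp add: blk_def)
    have len_blk: "length (blk v) = len v" for v by (simp add: blk_def)
    obtain v where v: "v \<in> S" "v \<le> p" "p < v + len v" using run_exists[OF letter[OF x]] unfolding p_def by blast
    obtain v' where v': "v' \<in> S" "v' \<le> q" "q < v' + len v'" using run_exists[OF letter[OF y]] unfolding q_def by blast
    have xX: "x \<in> X u \<longleftrightarrow> u = p" and yX: "y \<in> X u \<longleftrightarrow> u = q" for u
      using x y by (auto simp: X_def p_def q_def)
    have "same_block \<sigma> x y \<longleftrightarrow> p = q"
    proof
      assume "same_block \<sigma> x y"
      then show "p = q" unfolding same_block_def set_\<sigma> by (auto simp: nth_blk len_blk xX yX)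
    next
      assume "p = q"
      then show "same_block \<sigma> x y"
        unfolding same_block_def set_\<sigma> using v
        by (auto simp: nth_blk len_blk xX yX intro!: bexI[of _ v] exI[of _ "p - v"])
    qed
    then show "same_block \<sigma> x y \<longleftrightarrow> is ! (x - 1) = is ! (y - 1)" by (simp add: p_def q_def)
    assume "x \<noteq> y"
    have "neighbors \<sigma> x y \<longleftrightarrow> p \<le> q + 1 \<and> q \<le> p + 1"
    proof
      assume "neighbors \<sigma> x y"
      then show "p \<le> q + 1 \<and> q \<le> p + 1"
        unfolding neighbors_def set_\<sigma> by (auto simp: nth_blk len_blk xX yX)
    next
      assume near: "p \<le> q + 1 \<and> q \<le> p + 1"
      \<comment> \<open>Letters of different runs are at distance at least 2.\<close>
      have "v = v'"
        using near v v' gap[of v v'] gap[of v' v] by (cases v v' rule: linorder_cases) auto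
      then have "q - v < length (blk v)" "p - v < length (blk v)" "y \<in> blk v ! (q - v)" "x \<in> blk v ! (p - v)"
        "p - v + 1 = q - v \<or> p - v = q - v \<or> p - v = q - v + 1"
        using v v' near by (auto simp: nth_blk len_blk xX yX)
      then show "neighbors \<sigma> x y"
        unfolding neighbors_def set_\<sigma> using v(1) \<open>x \<noteq> y\<close> by blast
    qed
    then show "neighbors \<sigma> x y \<longleftrightarrow> is ! (x - 1) \<le> is ! (y - 1) + 1 \<and> is ! (y - 1) \<le> is ! (x - 1) + 1"
      by (simp add: p_def q_def)
  qed
  ultimately show ?thesis by blast
qed

section \<open>Words up to isomorphism of their manifolds\<close>

lemma bott_bs_matrix: "length is = m \<Longrightarrow> bott m (bs_matrix is)"
  by unfold_locales (auto simp: bs_matrix_def)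

lemma bs_isomorphic_iff:
  assumes "length is = m" "length js = m"
  shows "toric_isomorphic (bott_manifold (bs_matrix is)) (bott_manifold (bs_matrix js)) \<longleftrightarrow>
    (\<exists>\<pi>. bij_betw \<pi> {..<m} {..<m} \<and>
      (\<forall>j<m. \<forall>k<m. bs_matrix is $$ (j, k) = bs_matrix js $$ (\<pi> j, \<pi> k)))"
proof
  assume "toric_isomorphic (bott_manifold (bs_matrix is)) (bott_manifold (bs_matrix js))"
  then obtain L L' where "lattice_iso m (bs_matrix is) (bs_matrix js) L L'"
    using toric_isomorphic_lattice_iso bott_bs_matrix assms by blast
  then show "\<exists>\<pi>. bij_betw \<pi> {..<m} {..<m} \<and>
      (\<forall>j<m. \<forall>k<m. bs_matrix is $$ (j, k) = bs_matrix js $$ (\<pi> j, \<pi> k))"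
    \<comment> \<open>Off the diagonal only -2, 0 and 1 occur, and of these only 0 has its negative
      in the list.\<close>
    by (rule lattice_iso.permuted_entries) (auto simp: bs_matrix_def assms split: if_splits)
next
  assume "\<exists>\<pi>. bij_betw \<pi> {..<m} {..<m} \<and>
      (\<forall>j<m. \<forall>k<m. bs_matrix is $$ (j, k) = bs_matrix js $$ (\<pi> j, \<pi> k))"
  then show "toric_isomorphic (bott_manifold (bs_matrix is)) (bott_manifold (bs_matrix js))"
    using permuted_bott_isomorphic bott_bs_matrix assms by blast
qed

text \<open>A relation that is total on both sides and compatible with \<open>r\<close> and
  \<open>s\<close> replaces a choice of representatives. That \<open>s\<close> behaves as an
  equivalence relation on \<open>B\<close> is inherited from \<open>r\<close>, which spares
  composing toric isomorphisms.\<close>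

lemma quotients_bij_betw:
  assumes r: "equiv A r" and s: "s \<subseteq> B \<times> B"
    and left: "\<And>a. a \<in> A \<Longrightarrow> \<exists>b\<in>B. C a b" and right: "\<And>b. b \<in> B \<Longrightarrow> \<exists>a\<in>A. C a b"
    and compat: "\<And>a a' b b'. a \<in> A \<Longrightarrow> a' \<in> A \<Longrightarrow> b \<in> B \<Longrightarrow> b' \<in> B \<Longrightarrow> C a b \<Longrightarrow> C a' b' \<Longrightarrow>
      (a, a') \<in> r \<longleftrightarrow> (b, b') \<in> s"
  shows "\<exists>f. bij_betw f (A // r) (B // s)"
proof -
  define f where "f Q = {b \<in> B. \<exists>a\<in>Q. C a b}" for Q
  have rA: "r \<subseteq> A \<times> A" and rr: "\<And>a. a \<in> A \<Longrightarrow> (a, a) \<in> r"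
    using r by (auto simp: equiv_def refl_on_def)
  have f: "f (r `` {a}) = s `` {b}" if ab: "a \<in> A" "b \<in> B" "C a b" for a b
  proof -
    have "b' \<in> f (r `` {a}) \<longleftrightarrow> (b, b') \<in> s" if "b' \<in> B" for b'
      using compat[OF ab(1) _ ab(2) that ab(3)] right[OF that] rA that unfolding f_def by blast
    then show ?thesis using s unfolding f_def by blast
  qed
  have "bij_betw f (A // r) (B // s)"
  proof (rule bij_betw_imageI)
    show "inj_on f (A // r)"
    proof (rule inj_onI)
      fix Q Q' assume "Q \<in> A // r" "Q' \<in> A // r" and eq: "f Q = f Q'"
      then obtain a a' where a: "a \<in> A" "Q = r `` {a}" "a' \<in> A" "Q' = r `` {a'}" by (auto elim!: quotientE)
      obtain b b' where b: "b \<in> B" "C a b" "b' \<in> B" "C a' b'" using left a by metis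
      have "s `` {b} = s `` {b'}" using eq f a b by simp
      moreover have "(b', b') \<in> s" using compat[of a' a' b' b'] rr a b by blast
      ultimately have "(a, a') \<in> r" using compat[of a a' b b'] a b by blast
      then show "Q = Q'" using a r equiv_class_eq by metis
    qed
    show "f ` (A // r) = B // s"
    proof (intro equalityI subsetI)
      fix R assume "R \<in> f ` (A // r)"
      then obtain a where a: "a \<in> A" "R = f (r `` {a})" by (auto elim!: quotientE)
      then show "R \<in> B // s" using left[OF a(1)] f by (auto intro: quotientI)
    next
      fix R assume "R \<in> B // s"
      then obtain b where b: "b \<in> B" "R = s `` {b}" by (auto elim!: quotientE)
      obtain a where "a \<in> A" "C a b" using right[OF b(1)] by blast
      then show "R \<in> f ` (A // r)" using f b quotientI[of a A r] by (intro image_eqI) auto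
    qed
  qed
  then show ?thesis by blast
qed

theorem theorem1p3:
  fixes n m :: nat
  assumes "1 \<le> n" and "1 \<le> m"
  shows "\<exists>f. bij_betw f (bs_manifolds n m // bs_iso_rel n m) (AOP n m // approx_rel n m)"
proof -
  let ?C = "\<lambda>\<sigma> X. \<exists>is. length is = m \<and> set is \<subseteq> {1..n} \<and> X = bott_manifold (bs_matrix is) \<and> codes m \<sigma> is"
  have "\<exists>f. bij_betw f (AOP n m // approx_rel n m) (bs_manifolds n m // bs_iso_rel n m)"
  proof (rule quotients_bij_betw[where C = ?C])
    show "equiv (AOP n m) (approx_rel n m)" by (rule approx_rel_equiv)
    show "bs_iso_rel n m \<subseteq> bs_manifolds n m \<times> bs_manifolds n m" by (auto simp: bs_iso_rel_def)
    show "\<exists>X\<in>bs_manifolds n m. ?C \<sigma> X" if "\<sigma> \<in> AOP n m" for \<sigma>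
      using word_of_assembly[OF that] unfolding bs_manifolds_def by blast
    show "\<exists>\<sigma>\<in>AOP n m. ?C \<sigma> X" if "X \<in> bs_manifolds n m" for X
      using that assembly_of_word unfolding bs_manifolds_def by blast
  next
    fix \<sigma> \<tau> X Y
    assume \<sigma>: "\<sigma> \<in> AOP n m" "\<tau> \<in> AOP n m" and X: "X \<in> bs_manifolds n m" "Y \<in> bs_manifolds n m"
      and C: "?C \<sigma> X" "?C \<tau> Y"
    obtain "is" js where "is": "length is = m" "X = bott_manifold (bs_matrix is)" "codes m \<sigma> is"
      and js: "length js = m" "Y = bott_manifold (bs_matrix js)" "codes m \<tau> js"
      using C by blast
    have "(X, Y) \<in> bs_iso_rel n m \<longleftrightarrow> toric_isomorphic X Y" using X by (simp add: bs_iso_rel_def)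
    also have "\<dots> \<longleftrightarrow> (\<exists>\<pi>. bij_betw \<pi> {..<m} {..<m} \<and>
        (\<forall>j<m. \<forall>k<m. bs_matrix is $$ (j, k) = bs_matrix js $$ (\<pi> j, \<pi> k)))"
      unfolding "is"(2) js(2) by (rule bs_isomorphic_iff[OF "is"(1) js(1)])
    also have "\<dots> \<longleftrightarrow> perm_equiv m \<sigma> \<tau>"
    proof -
      have "\<pi> j < m" if "bij_betw \<pi> {..<m} {..<m}" "j < m" for \<pi> :: "nat \<Rightarrow> nat" and j
        using that by (auto simp: bij_betw_def)
      then show ?thesis
        using "is"(3) js(3) unfolding codes_def perm_equiv_def by (auto 0 4)
    qed
    also have "\<dots> \<longleftrightarrow> (\<sigma>, \<tau>) \<in> approx_rel n m" using \<sigma> by (simp add: approx_rel_iff)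
    finally show "(\<sigma>, \<tau>) \<in> approx_rel n m \<longleftrightarrow> (X, Y) \<in> bs_iso_rel n m" by simp
  qed
  then show ?thesis using bij_betw_inv by blast
qed

end
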